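(* Let $G$ be a finite, simple, connected chordless graph with maximum degree $\Delta$. Then $a'(G)=\Delta$, unless $G$ is a cycle, in which case $a'(G)=\Delta+1=3$.
   Context: An edge $e=uv$ of a graph $G$ is a chord if $u$ and $v$ both lie on a common cycle of the graph $G\setminus e$ obtained by deleting the edge $e$. A graph is chordless if it contains no chord. A proper edge coloring is acyclic if it contains no bichromatic cycle, i.e., the union of any two color classes induces a linear forest (a disjoint union of paths). The acyclic chromatic index $a'(G)$ is the minimum number of colors in an acyclic edge coloring of $G$. *)

theory Defs
  imports Main
begin

text \<open>
  A graph is given by its vertex set \<open>V\<close> and its edge set \<open>E\<close>, an edge being the two-element
  set of its ends.
\<close>

locale finite_simple_graph =
  fixes V :: "'a set" and E :: "'a set set"
  assumes finite_vertices: "finite V"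
    and nonempty_vertices: "V \<noteq> {}"
    and edge_subset: "e \<in> E \<Longrightarrow> e \<subseteq> V"
    and edge_card: "e \<in> E \<Longrightarrow> card e = 2"

definition connected_graph :: "'a set \<Rightarrow> 'a set set \<Rightarrow> bool" where
  "connected_graph V E \<longleftrightarrow> (\<forall>u\<in>V. \<forall>v\<in>V. (u, v) \<in> {(x, y). {x, y} \<in> E}\<^sup>*)"

definition vertex_degree :: "'a set set \<Rightarrow> 'a \<Rightarrow> nat" where
  "vertex_degree E v = card {e \<in> E. v \<in> e}"

definition max_degree :: "'a set \<Rightarrow> 'a set set \<Rightarrow> nat" where
  "max_degree V E = Max (vertex_degree E ` V)"

text \<open>
  A cycle is represented by the list of its vertices in cyclic order.
\<close>

definition cycle_edges :: "'a list \<Rightarrow> 'a set set" where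
  "cycle_edges c = {{c ! i, c ! (Suc i mod length c)} | i. i < length c}"

definition cycle_in :: "'a set set \<Rightarrow> 'a list \<Rightarrow> bool" where
  "cycle_in E c \<longleftrightarrow> length c \<ge> 3 \<and> distinct c \<and> cycle_edges c \<subseteq> E"

definition cycle_graph :: "'a set \<Rightarrow> 'a set set \<Rightarrow> bool" where
  "cycle_graph V E \<longleftrightarrow> (\<exists>c. cycle_in E c \<and> set c = V \<and> cycle_edges c = E)"

definition chord :: "'a set set \<Rightarrow> 'a set \<Rightarrow> bool" where
  "chord E e \<longleftrightarrow> e \<in> E \<and> (\<exists>c. cycle_in (E - {e}) c \<and> e \<subseteq> set c)"

definition chordless :: "'a set set \<Rightarrow> bool" where
  "chordless E \<longleftrightarrow> (\<nexists>e. chord E e)"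

definition proper_edge_coloring :: "'a set set \<Rightarrow> ('a set \<Rightarrow> nat) \<Rightarrow> bool" where
  "proper_edge_coloring E col \<longleftrightarrow>
     (\<forall>e\<in>E. \<forall>f\<in>E. e \<noteq> f \<longrightarrow> e \<inter> f \<noteq> {} \<longrightarrow> col e \<noteq> col f)"

definition acyclic_edge_coloring :: "'a set set \<Rightarrow> ('a set \<Rightarrow> nat) \<Rightarrow> bool" where
  "acyclic_edge_coloring E col \<longleftrightarrow> proper_edge_coloring E col \<and>
     (\<nexists>c. cycle_in E c \<and> card (col ` cycle_edges c) = 2)"

definition acyclic_chromatic_index :: "'a set set \<Rightarrow> nat" where
  "acyclic_chromatic_index E =
     (LEAST k. \<exists>col. acyclic_edge_coloring E col \<and> col ` E \<subseteq> {..<k})"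

text \<open>
  An injective coloring is acyclic, because a cycle has at least three edges. Hence for finite
  graphs the minimum in the definition above is attained.
\<close>

lemma card_cycle_edges:
  assumes "length c \<ge> 3" "distinct c"
  shows "card (cycle_edges c) = length c"
proof -
  let ?n = "length c"
  let ?f = "\<lambda>i. {c ! i, c ! (Suc i mod ?n)}"
  have "inj_on ?f {..<?n}"
  proof (rule inj_onI)
    fix i j assume ij: "i \<in> {..<?n}" "j \<in> {..<?n}" and eq: "?f i = ?f j"
    have lt: "i < ?n" "j < ?n" "Suc i mod ?n < ?n" "Suc j mod ?n < ?n"
      using ij assms(1) by (auto intro: mod_less_divisor)
    have "i = j \<or> (i = Suc j mod ?n \<and> j = Suc i mod ?n)"
      using eq lt assms(2) by (auto simp: doubleton_eq_iff nth_eq_iff_index_eq)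
    moreover have "\<not> (i = Suc j mod ?n \<and> j = Suc i mod ?n)"
      using lt assms(1) by (auto simp: mod_Suc split: if_splits)
    ultimately show "i = j" by blast
  qed
  moreover have "cycle_edges c = ?f ` {..<?n}" by (auto simp: cycle_edges_def)
  ultimately show ?thesis by (simp add: card_image)
qed

lemma ex_acyclic_edge_coloring:
  assumes "finite E"
  shows "\<exists>k col. acyclic_edge_coloring E col \<and> col ` E \<subseteq> {..<k}"
proof -
  obtain col where col: "bij_betw col E {0..<card E}"
    using ex_bij_betw_finite_nat[OF assms] by blast
  then have inj: "inj_on col E" by (simp add: bij_betw_def)
  have "proper_edge_coloring E col"
    using inj by (auto simp: proper_edge_coloring_def dest: inj_onD)
  moreover have "card (col ` cycle_edges c) \<noteq> 2" if "cycle_in E c" for c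
  proof -
    have "card (col ` cycle_edges c) = length c"
      using that inj card_cycle_edges[of c]
      by (simp add: cycle_in_def card_image inj_on_subset)
    with that show ?thesis by (simp add: cycle_in_def)
  qed
  ultimately have "acyclic_edge_coloring E col" by (auto simp: acyclic_edge_coloring_def)
  moreover have "col ` E \<subseteq> {..<card E}" using col by (auto simp: bij_betw_def)
  ultimately show ?thesis by blast
qed

end

theory Submission
  imports Defs
begin

text \<open>
  Every edge \<open>uz\<close> of a chordless graph is separable: deleting it leaves a graph in which a single
  vertex \<open>w\<close> separates \<open>u\<close> from \<open>z\<close>, since otherwise \<open>u\<close> and \<open>z\<close> would lie on a common cycle
  (Menger for two paths). Separability passes to subgraphs and to contractions, so for \<open>k \<ge> 3\<close>
  and \<open>\<Delta> \<le> k\<close> one can show by induction on the number of edges that separable graphs have an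
  acyclic colouring with \<open>k\<close> colours. Colourings of two parts sharing one vertex are glued after
  permuting colours, and two adjacent vertices of degree 2 are contracted. Otherwise take an edge
  \<open>uz\<close> whose separation has a side \<open>A\<close> containing \<open>u\<close> with as few edges as possible (but at least
  two). By minimality every edge of \<open>A\<close> joins a hub (degree at least 3) to a vertex of degree 2.
  Colour the other side by induction, let \<open>c\<close> be a colour missing at \<open>z\<close>, to be used on \<open>uz\<close>, and
  colour \<open>A\<close> greedily, hub after hub, each hub except the last one, \<open>w\<close>, having a later
  hub at distance 2. In a star that meets earlier stars only in vertices of degree 2, a new
  two-coloured cycle can arise only from two edges whose colours are swapped at their far ends,
  which makes the greedy choice possible. The vertex \<open>w\<close> comes last so that one can arrange that
  no two-coloured path through \<open>A\<close> closes up with \<open>uz\<close>. Connected graphs with \<open>\<Delta> \<le> 2\<close> that are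
  not cycles have no cycles at all and are coloured leaf by leaf.
\<close>

section \<open>Degrees and two-coloured subgraphs\<close>

text \<open>The obstacle is the colour \<open>c\<close> of \<open>uz\<close>. Gluing permutes the
  colours of the far side, but the permutation has to fix \<open>c\<close>, which must stay absent
  at \<open>z\<close>. With \<Delta> = \<open>k\<close> there may be no spare colour at
  \<open>w\<close>: if both sides use \<open>c\<close> there, they clash; if neither does, up to
  \<open>k\<close> edges compete for \<open>k - 1\<close> colours. So the greedy colouring must use
  \<open>c\<close> at \<open>w\<close> exactly when the far side does not, and it comes in two
  versions. Avoiding \<open>c\<close> gives up a colour, which is affordable when the far side has
  two edges at \<open>w\<close>; when it has only one, that side is coloured through a contraction
  which keeps \<open>c\<close> away from \<open>w\<close>. A two-coloured cycle through
  \<open>uz\<close> would cross \<open>A\<close> from \<open>u\<close> to \<open>w\<close> in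
  colours \<open>c\<close> and \<open>d\<close> and continue on the far side. It is stopped when
  both \<open>c\<close> and \<open>d\<close> occur at \<open>w\<close> inside \<open>A\<close>, for
  then no far edge at \<open>w\<close> may have either colour. One place where
  \<open>k \<ge> 3\<close> is essential is undoing the contraction of two adjacent vertices of
  degree 2: a cycle through the restored path then meets three colours.\<close>

definition simple_edges :: "'a set set \<Rightarrow> bool" where
  "simple_edges E \<longleftrightarrow> finite E \<and> (\<forall>e\<in>E. card e = 2)"

text \<open>
  A two-coloured edge set of minimum degree 2 contains a two-coloured cycle. Stating acyclicity
  through degrees lets parity arguments replace reasoning about cycles as lists of vertices.
\<close>

definition bicycle_free :: "'a set set \<Rightarrow> ('a set \<Rightarrow> nat) \<Rightarrow> bool" where
  "bicycle_free E col \<longleftrightarrow> proper_edge_coloring E col \<and>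
     (\<forall>F a b. F \<subseteq> E \<longrightarrow> F \<noteq> {} \<longrightarrow> col ` F \<subseteq> {a, b} \<longrightarrow> (\<exists>v\<in>\<Union>F. vertex_degree F v < 2))"

lemma bicycle_free_empty:
  "bicycle_free E col \<Longrightarrow> F \<subseteq> E \<Longrightarrow> col ` F \<subseteq> {a, b} \<Longrightarrow>
    (\<And>v. v \<in> \<Union>F \<Longrightarrow> 2 \<le> vertex_degree F v) \<Longrightarrow> F = {}"
  unfolding bicycle_free_def by (meson not_le)

lemma bicycle_freeI:
  assumes "proper_edge_coloring E col"
    and "\<And>F a b. F \<subseteq> E \<Longrightarrow> F \<noteq> {} \<Longrightarrow> col ` F \<subseteq> {a, b} \<Longrightarrow>
      (\<And>v. v \<in> \<Union>F \<Longrightarrow> 2 \<le> vertex_degree F v) \<Longrightarrow> False"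
  shows "bicycle_free E col"
  unfolding bicycle_free_def using assms by (meson not_le)

lemma bicycle_free_proper: "bicycle_free E col \<Longrightarrow> proper_edge_coloring E col"
  unfolding bicycle_free_def by blast

lemma simple_edges_subset: "simple_edges E \<Longrightarrow> F \<subseteq> E \<Longrightarrow> simple_edges F"
  unfolding simple_edges_def using finite_subset by blast

lemma simple_edges_finite: "simple_edges E \<Longrightarrow> finite E"
  by (simp add: simple_edges_def)

lemma simple_edges_finite_Union: "simple_edges E \<Longrightarrow> finite (\<Union>E)"
  unfolding simple_edges_def by (metis card_ge_0_finite finite_Union zero_less_numeral)

lemma simple_edges_other:
  assumes "simple_edges E" "e \<in> E" "v \<in> e"
  obtains x where "e = {v, x}" "x \<noteq> v"
proof -
  obtain p q where "e = {p, q}" "p \<noteq> q"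
    using assms(1,2) unfolding simple_edges_def by (meson card_2_iff)
  then show ?thesis using assms(3) that[of p] that[of q] by auto
qed

lemma simple_edges_nonempty: "simple_edges E \<Longrightarrow> e \<in> E \<Longrightarrow> \<exists>u v. e = {u, v} \<and> u \<noteq> v"
  unfolding simple_edges_def by (meson card_2_iff)

lemma simple_edge_doubleton: "simple_edges E \<Longrightarrow> {u, v} \<in> E \<Longrightarrow> u \<noteq> v"
  unfolding simple_edges_def by force

text \<open>A common edge would bring two distinct vertices into \<open>{w}\<close>. Separations can
  therefore be stated by their vertices alone.\<close>

lemma sep_disjoint:
  assumes "simple_edges X" "\<Union>X \<inter> \<Union>Y \<subseteq> {w}"
  shows "X \<inter> Y = {}"
proof (rule ccontr)
  assume "X \<inter> Y \<noteq> {}"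
  then obtain e where e: "e \<in> X" "e \<in> Y" by blast
  with assms(1) obtain u v where uv: "e = {u, v}" "u \<noteq> v" using simple_edges_nonempty by blast
  then have "u \<in> \<Union>X \<inter> \<Union>Y" "v \<in> \<Union>X \<inter> \<Union>Y" using e by auto
  then show False using assms(2) uv(2) by blast
qed

lemma vertex_degree_mono: "finite F \<Longrightarrow> G \<subseteq> F \<Longrightarrow> vertex_degree G v \<le> vertex_degree F v"
  unfolding vertex_degree_def by (rule card_mono) auto

lemma vertex_degree_pos: "finite F \<Longrightarrow> 0 < vertex_degree F v \<longleftrightarrow> v \<in> \<Union>F"
  unfolding vertex_degree_def card_gt_0_iff by auto

lemma vertex_degree_0: "v \<notin> \<Union>F \<Longrightarrow> vertex_degree F v = 0"
proof -
  assume "v \<notin> \<Union>F"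
  then have "{e \<in> F. v \<in> e} = {}" by auto
  then show ?thesis unfolding vertex_degree_def by (simp only: card.empty)
qed

lemma vertex_degree_cong:
  "(\<And>e. v \<in> e \<Longrightarrow> e \<in> F \<longleftrightarrow> e \<in> G) \<Longrightarrow> vertex_degree F v = vertex_degree G v"
  unfolding vertex_degree_def by (rule arg_cong[of _ _ card]) blast

lemma vertex_degree_insert:
  "finite F \<Longrightarrow> e \<notin> F \<Longrightarrow> vertex_degree (insert e F) v = vertex_degree F v + (if v \<in> e then 1 else 0)"
proof -
  assume a: "finite F" "e \<notin> F"
  have "{x \<in> insert e F. v \<in> x} = (if v \<in> e then insert e {x \<in> F. v \<in> x} else {x \<in> F. v \<in> x})" by auto
  then show ?thesis using a by (simp add: vertex_degree_def)
qed

lemma vertex_degree_Un: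
  "finite X \<Longrightarrow> finite Y \<Longrightarrow> X \<inter> Y = {} \<Longrightarrow> vertex_degree (X \<union> Y) v = vertex_degree X v + vertex_degree Y v"
proof -
  assume a: "finite X" "finite Y" "X \<inter> Y = {}"
  have "{e \<in> X \<union> Y. v \<in> e} = {e \<in> X. v \<in> e} \<union> {e \<in> Y. v \<in> e}" by auto
  moreover have "{e \<in> X. v \<in> e} \<inter> {e \<in> Y. v \<in> e} = {}" using a(3) by blast
  ultimately show ?thesis unfolding vertex_degree_def using a(1,2) by (simp add: card_Un_disjoint)
qed

lemma vertex_degree_ge2_other:
  assumes "2 \<le> vertex_degree F v"
  obtains e' where "e' \<in> F" "v \<in> e'" "e' \<noteq> e"
proof -
  have "\<not> {e \<in> F. v \<in> e} \<subseteq> {e}"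
  proof
    assume "{e \<in> F. v \<in> e} \<subseteq> {e}"
    then have "card {e \<in> F. v \<in> e} \<le> 1" using card_mono[of "{e}"] by force
    then show False using assms by (simp add: vertex_degree_def)
  qed
  then show ?thesis using that by blast
qed

lemma vertex_degree_ge2I:
  assumes "finite F" "e \<in> F" "e' \<in> F" "v \<in> e" "v \<in> e'" "e \<noteq> e'"
  shows "2 \<le> vertex_degree F v"
proof -
  have "card {e, e'} \<le> card {e \<in> F. v \<in> e}" using assms by (intro card_mono) auto
  then show ?thesis using assms by (simp add: vertex_degree_def)
qed

lemma vertex_degree_lt2_unique:
  assumes "finite F" "vertex_degree F v < 2" "e \<in> F" "f \<in> F" "v \<in> e" "v \<in> f"
  shows "f = e"
  using vertex_degree_ge2I[OF assms(1,3-6)] assms(2) by force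

lemma vertex_degree_1E:
  assumes "vertex_degree F v = 1"
  obtains e where "e \<in> F" "v \<in> e" "\<And>e'. e' \<in> F \<Longrightarrow> v \<in> e' \<Longrightarrow> e' = e"
proof -
  obtain e where "{e \<in> F. v \<in> e} = {e}" using assms unfolding vertex_degree_def
    by (metis card_1_singletonE)
  then show ?thesis using that by blast
qed

lemma vertex_degree_2E:
  assumes "vertex_degree F v = 2" "e \<in> F" "v \<in> e"
  obtains e' where "e' \<in> F" "v \<in> e'" "e' \<noteq> e" "\<And>e''. e'' \<in> F \<Longrightarrow> v \<in> e'' \<Longrightarrow> e'' = e \<or> e'' = e'"
proof -
  obtain p q where pq: "{e \<in> F. v \<in> e} = {p, q}" "p \<noteq> q" using assms(1) unfolding vertex_degree_def
    by (meson card_2_iff)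
  have e: "e = p \<or> e = q" using pq assms by blast
  have m: "\<And>x. x \<in> F \<and> v \<in> x \<longleftrightarrow> x = p \<or> x = q" using pq(1) by auto
  show ?thesis
  proof (cases "e = p")
    case True then show ?thesis using that[of q] m pq(2) by blast
  next
    case False then show ?thesis using that[of p] m pq(2) e by blast
  qed
qed

lemma proper_edge_coloring_subset:
  "proper_edge_coloring E col \<Longrightarrow> F \<subseteq> E \<Longrightarrow> proper_edge_coloring F col"
  unfolding proper_edge_coloring_def by blast

lemma proper_inj_star:
  "proper_edge_coloring E col \<Longrightarrow> inj_on col {e \<in> E. v \<in> e}"
  unfolding proper_edge_coloring_def inj_on_def by blast

lemma proper_card_star:
  "proper_edge_coloring E col \<Longrightarrow> card (col ` {e \<in> E. v \<in> e}) = vertex_degree E v"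
  unfolding vertex_degree_def by (rule card_image[OF proper_inj_star])

lemma proper_bicolored_degree:
  assumes "proper_edge_coloring F col" "col ` F \<subseteq> {a, b}"
  shows "vertex_degree F v \<le> 2"
proof -
  have "card (col ` {e \<in> F. v \<in> e}) \<le> card {a, b}" using assms(2) by (intro card_mono) auto
  then show ?thesis using proper_card_star[OF assms(1), of v] card_insert_le_m1[of 2 "{b}" a] by simp
qed

lemma handshake:
  assumes "simple_edges F"
  shows "(\<Sum>v\<in>\<Union>F. vertex_degree F v) = 2 * card F"
proof -
  have fin: "finite F" "finite (\<Union>F)" using assms simple_edges_finite simple_edges_finite_Union by auto
  have "(\<Sum>v\<in>\<Union>F. vertex_degree F v) = (\<Sum>v\<in>\<Union>F. \<Sum>e\<in>F. if v \<in> e then 1 else 0)"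
    unfolding vertex_degree_def using fin by (intro sum.cong refl) (simp add: sum.If_cases Int_def)
  also have "\<dots> = (\<Sum>e\<in>F. \<Sum>v\<in>\<Union>F. if v \<in> e then 1 else 0)" by (rule sum.swap)
  also have "\<dots> = (\<Sum>e\<in>F. 2)"
  proof (rule sum.cong[OF refl])
    fix e assume e: "e \<in> F"
    then have "\<Union>F \<inter> e = e" by auto
    moreover have "card e = 2" using assms e by (simp add: simple_edges_def)
    ultimately show "(\<Sum>v\<in>\<Union>F. if v \<in> e then 1 else 0) = (2::nat)"
      using fin by (simp add: sum.If_cases)
  qed
  finally show ?thesis by simp
qed

text \<open>Handshake parity. It replaces walking along a path: once one end of odd degree is known,
  a second odd vertex must exist, and the other degrees tell where it is.\<close>

lemma odd_vertex_pair:
  assumes "simple_edges F" "odd (vertex_degree F x)"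
  obtains y where "y \<noteq> x" "odd (vertex_degree F y)"
proof (rule ccontr)
  assume "\<not> thesis"
  then have ev: "\<And>y. y \<noteq> x \<Longrightarrow> even (vertex_degree F y)" using that by blast
  have x: "x \<in> \<Union>F" using assms(2) by (metis even_zero vertex_degree_0)
  have "(\<Sum>v\<in>\<Union>F. vertex_degree F v) = vertex_degree F x + (\<Sum>v\<in>\<Union>F - {x}. vertex_degree F v)"
    using simple_edges_finite_Union[OF assms(1)] x by (rule sum.remove)
  moreover have "even (\<Sum>v\<in>\<Union>F - {x}. vertex_degree F v)" using ev by (intro dvd_sum) auto
  ultimately show False using handshake[OF assms(1)] assms(2)
    by (metis dvd_triv_left even_add)
qed

text \<open>
  In a properly two-coloured edge set all degrees are at most 2, so there \<open>links F x y\<close> means that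
  \<open>F\<close> is a path from \<open>x\<close> to \<open>y\<close>, possibly together with some cycles.
\<close>

definition links :: "'a set set \<Rightarrow> 'a \<Rightarrow> 'a \<Rightarrow> bool" where
  "links F x y \<longleftrightarrow> vertex_degree F x = 1 \<and> vertex_degree F y = 1 \<and>
     (\<forall>v\<in>\<Union>F - {x, y}. 2 \<le> vertex_degree F v)"

lemma links_sym: "links F x y \<Longrightarrow> links F y x"
  unfolding links_def by (metis insert_commute)

lemma links_ge2: "links F x y \<Longrightarrow> v \<in> \<Union>F \<Longrightarrow> v \<noteq> x \<Longrightarrow> v \<noteq> y \<Longrightarrow> 2 \<le> vertex_degree F v"
  unfolding links_def by blast

text \<open>Only one path of \<open>K\<close> starts at \<open>x\<close>. Instead of following it,
  parity is used in \<open>F \<inter> F'\<close>: \<open>x\<close> is odd there, so some other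
  vertex is odd too. But a vertex of degree 2 in both sets has all its \<open>K\<close>-edges in
  both, and an end of only one of the sets would need degree 2 in the other.\<close>

lemma links_unique:
  assumes K: "simple_edges K" and deg: "\<And>v. vertex_degree K v \<le> 2"
    and F: "F \<subseteq> K" "links F x y" and F': "F' \<subseteq> K" "links F' x y'"
    and ends: "vertex_degree K x \<le> 1" "vertex_degree K y \<le> 1" "vertex_degree K y' \<le> 1"
    and xy: "x \<noteq> y" "x \<noteq> y'"
  shows "y = y'"
proof (rule ccontr)
  assume ne: "y \<noteq> y'"
  note finK = simple_edges_finite[OF K]
  have full: "{e \<in> G. v \<in> e} = {e \<in> K. v \<in> e}"
    if "G \<subseteq> K" "vertex_degree K v \<le> vertex_degree G v" for G v
  proof (rule card_seteq)
    show "finite {e \<in> K. v \<in> e}" using finK by simp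
    show "{e \<in> G. v \<in> e} \<subseteq> {e \<in> K. v \<in> e}" using that(1) by blast
    show "card {e \<in> K. v \<in> e} \<le> card {e \<in> G. v \<in> e}" using that(2) unfolding vertex_degree_def .
  qed
  have meet: "vertex_degree (F \<inter> F') v = vertex_degree K v"
    if "vertex_degree K v \<le> vertex_degree F v" "vertex_degree K v \<le> vertex_degree F' v" for v
  proof -
    have "{e \<in> F \<inter> F'. v \<in> e} = {e \<in> K. v \<in> e}"
      using full[OF F(1) that(1)] full[OF F'(1) that(2)] by blast
    then show ?thesis by (simp add: vertex_degree_def)
  qed
  have Fx: "vertex_degree F x = 1" "vertex_degree F' x = 1" using F(2) F'(2) unfolding links_def by blast+
  have "vertex_degree K x = 1" using vertex_degree_mono[OF finK F(1), of x] Fx(1) ends(1) by linarith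
  then have "odd (vertex_degree (F \<inter> F') x)" using meet[of x] Fx by simp
  then obtain v where v: "v \<noteq> x" "odd (vertex_degree (F \<inter> F') v)"
    using odd_vertex_pair[of "F \<inter> F'" x] simple_edges_subset[OF K, of "F \<inter> F'"] F(1) by blast
  have "v \<in> \<Union>(F \<inter> F')" by (rule ccontr) (use v(2) vertex_degree_0[of v "F \<inter> F'"] in simp)
  then have vF: "v \<in> \<Union>F" "v \<in> \<Union>F'" by blast+
  have small: "\<not> 2 \<le> vertex_degree G t" if "G \<subseteq> K" "vertex_degree K t \<le> 1" for G t
    using vertex_degree_mono[OF finK that(1), of t] that(2) by linarith
  have "v \<noteq> y" using links_ge2[OF F'(2) vF(2) v(1)] small[OF F'(1) ends(2)] ne by metis
  moreover have "v \<noteq> y'" using links_ge2[OF F(2) vF(1) v(1)] small[OF F(1) ends(3)] ne by metis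
  ultimately have "2 \<le> vertex_degree F v" "2 \<le> vertex_degree F' v"
    using links_ge2[OF F(2) vF(1) v(1)] links_ge2[OF F'(2) vF(2) v(1)] by auto
  then have "vertex_degree (F \<inter> F') v = vertex_degree K v" "vertex_degree K v = 2"
    using meet[of v] deg[of v] vertex_degree_mono[OF finK F(1), of v] by linarith+
  then show False using v(2) by simp
qed

section \<open>Colouring the star of a vertex\<close>

text \<open>
  The star is indexed by its outer vertices \<open>i\<close>; \<open>f i\<close> is the colour of the other edge at \<open>i\<close>, if
  that edge is already coloured, and \<open>R i j\<close> says that a two-coloured path joins \<open>i\<close> to \<open>j\<close> outside
  the star, so that swapping the colours at \<open>i\<close> and \<open>j\<close> would close a cycle.
\<close>

definition star_assignment ::
  "'i set \<Rightarrow> nat set \<Rightarrow> ('i \<Rightarrow> nat option) \<Rightarrow> ('i \<Rightarrow> 'i \<Rightarrow> bool) \<Rightarrow> ('i \<Rightarrow> nat) \<Rightarrow> bool" where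
  "star_assignment I L f R a \<longleftrightarrow> inj_on a I \<and> a ` I \<subseteq> L \<and> (\<forall>i\<in>I. f i \<noteq> Some (a i)) \<and>
     (\<forall>i\<in>I. \<forall>j\<in>I. f i = Some (a j) \<longrightarrow> f j = Some (a i) \<longrightarrow> \<not> R i j)"

lemma star_assignment_empty: "star_assignment {} L f R a"
  by (simp add: star_assignment_def)

lemma star_assignment_insert:
  assumes a: "star_assignment J L f R a" and J: "finite J" "i \<notin> J" and L: "finite L"
    and R: "\<And>x y. R x y \<Longrightarrow> R y x"
    and card: "card J + 1 < card L \<or> f i = None \<and> card J < card L"
  obtains b where "star_assignment (insert i J) L f R (a(i := b))"
proof -
  have inj: "inj_on a J" using a by (simp add: star_assignment_def)
  obtain X where X: "finite X" "card X \<le> 1" "f i = None \<Longrightarrow> X = {}"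
    "\<And>p. f i = Some p \<Longrightarrow> p \<notin> a ` J \<Longrightarrow> p \<in> X"
    "\<And>j q. j \<in> J \<Longrightarrow> f i = Some (a j) \<Longrightarrow> f j = Some q \<Longrightarrow> q \<in> X"
  proof (cases "f i")
    case None
    then show ?thesis using that[of "{}"] by simp
  next
    case (Some p)
    show ?thesis
    proof (cases "p \<in> a ` J")
      case True
      then obtain j where j: "j \<in> J" "p = a j" by blast
      have "card (set_option (f j)) \<le> 1" by (cases "f j") auto
      moreover have "finite (set_option (f j))" by (cases "f j") auto
      moreover have "q \<in> set_option (f j)" if "j' \<in> J" "f i = Some (a j')" "f j' = Some q" for j' q
        using that j Some inj_onD[OF inj, of j' j] by auto
      ultimately show ?thesis using that[of "set_option (f j)"] Some True by simp
    next
      case False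
      then show ?thesis using that[of "{p}"] Some by auto
    qed
  qed
  have "card (a ` J \<union> X) \<le> card J + card X"
    using card_Un_le[of "a ` J" X] card_image_le[OF J(1), of a] by linarith
  also have "\<dots> < card L" using card X(2,3) by (cases "f i = None") auto
  finally have "\<not> L \<subseteq> a ` J \<union> X" using card_mono[of "a ` J \<union> X" L] J X(1) by auto
  then obtain b where b: "b \<in> L" "b \<notin> a ` J" "b \<notin> X" by blast
  have fi: "f i \<noteq> Some b" using X(4)[of b] b by auto
  have sw: "\<not> (f i = Some (a j) \<and> f j = Some b)" if "j \<in> J" for j using X(5)[OF that] b(3) by blast
  have "star_assignment (insert i J) L f R (a(i := b))"
    unfolding star_assignment_def
  proof (intro conjI ballI impI)
    show "inj_on (a(i := b)) (insert i J)" using inj b(2) J(2) by (auto simp: inj_on_def)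
    show "(a(i := b)) ` insert i J \<subseteq> L" using a b(1) J(2) by (auto simp: star_assignment_def)
    show "f x \<noteq> Some ((a(i := b)) x)" if "x \<in> insert i J" for x
      using that a fi by (auto simp: star_assignment_def)
    show "\<not> R x y" if "x \<in> insert i J" "y \<in> insert i J"
      "f x = Some ((a(i := b)) y)" "f y = Some ((a(i := b)) x)" for x y
      using that a sw fi by (auto simp: star_assignment_def split: if_splits)
  qed
  then show ?thesis using that by blast
qed

lemma star_assignment_extend_less:
  assumes a: "star_assignment J L f R a" and I: "finite I" "J \<subseteq> I" and L: "finite L" "card I < card L"
    and R: "\<And>x y. R x y \<Longrightarrow> R y x"
  obtains a' where "star_assignment I L f R a'" "\<And>j. j \<in> J \<Longrightarrow> a' j = a j"
proof -
  have "\<exists>a'. star_assignment (J \<union> M) L f R a' \<and> (\<forall>j\<in>J. a' j = a j)"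
    if "finite M" "M \<inter> J = {}" "card (J \<union> M) < card L" for M
    using that
  proof (induction M)
    case empty
    then show ?case using a by auto
  next
    case (insert x M)
    have fin: "finite (J \<union> M)" using I insert(1) finite_subset by blast
    have x: "x \<notin> J \<union> M" using insert by auto
    then have c: "card (J \<union> M) + 1 < card L" using insert(5) fin by simp
    then obtain a' where a': "star_assignment (J \<union> M) L f R a'" "\<forall>j\<in>J. a' j = a j"
      using insert by auto
    obtain b where b: "star_assignment (insert x (J \<union> M)) L f R (a'(x := b))"
      using star_assignment_insert[OF a'(1) fin x L(1) R] c by blast
    show ?case
    proof (intro exI conjI)
      show "star_assignment (J \<union> insert x M) L f R (a'(x := b))" using b by simp
      show "\<forall>j\<in>J. (a'(x := b)) j = a j" using a'(2) x by auto
    qed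
  qed
  from this[of "I - J"] I L that show ?thesis by (auto simp: Un_absorb1)
qed

text \<open>An outer vertex without a far colour forbids nothing extra, so colouring it last saves
  the spare colour that \<open>star_assignment_extend_less\<close> needs. This is the gain from
  having a later hub at distance 2.\<close>

lemma star_assignment_extend_free:
  assumes a: "star_assignment J L f R a" and I: "finite I" "J \<subseteq> I" and L: "finite L" "card I \<le> card L"
    and R: "\<And>x y. R x y \<Longrightarrow> R y x" and i: "i \<in> I" "i \<notin> J" "f i = None"
  obtains a' where "star_assignment I L f R a'" "\<And>j. j \<in> J \<Longrightarrow> a' j = a j"
proof -
  have c: "card (I - {i}) < card L" using I(1) L i(1)
    by (metis card_Diff1_less dual_order.strict_trans1)
  obtain a' where a': "star_assignment (I - {i}) L f R a'" "\<And>j. j \<in> J \<Longrightarrow> a' j = a j"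
    using star_assignment_extend_less[OF a _ _ L(1) c R] I i by blast
  obtain b where b: "star_assignment (insert i (I - {i})) L f R (a'(i := b))"
    using star_assignment_insert[OF a'(1) _ _ L(1) R, of i] c i(3) I(1) by auto
  then have "star_assignment I L f R (a'(i := b))" using i(1) by (simp add: insert_absorb)
  moreover have "\<And>j. j \<in> J \<Longrightarrow> (a'(i := b)) j = a j" using a'(2) i(2) by auto
  ultimately show ?thesis using that by blast
qed

section \<open>Hub graphs (full subdivisions of multigraphs on the hubs) and the colouring of one
  more star\<close>

locale hub_edges =
  fixes A :: "'a set set" and H :: "'a set"
  assumes simple: "simple_edges A"
    and edge_ends: "e \<in> A \<Longrightarrow> \<exists>h x. e = {h, x} \<and> h \<in> H \<and> x \<notin> H"
    and nonhub_degree: "x \<in> \<Union>A \<Longrightarrow> x \<notin> H \<Longrightarrow> vertex_degree A x = 2"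
begin

text \<open>As every edge has exactly one end in \<open>H\<close>, the stars of the hubs partition
  \<open>A\<close>, and each hub added to \<open>D\<close> contributes its full star.\<close>

definition colored :: "'a set \<Rightarrow> 'a set set" where
  "colored D = {e \<in> A. e \<inter> D \<noteq> {}}"

text \<open>The choice matters only at a nonhub next to a hub outside \<open>D\<close>; there at
  most one edge is coloured, as \<open>far_Some\<close> shows.\<close>

definition far :: "'a set \<Rightarrow> ('a set \<Rightarrow> nat) \<Rightarrow> 'a \<Rightarrow> nat option" where
  "far D col x = (if \<exists>e\<in>colored D. x \<in> e then Some (col (SOME e. e \<in> colored D \<and> x \<in> e)) else None)"

text \<open>The instance of \<open>R\<close> in \<open>star_assignment\<close>. The two colours are
  those that the star edges to \<open>x\<close> and \<open>y\<close> would get in a swap;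
  \<open>the\<close> is harmless because a swap presupposes both far colours.\<close>

definition far_link :: "'a set \<Rightarrow> ('a set \<Rightarrow> nat) \<Rightarrow> 'a \<Rightarrow> 'a \<Rightarrow> bool" where
  "far_link D col x y \<longleftrightarrow>
     (\<exists>F\<subseteq>colored D. col ` F \<subseteq> {the (far D col x), the (far D col y)} \<and> links F x y)"

definition nbrs :: "'a \<Rightarrow> 'a set" where
  "nbrs v = {x. {v, x} \<in> A}"

definition recolor :: "'a \<Rightarrow> ('a \<Rightarrow> nat) \<Rightarrow> ('a set \<Rightarrow> nat) \<Rightarrow> 'a set \<Rightarrow> nat" where
  "recolor v a col e = (if v \<in> e then a (the_elem (e - {v})) else col e)"

lemma finite_A: "finite A" using simple by (rule simple_edges_finite)

lemma colored_subset: "colored D \<subseteq> A" by (auto simp: colored_def)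

lemma simple_colored: "simple_edges (colored D)"
  using simple_edges_subset[OF simple colored_subset] .

lemma far_link_sym: "far_link D col x y \<Longrightarrow> far_link D col y x"
  unfolding far_link_def by (metis insert_commute links_sym)

lemma nbr_nonhub: "v \<in> H \<Longrightarrow> {v, x} \<in> A \<Longrightarrow> x \<notin> H"
  using edge_ends[of "{v, x}"] by (auto simp: doubleton_eq_iff)

lemma nbr_neq: "{v, x} \<in> A \<Longrightarrow> x \<noteq> v"
  using simple_edge_doubleton[OF simple] by blast

lemma hub_edge:
  assumes "e \<in> A" "v \<in> e" "v \<in> H"
  obtains x where "x \<in> nbrs v" "e = {v, x}" "x \<notin> H" "x \<noteq> v"
proof -
  obtain x where "e = {v, x}" "x \<noteq> v" using simple_edges_other[OF simple assms(1,2)] by blast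
  then show ?thesis using that[of x] nbr_nonhub[of v x] assms by (auto simp: nbrs_def)
qed

lemma hubs_eq: "e \<in> A \<Longrightarrow> v \<in> e \<Longrightarrow> v \<in> H \<Longrightarrow> u \<in> e \<Longrightarrow> u \<in> H \<Longrightarrow> u = v"
  by (metis edge_ends insert_iff singletonD)

lemma card_nbrs: "card (nbrs v) = vertex_degree A v"
proof -
  have "bij_betw (\<lambda>x. {v, x}) (nbrs v) {e \<in> A. v \<in> e}"
    unfolding bij_betw_def
  proof
    show "inj_on (\<lambda>x. {v, x}) (nbrs v)" by (auto simp: inj_on_def doubleton_eq_iff)
    show "(\<lambda>x. {v, x}) ` nbrs v = {e \<in> A. v \<in> e}"
    proof
      show "{e \<in> A. v \<in> e} \<subseteq> (\<lambda>x. {v, x}) ` nbrs v"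
      proof
        fix e assume "e \<in> {e \<in> A. v \<in> e}"
        then have e: "e \<in> A" "v \<in> e" by auto
        obtain x where "e = {v, x}" using simple_edges_other[OF simple e] by blast
        then show "e \<in> (\<lambda>x. {v, x}) ` nbrs v" using e by (auto simp: nbrs_def)
      qed
    qed (auto simp: nbrs_def)
  qed
  then show ?thesis by (simp add: bij_betw_same_card vertex_degree_def)
qed

lemma finite_nbrs: "finite (nbrs v)"
proof (rule finite_subset)
  show "nbrs v \<subseteq> \<Union>A" by (auto simp: nbrs_def)
  show "finite (\<Union>A)" using simple by (rule simple_edges_finite_Union)
qed

lemma nonhub_edges:
  assumes "e \<in> A" "e' \<in> A" "e'' \<in> A" "x \<in> e" "x \<in> e'" "x \<in> e''" "x \<notin> H" "e \<noteq> e'"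
  shows "e'' = e \<or> e'' = e'"
proof -
  have "vertex_degree A x = 2" using nonhub_degree assms by blast
  then obtain f where "\<And>g. g \<in> A \<Longrightarrow> x \<in> g \<Longrightarrow> g = e \<or> g = f"
    using vertex_degree_2E[of A x e] assms by metis
  then show ?thesis using assms by metis
qed

lemma not_colored_star: "v \<notin> D \<Longrightarrow> v \<in> H \<Longrightarrow> D \<subseteq> H \<Longrightarrow> e \<in> colored D \<Longrightarrow> v \<notin> e"
  unfolding colored_def using hubs_eq by blast

lemma far_Some:
  assumes "D \<subseteq> H" "v \<in> H" "v \<notin> D" "{v, x} \<in> A" "e \<in> colored D" "x \<in> e"
  shows "far D col x = Some (col e)"
proof -
  have "e' = e" if "e' \<in> colored D" "x \<in> e'" for e'
  proof -
    have "v \<notin> e'" "v \<notin> e"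
      using not_colored_star[OF assms(3,2,1) that(1)] not_colored_star[OF assms(3,2,1,5)] .
    moreover have "e' \<in> A" "e \<in> A" using that assms colored_subset by auto
    ultimately show ?thesis
      using nonhub_edges[of "{v, x}" e e' x] assms that nbr_nonhub[OF assms(2,4)] by blast
  qed
  then have "(SOME e. e \<in> colored D \<and> x \<in> e) = e" using assms(5,6) by (intro some_equality) blast+
  moreover have "\<exists>e\<in>colored D. x \<in> e" using assms(5,6) by blast
  ultimately show ?thesis unfolding far_def by simp
qed

text \<open>Supplies the free vertex for \<open>star_extend_free\<close>: both edges at
  \<open>x\<close> belong to hubs outside \<open>D\<close>, and there is no third edge.\<close>

lemma far_None:
  assumes "D \<subseteq> H" "v \<in> H" "v \<notin> D" "{v, x} \<in> A" "y \<in> H" "y \<notin> D" "{y, x} \<in> A" "y \<noteq> v"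
  shows "far D col x = None"
proof -
  have "x \<notin> e" if "e \<in> colored D" for e
  proof
    assume "x \<in> e"
    moreover have "{v, x} \<noteq> {y, x}" using assms(8) by (auto simp: doubleton_eq_iff)
    ultimately have "e = {v, x} \<or> e = {y, x}"
      using nonhub_edges[of "{v, x}" "{y, x}" e x] assms that colored_subset nbr_nonhub[OF assms(2,4)]
      by auto
    then show False using not_colored_star[OF _ _ assms(1) that] assms by blast
  qed
  then show ?thesis unfolding far_def by simp
qed

lemma recolor_star: "x \<noteq> v \<Longrightarrow> recolor v a col {v, x} = a x"
proof -
  assume "x \<noteq> v"
  then have "{v, x} - {v} = {x}" by auto
  then show ?thesis by (simp add: recolor_def)
qed

lemma recolor_other: "v \<notin> e \<Longrightarrow> recolor v a col e = col e"
  by (simp add: recolor_def)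

lemma colored_insert_cases:
  assumes "e \<in> colored (insert v D)" "v \<in> H"
  obtains (star) x where "x \<in> nbrs v" "e = {v, x}" "x \<notin> H" "x \<noteq> v"
  | (old) "e \<in> colored D" "v \<notin> e"
proof (cases "v \<in> e")
  case True
  then show ?thesis using hub_edge[of e v] assms star by (auto simp: colored_def)
next
  case False
  then show ?thesis using old assms by (auto simp: colored_def)
qed

lemma recolor_image:
  assumes "v \<in> H" "col ` colored D \<subseteq> C" "a ` nbrs v \<subseteq> C"
  shows "recolor v a col ` colored (insert v D) \<subseteq> C"
proof
  fix p assume "p \<in> recolor v a col ` colored (insert v D)"
  then obtain e where e: "e \<in> colored (insert v D)" "p = recolor v a col e" by blast
  from e(1) assms(1) show "p \<in> C"
    by (cases rule: colored_insert_cases) (use e(2) assms in \<open>auto simp: recolor_star recolor_other\<close>)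
qed

lemma recolor_proper:
  assumes D: "D \<subseteq> H" "v \<in> H" "v \<notin> D" and col: "proper_edge_coloring (colored D) col"
    and a: "inj_on a (nbrs v)" "\<forall>i\<in>nbrs v. far D col i \<noteq> Some (a i)"
  shows "proper_edge_coloring (colored (insert v D)) (recolor v a col)"
  unfolding proper_edge_coloring_def
proof (intro ballI impI)
  have mixed: "a x \<noteq> col f" if "x \<in> nbrs v" "f \<in> colored D" "x \<in> f" for x f
  proof -
    have "{v, x} \<in> A" using that(1) by (simp add: nbrs_def)
    then show ?thesis using far_Some[OF D _ that(2,3), of col] a(2) that(1) by auto
  qed
  fix e f assume e: "e \<in> colored (insert v D)" and f: "f \<in> colored (insert v D)"
    and ef: "e \<noteq> f" "e \<inter> f \<noteq> {}"
  from e D(2) show "recolor v a col e \<noteq> recolor v a col f"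
  proof (cases rule: colored_insert_cases)
    case (star x)
    note x = this
    from f D(2) show ?thesis
    proof (cases rule: colored_insert_cases)
      case (star y)
      then have "a x \<noteq> a y" using x a(1) ef(1) by (auto simp: inj_on_def)
      then show ?thesis using x star by (simp add: recolor_star)
    next
      case old
      then have "x \<in> f" using ef x by auto
      then show ?thesis using mixed[of x f] x old by (simp add: recolor_star recolor_other)
    qed
  next
    case old
    note e = this
    from f D(2) show ?thesis
    proof (cases rule: colored_insert_cases)
      case (star y)
      then have "y \<in> e" using ef e by auto
      then show ?thesis using mixed[of y e] star e by (simp add: recolor_star recolor_other)
    next
      case old
      then show ?thesis using e ef col by (simp add: recolor_other proper_edge_coloring_def)
    qed
  qed
qed

lemma recolor_bicycle_free:
  assumes D: "D \<subseteq> H" "v \<in> H" "v \<notin> D" and col: "bicycle_free (colored D) col"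
    and a: "star_assignment (nbrs v) L (far D col) (far_link D col) a"
  shows "bicycle_free (colored (insert v D)) (recolor v a col)"
proof (rule bicycle_freeI)
  let ?col = "recolor v a col"
  have inj: "inj_on a (nbrs v)" and ne: "\<forall>i\<in>nbrs v. far D col i \<noteq> Some (a i)"
    and sw: "\<And>i j. i \<in> nbrs v \<Longrightarrow> j \<in> nbrs v \<Longrightarrow> far D col i = Some (a j) \<Longrightarrow> far D col j = Some (a i) \<Longrightarrow>
      \<not> far_link D col i j"
    using a unfolding star_assignment_def by blast+
  show P: "proper_edge_coloring (colored (insert v D)) ?col"
    using recolor_proper[OF D bicycle_free_proper[OF col] inj ne] .
  fix F p q assume F: "F \<subseteq> colored (insert v D)" "F \<noteq> {}" "?col ` F \<subseteq> {p, q}"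
    and deg: "\<And>x. x \<in> \<Union>F \<Longrightarrow> 2 \<le> vertex_degree F x"
  show False
  proof -
    have FA: "F \<subseteq> A" using F(1) colored_subset by blast
    have finF: "finite F" using FA finite_A finite_subset by blast
    have proper: "proper_edge_coloring F ?col" using proper_edge_coloring_subset[OF P F(1)] .
    show False
    proof (cases "v \<in> \<Union>F")
      case False
      then have "F \<subseteq> colored D" using F(1) by (auto simp: colored_def)
      moreover have "col ` F \<subseteq> {p, q}" using F(3) False by (auto simp: recolor_other)
      ultimately show False using bicycle_free_empty[OF col] deg F(2) by blast
    next
      case True
      then obtain e where e: "e \<in> F" "v \<in> e" by blast
      obtain x where x: "x \<in> nbrs v" "e = {v, x}" "x \<notin> H" "x \<noteq> v"
        using hub_edge[of e v] e FA D(2) by blast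
      obtain e' where e': "e' \<in> F" "v \<in> e'" "e' \<noteq> e"
        using vertex_degree_ge2_other[OF deg[OF True], of e] by blast
      obtain y where y: "y \<in> nbrs v" "e' = {v, y}" "y \<notin> H" "y \<noteq> v"
        using hub_edge[of e' v] e' FA D(2) by blast
      have xy: "x \<noteq> y" using e'(3) x(2) y(2) by blast
      have axy: "a x \<noteq> a y" using inj_on_contraD[OF inj xy x(1) y(1)] .
      have "?col e = a x" "?col e' = a y" using x(2,4) y(2,4) recolor_star by simp_all
      moreover have "?col e \<in> {p, q}" "?col e' \<in> {p, q}" using F(3) e(1) e'(1) by blast+
      ultimately have pq: "{p, q} = {a x, a y}" using axy by auto
      \<comment> \<open>The cycle leaves \<open>s\<close> by its only other edge \<open>g\<close>,
        which was coloured before. The colour of \<open>g\<close> is one of the two and differs from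
        the one assigned to \<open>s\<close>, so it is the one assigned to \<open>t\<close>.\<close>
      have other: "\<exists>g\<in>F. s \<in> g \<and> g \<in> colored D \<and> v \<notin> g \<and> far D col s = Some (col g) \<and> col g = a t"
        if st: "(s = x \<and> t = y) \<or> (s = y \<and> t = x)" for s t
      proof -
        have s: "s \<in> nbrs v" "{v, s} \<in> F" "s \<noteq> v" "s \<notin> H" using st x y e(1) e'(1) by metis+
        then have "2 \<le> vertex_degree F s" using deg by blast
        then obtain g where g: "g \<in> F" "s \<in> g" "g \<noteq> {v, s}"
          using vertex_degree_ge2_other[of F s "{v, s}"] by blast
        have "v \<notin> g"
        proof
          assume "v \<in> g"
          then obtain r where "g = {v, r}" using hub_edge[of g v] g FA D(2) by blast
          then show False using g(2,3) s(3) by blast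
        qed
        then have gc: "g \<in> colored D" using g F(1) by (auto simp: colored_def)
        have fr: "far D col s = Some (col g)" using far_Some[OF D _ gc g(2)] s(1) by (simp add: nbrs_def)
        have "?col g \<in> {a x, a y}" using F(3) g(1) pq by blast
        then have "col g \<in> {a x, a y}" using recolor_other[OF \<open>v \<notin> g\<close>, of a col] by simp
        moreover have "col g \<noteq> a s" using ne s(1) fr by auto
        ultimately have "col g = a t" using st by blast
        then show ?thesis using g gc fr \<open>v \<notin> g\<close> by blast
      qed
      from other[of x y] other[of y x]
      have fx: "far D col x = Some (a y)" and fy: "far D col y = Some (a x)" by metis+
      \<comment> \<open>Without the star of \<open>v\<close> the cycle becomes a link from
        \<open>x\<close> to \<open>y\<close> in old edges, with swapped far colours: exactly what
        the assignment excludes.\<close>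
      define F' where "F' = {g \<in> F. v \<notin> g}"
      have star: "g = e \<or> g = e'" if g: "g \<in> F" "v \<in> g" for g
      proof -
        obtain r where r: "r \<in> nbrs v" "g = {v, r}" "r \<noteq> v"
          using hub_edge[of g v] g FA D(2) by blast
        have "?col g \<in> {a x, a y}" using F(3) g(1) pq by blast
        then have "a r = a x \<or> a r = a y" using recolor_star[OF r(3), of a col] r(2) by simp
        then have "r = x \<or> r = y" using inj_onD[OF inj _ r(1)] x(1) y(1) by metis
        then show ?thesis using r(2) x(2) y(2) by blast
      qed
      have F'c: "F' \<subseteq> colored D" using F(1) by (auto simp: F'_def colored_def)
      have "col ` F' \<subseteq> {a x, a y}"
      proof
        fix s assume "s \<in> col ` F'"
        then obtain g where "g \<in> F" "v \<notin> g" "s = col g" unfolding F'_def by blast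
        moreover from this have "?col g \<in> {a x, a y}" using F(3) pq by blast
        ultimately show "s \<in> {a x, a y}" using recolor_other[of v g a col] by simp
      qed
      then have colF': "col ` F' \<subseteq> {the (far D col x), the (far D col y)}"
        unfolding fx fy by (simp add: insert_commute)
      have one: "vertex_degree F' s = 1" if st: "(s = x \<and> t = y) \<or> (s = y \<and> t = x)" for s t
      proof -
        have s: "{v, s} \<in> F" "s \<notin> H" using st x y e(1) e'(1) by metis+
        obtain g where g: "g \<in> F" "s \<in> g" "v \<notin> g" using other[OF st] by blast
        have "h = g" if "h \<in> F'" "s \<in> h" for h
          using nonhub_edges[of "{v, s}" g h s] that g s FA unfolding F'_def by blast
        moreover have "g \<in> F'" using g by (simp add: F'_def)
        ultimately have "{h \<in> F'. s \<in> h} = {g}" using g(2) by blast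
        then show ?thesis unfolding vertex_degree_def by (metis card_1_singleton_iff One_nat_def)
      qed
      have "links F' x y"
        unfolding links_def
      proof (intro conjI ballI)
        show "vertex_degree F' x = 1" "vertex_degree F' y = 1" using one by blast+
        fix r assume r: "r \<in> \<Union>F' - {x, y}"
        then have "r \<noteq> v" by (auto simp: F'_def)
        have "g \<in> F' \<longleftrightarrow> g \<in> F" if "r \<in> g" for g
          using star[of g] that r \<open>r \<noteq> v\<close> x(2) y(2) unfolding F'_def by blast
        then have "vertex_degree F' r = vertex_degree F r" by (rule vertex_degree_cong)
        moreover have "r \<in> \<Union>F" using r by (auto simp: F'_def)
        ultimately show "2 \<le> vertex_degree F' r" using deg[of r] by metis
      qed
      then have "far_link D col x y" using F'c colF' unfolding far_link_def by blast
      then show False using sw[OF x(1) y(1) fx fy] by blast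
    qed
  qed
qed

end

section \<open>Colouring star by star\<close>

text \<open>Connectedness without reference to walks; biconnectivity yields this form
  directly.\<close>

definition connected_edges :: "'a set set \<Rightarrow> bool" where
  "connected_edges M \<longleftrightarrow> (\<forall>X Y. X \<union> Y = M \<longrightarrow> \<Union>X \<inter> \<Union>Y = {} \<longrightarrow> X = {} \<or> Y = {})"

context hub_edges
begin

text \<open>Read backwards this orders the hubs: when \<open>v\<close> is processed, the hub
  \<open>y\<close> in \<open>T\<close> is still waiting, and \<open>x\<close> is the free vertex
  between them. Starting from \<open>w\<close> makes \<open>w\<close> the last one.\<close>

inductive reach :: "'a \<Rightarrow> 'a set \<Rightarrow> bool" for w where
  reach_base: "reach w {w}"
| reach_step: "reach w T \<Longrightarrow> v \<in> H \<Longrightarrow> v \<notin> T \<Longrightarrow> {v, x} \<in> A \<Longrightarrow> {y, x} \<in> A \<Longrightarrow> y \<in> T \<Longrightarrow>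
    reach w (insert v T)"

lemma reach_subset: "reach w T \<Longrightarrow> w \<in> H \<Longrightarrow> T \<subseteq> H"
  by (induction rule: reach.induct) auto

lemma reach_mem: "reach w T \<Longrightarrow> w \<in> T"
  by (induction rule: reach.induct) auto

lemma hub_edge_nonhub:
  assumes "e \<in> A" "x \<in> e" "x \<notin> H"
  obtains h where "h \<in> H" "e = {h, x}"
  using edge_ends[OF assms(1)] assms(2,3) by blast

text \<open>A maximal reachable \<open>T\<close> is all of \<open>H\<close>: otherwise connectedness
  gives a vertex shared by an edge meeting \<open>T\<close> and an edge missing \<open>T\<close>. It
  must be a nonhub, and the hub of the second edge extends \<open>T\<close>.\<close>

lemma reach_all:
  assumes conn: "connected_edges A" and w: "w \<in> H" and H: "H \<subseteq> \<Union>A"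
  shows "reach w H"
proof -
  have finH: "finite H" using H simple_edges_finite_Union[OF simple] finite_subset by blast
  have "{T. reach w T} \<subseteq> Pow H" using reach_subset w by blast
  then have "finite {T. reach w T}" using finH by (meson finite_Pow_iff finite_subset)
  then have "\<exists>m\<in>{T. reach w T}. {w} \<subseteq> m \<and> (\<forall>b\<in>{T. reach w T}. m \<subseteq> b \<longrightarrow> m = b)"
    by (rule finite_has_maximal2) (simp add: reach_base)
  then obtain T where "T \<in> {T. reach w T}" "\<forall>b\<in>{T. reach w T}. T \<subseteq> b \<longrightarrow> T = b" by metis
  then have T: "reach w T" "\<And>T'. reach w T' \<Longrightarrow> T \<subseteq> T' \<Longrightarrow> T = T'" by simp_all
  have TH: "T \<subseteq> H" using reach_subset T(1) w by blast
  show ?thesis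
  proof (cases "T = H")
    case False
    then obtain h where h: "h \<in> H" "h \<notin> T" using TH by blast
    define X where "X = {e \<in> A. e \<inter> T \<noteq> {}}"
    define Y where "Y = {e \<in> A. e \<inter> T = {}}"
    have "\<Union>X \<inter> \<Union>Y \<noteq> {}"
    proof
      assume disj: "\<Union>X \<inter> \<Union>Y = {}"
      have "X \<union> Y = A" unfolding X_def Y_def by blast
      then have XY: "X = {} \<or> Y = {}" using conn disj unfolding connected_edges_def by simp
      obtain e0 where "e0 \<in> A" "w \<in> e0" using w H by blast
      then have "e0 \<in> X" using reach_mem[OF T(1)] unfolding X_def by blast
      moreover obtain e where e: "e \<in> A" "h \<in> e" using h H by blast
      have "e \<inter> T = {}" using hubs_eq[OF e h(1)] TH h(2) by blast
      then have "e \<in> Y" using e unfolding Y_def by simp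
      ultimately show False using XY by blast
    qed
    then obtain s e e' where "e \<in> X" "e' \<in> Y" and se: "s \<in> e" "s \<in> e'" by (meson Int_emptyI UnionE)
    then have s: "s \<in> e" "s \<in> e'" "e \<in> A" "e' \<in> A" "e \<inter> T \<noteq> {}" "e' \<inter> T = {}"
      unfolding X_def Y_def by simp_all
    obtain y where y: "y \<in> e" "y \<in> T" using s(5) by blast
    have yH: "y \<in> H" using y(2) TH by blast
    have "s \<noteq> y" using s(2,6) y by blast
    then have sH: "s \<notin> H" using hubs_eq[OF s(3) y(1) yH s(1)] by blast
    obtain h1 where h1: "h1 \<in> H" "e = {h1, s}" using hub_edge_nonhub[OF s(3,1) sH] by blast
    obtain h2 where h2: "h2 \<in> H" "e' = {h2, s}" using hub_edge_nonhub[OF s(4,2) sH] by blast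
    have "h1 = y" using hubs_eq[OF s(3) y(1) yH _ h1(1)] h1(2) by blast
    then have "reach w (insert h2 T)"
      using reach_step[OF T(1) h2(1), of s y] s h1 h2 y by auto
    then have "h2 \<in> T" using T(2) by blast
    then show ?thesis using h2 s(6) by blast
  qed (use T(1) in simp)
qed

lemma star_extend_free:
  assumes "star_assignment J L (far D col) (far_link D col) a" "J \<subseteq> nbrs v" "finite L"
    "card (nbrs v) \<le> card L" "x \<in> nbrs v" "x \<notin> J" "far D col x = None"
  shows "\<exists>a'. star_assignment (nbrs v) L (far D col) (far_link D col) a' \<and> (\<forall>j\<in>J. a' j = a j)"
proof -
  obtain a' where "star_assignment (nbrs v) L (far D col) (far_link D col) a'" "\<And>j. j \<in> J \<Longrightarrow> a' j = a j"
    by (rule star_assignment_extend_free[OF assms(1) finite_nbrs assms(2,3,4) far_link_sym assms(5,6,7)]) blast+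
  then show ?thesis by blast
qed

lemma star_extend_less:
  assumes "star_assignment J L (far D col) (far_link D col) a" "J \<subseteq> nbrs v" "finite L"
    "card (nbrs v) < card L"
  shows "\<exists>a'. star_assignment (nbrs v) L (far D col) (far_link D col) a' \<and> (\<forall>j\<in>J. a' j = a j)"
proof -
  obtain a' where "star_assignment (nbrs v) L (far D col) (far_link D col) a'" "\<And>j. j \<in> J \<Longrightarrow> a' j = a j"
    by (rule star_assignment_extend_less[OF assms(1) finite_nbrs assms(2,3,4) far_link_sym]) blast+
  then show ?thesis by blast
qed

text \<open>
  \<open>T\<close> is the set of hubs still to be processed. The edge \<open>e\<close> required once \<open>u\<close> is processed guarantees
  that in the end some vertex next to the last hub has a colour other than \<open>c\<close> on its far side, so
  that \<open>c\<close> can be used at the last hub.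
\<close>

definition admissible :: "'a \<Rightarrow> nat \<Rightarrow> nat \<Rightarrow> 'a set \<Rightarrow> ('a set \<Rightarrow> nat) \<Rightarrow> bool" where
  "admissible u c k T col \<longleftrightarrow> bicycle_free (colored (H - T)) col \<and> col ` colored (H - T) \<subseteq> {..<k} \<and>
     (u \<notin> T \<longrightarrow> (\<forall>e\<in>colored (H - T). u \<in> e \<longrightarrow> col e \<noteq> c) \<and>
       (\<exists>e x t. e \<in> colored (H - T) \<and> x \<in> e \<and> x \<notin> H \<and> t \<in> T \<and> {t, x} \<in> A \<and> col e \<noteq> c))"

text \<open>The free vertex \<open>x\<close> lets the star of \<open>v\<close> be completed with
  only as many colours as its degree. At \<open>v = u\<close> the colour \<open>c\<close> is struck
  from the list, which \<open>vertex_degree A u < k\<close> allows, and the edge \<open>vx\<close>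
  becomes the required witness. Later the witness is lost only when its waiting hub \<open>t\<close>
  is \<open>v\<close> itself; then \<open>vx\<close> is made the new one.\<close>

lemma admissible_step:
  assumes u: "u \<in> H" and c: "c < k" and degu: "vertex_degree A u < k"
    and deg: "vertex_degree A v \<le> k"
    and T: "T \<subseteq> H" and v: "v \<in> H" "v \<notin> T" and x: "{v, x} \<in> A" "{y, x} \<in> A" "y \<in> T"
    and col: "admissible u c k (insert v T) col"
  shows "\<exists>col'. admissible u c k T col'"
proof -
  define D where "D = H - insert v T"
  have D: "D \<subseteq> H" "v \<notin> D" and ins: "insert v D = H - T" using v by (auto simp: D_def)
  have bf: "bicycle_free (colored D) col" and im: "col ` colored D \<subseteq> {..<k}"
    using col by (auto simp: admissible_def D_def)
  have xn: "x \<in> nbrs v" "x \<notin> H" "x \<noteq> v" using x nbr_nonhub[OF v(1) x(1)] v by (auto simp: nbrs_def)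
  have free: "far D col x = None"
    using far_None[OF D(1) v(1) D(2) x(1) _ _ x(2)] x(3) T v by (auto simp: D_def)
  have cardn: "card (nbrs v) \<le> card {..<k}" using deg card_nbrs by simp
  have finish: "\<exists>col'. admissible u c k T col'"
    if a: "star_assignment (nbrs v) L (far D col) (far_link D col) a" "L \<subseteq> {..<k}"
      and stay: "u \<notin> T \<Longrightarrow> (\<forall>e\<in>colored (H - T). u \<in> e \<longrightarrow> recolor v a col e \<noteq> c) \<and>
       (\<exists>e x t. e \<in> colored (H - T) \<and> x \<in> e \<and> x \<notin> H \<and> t \<in> T \<and> {t, x} \<in> A \<and> recolor v a col e \<noteq> c)"
    for a L
  proof -
    have "a ` nbrs v \<subseteq> {..<k}" using a unfolding star_assignment_def by blast
    then have "recolor v a col ` colored (H - T) \<subseteq> {..<k}"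
      using recolor_image[OF v(1) im] ins by metis
    moreover have "bicycle_free (colored (H - T)) (recolor v a col)"
      using recolor_bicycle_free[OF D(1) v(1) D(2) bf a(1)] ins by simp
    ultimately show ?thesis using stay unfolding admissible_def by blast
  qed
  have vx: "{v, x} \<in> colored (H - T)" using x v by (auto simp: colored_def)
  show ?thesis
  proof (cases "v = u")
    case True
    have cv: "card (nbrs v) \<le> card ({..<k} - {c})" using True degu card_nbrs c by simp
    obtain a where a: "star_assignment (nbrs v) ({..<k} - {c}) (far D col) (far_link D col) a"
      using star_extend_free[OF star_assignment_empty empty_subsetI finite_Diff[OF finite_lessThan] cv xn(1) _ free]
      by blast
    have anc: "a i \<noteq> c" if "i \<in> nbrs v" for i using a that unfolding star_assignment_def by blast
    show ?thesis
    proof (rule finish[OF a])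
      have "recolor v a col e \<noteq> c" if e: "e \<in> colored (H - T)" "u \<in> e" for e
      proof -
        obtain i where "i \<in> nbrs v" "e = {v, i}" "i \<noteq> v"
          using hub_edge[of e v] e True v(1) colored_subset by blast
        then show ?thesis using anc recolor_star[of i v a col] by simp
      qed
      moreover have "recolor v a col {v, x} \<noteq> c" using anc[OF xn(1)] recolor_star[OF xn(3)] by simp
      ultimately show "(\<forall>e\<in>colored (H - T). u \<in> e \<longrightarrow> recolor v a col e \<noteq> c) \<and>
       (\<exists>e x t. e \<in> colored (H - T) \<and> x \<in> e \<and> x \<notin> H \<and> t \<in> T \<and> {t, x} \<in> A \<and> recolor v a col e \<noteq> c)"
        using vx xn(2) x by blast
    qed blast
  next
    case False
    show ?thesis
    proof (cases "u \<in> T")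
      case True
      obtain a where "star_assignment (nbrs v) {..<k} (far D col) (far_link D col) a"
        using star_extend_free[OF star_assignment_empty empty_subsetI finite_lessThan cardn xn(1) _ free] by blast
      then show ?thesis using finish True by blast
    next
      case nT: False
      then have uD: "u \<notin> insert v T" using False by auto
      have uc: "recolor v a col e \<noteq> c" if e: "e \<in> colored (H - T)" "u \<in> e" for e a
      proof -
        have "v \<notin> e" using hubs_eq[of e u v] e u v(1) False colored_subset by blast
        then have "e \<in> colored D" using e(1) ins by (auto simp: colored_def)
        then have "col e \<noteq> c" using col uD e(2) unfolding admissible_def D_def by blast
        then show ?thesis using recolor_other[OF \<open>v \<notin> e\<close>] by simp
      qed
      obtain e x1 t where f: "e \<in> colored D" "x1 \<in> e" "x1 \<notin> H" "t \<in> insert v T" "{t, x1} \<in> A" "col e \<noteq> c"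
        using col uD unfolding admissible_def D_def by blast
      have ve: "v \<notin> e" using not_colored_star[OF D(2) v(1) D(1) f(1)] .
      show ?thesis
      proof (cases "t = v")
        case True
        have x1n: "x1 \<in> nbrs v" "x1 \<noteq> v" using f True v by (auto simp: nbrs_def)
        have far1: "far D col x1 = Some (col e)"
          using far_Some[OF D(1) v(1) D(2) _ f(1,2)] f(5) True by simp
        have xx1: "x \<notin> {x1}" using far1 free by auto
        \<comment> \<open>Giving \<open>c\<close> to \<open>x1\<close> is legal since its far colour
          is not \<open>c\<close>, and it forces a colour other than \<open>c\<close> on
          \<open>vx\<close>, the new witness.\<close>
        have sa: "star_assignment {x1} {..<k} (far D col) (far_link D col) (\<lambda>_. c)"
          using far1 f(6) c by (auto simp: star_assignment_def)
        have "{x1} \<subseteq> nbrs v" using x1n by simp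
        then obtain a where a: "star_assignment (nbrs v) {..<k} (far D col) (far_link D col) a" "a x1 = c"
          using star_extend_free[OF sa _ finite_lessThan cardn xn(1) xx1 free] by blast
        have inj: "inj_on a (nbrs v)" using a(1) unfolding star_assignment_def by blast
        have "a x \<noteq> c" using inj_on_contraD[OF inj _ xn(1) x1n(1)] xx1 a(2) by simp
        then have "recolor v a col {v, x} \<noteq> c" using recolor_star[OF xn(3)] by simp
        then show ?thesis using finish[OF a(1)] uc vx xn(2) x by blast
      next
        case False
        obtain a where a: "star_assignment (nbrs v) {..<k} (far D col) (far_link D col) a"
          using star_extend_free[OF star_assignment_empty empty_subsetI finite_lessThan cardn xn(1) _ free] by blast
        have "e \<in> colored (H - T)" using f(1) ins by (auto simp: colored_def)
        moreover have "recolor v a col e \<noteq> c" using recolor_other[OF ve] f(6) by simp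
        ultimately show ?thesis using finish[OF a] uc f False by blast
      qed
    qed
  qed
qed

lemma admissible_last:
  assumes T: "reach w T" and u: "u \<in> H" "w \<in> H" and c: "c < k" and degu: "vertex_degree A u < k"
    and deg: "\<And>v. vertex_degree A v \<le> k"
    and col: "admissible u c k T col"
  shows "\<exists>col'. admissible u c k {w} col'"
  using T col
proof (induction arbitrary: col rule: reach.induct)
  case reach_base
  then show ?case by blast
next
  case (reach_step T v x y)
  then show ?case using admissible_step[OF u(1) c degu deg reach_subset[OF _ u(2)]] by metis
qed

lemma admissible_exists:
  assumes "connected_edges A" "H \<subseteq> \<Union>A" "u \<in> H" "w \<in> H" "c < k" "vertex_degree A u < k"
    "\<And>v. vertex_degree A v \<le> k"
  shows "\<exists>col. admissible u c k {w} col"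
proof (rule admissible_last[OF reach_all])
  have "colored (H - H) = {}" by (auto simp: colored_def)
  then show "admissible u c k H undefined"
    using assms by (auto simp: admissible_def bicycle_free_def proper_edge_coloring_def)
qed (use assms in auto)

lemma colored_H: "colored H = A"
  using edge_ends by (fastforce simp: colored_def)

text \<open>For the case that the far side already uses \<open>c\<close> at \<open>w\<close>. At the
  last hub no free neighbour is available, so the star must be strictly smaller than its list of
  \<open>k - 1\<close> colours; hence \<open>vertex_degree A w + 1 < k\<close>.\<close>

lemma coloring_avoiding:
  assumes conn: "connected_edges A" "H \<subseteq> \<Union>A" and uw: "u \<in> H" "w \<in> H" "u \<noteq> w" and c: "c < k"
    and degu: "vertex_degree A u < k" and deg: "\<And>v. vertex_degree A v \<le> k"
    and degw: "vertex_degree A w + 1 < k"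
  obtains col where "bicycle_free A col" "col ` A \<subseteq> {..<k}"
    "\<And>e. e \<in> A \<Longrightarrow> u \<in> e \<Longrightarrow> col e \<noteq> c" "\<And>e. e \<in> A \<Longrightarrow> w \<in> e \<Longrightarrow> col e \<noteq> c"
proof -
  obtain col where col: "admissible u c k {w} col"
    using admissible_exists[OF conn uw(1,2) c degu deg] by blast
  define D where "D = H - {w}"
  have D: "D \<subseteq> H" "w \<notin> D" and ins: "insert w D = H" using uw by (auto simp: D_def)
  have bf: "bicycle_free (colored D) col" and im: "col ` colored D \<subseteq> {..<k}"
    and cu: "\<forall>e\<in>colored D. u \<in> e \<longrightarrow> col e \<noteq> c"
    using col uw(3) by (auto simp: admissible_def D_def)
  have cw: "card (nbrs w) < card ({..<k} - {c})" using degw card_nbrs c by simp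
  obtain a where a: "star_assignment (nbrs w) ({..<k} - {c}) (far D col) (far_link D col) a"
    using star_extend_less[OF star_assignment_empty empty_subsetI finite_Diff[OF finite_lessThan] cw] by blast
  have ak: "a ` nbrs w \<subseteq> {..<k} - {c}" using a unfolding star_assignment_def by blast
  show ?thesis
  proof (rule that[of "recolor w a col"])
    show "bicycle_free A (recolor w a col)"
      using recolor_bicycle_free[OF D(1) uw(2) D(2) bf a] ins colored_H by simp
    show "recolor w a col ` A \<subseteq> {..<k}"
      using recolor_image[OF uw(2) im, of a] ins colored_H ak by auto
    show "recolor w a col e \<noteq> c" if e: "e \<in> A" "u \<in> e" for e
    proof -
      have "w \<notin> e" using hubs_eq[OF e uw(1), of w] uw by blast
      moreover have "e \<in> colored D" using e uw by (auto simp: colored_def D_def)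
      ultimately show ?thesis using cu e(2) recolor_other by metis
    qed
    show "recolor w a col e \<noteq> c" if e: "e \<in> A" "w \<in> e" for e
    proof -
      obtain i where "i \<in> nbrs w" "e = {w, i}" "i \<noteq> w" using hub_edge[OF e uw(2)] by blast
      then show ?thesis using ak recolor_star[of i w a col] by auto
    qed
  qed
qed

end

section \<open>Links to the last vertex\<close>

lemma vertex_degree_le1:
  assumes "finite K" "\<And>e f. e \<in> K \<Longrightarrow> f \<in> K \<Longrightarrow> v \<in> e \<Longrightarrow> v \<in> f \<Longrightarrow> e = f"
  shows "vertex_degree K v \<le> 1"
  using card_le_Suc0_iff_eq[of "{e \<in> K. v \<in> e}"] assms unfolding vertex_degree_def by auto

lemma vertex_degree_eq1:
  assumes "g \<in> K" "v \<in> g" "\<And>e. e \<in> K \<Longrightarrow> v \<in> e \<Longrightarrow> e = g"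
  shows "vertex_degree K v = 1"
proof -
  have "{e \<in> K. v \<in> e} = {g}" using assms by blast
  then show ?thesis unfolding vertex_degree_def by (metis card_1_singleton_iff One_nat_def)
qed

lemma proper_eqD:
  "proper_edge_coloring E col \<Longrightarrow> e \<in> E \<Longrightarrow> f \<in> E \<Longrightarrow> v \<in> e \<Longrightarrow> v \<in> f \<Longrightarrow> col e = col f \<Longrightarrow> e = f"
  unfolding proper_edge_coloring_def by blast

context hub_edges
begin

text \<open>
  Every nonhub on a two-coloured link meets one edge of each colour, so the link has equally many
  edges of both; a link on which both end edges have colour \<open>d\<close> would have more hubs
  met by \<open>d\<close> than by \<open>c\<close>.
\<close>

lemma no_link_avoiding:
  assumes P: "proper_edge_coloring A col" and F: "F \<subseteq> A" "col ` F \<subseteq> {c, d}" "links F u w"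
    and uw: "u \<in> H" "w \<in> H"
    and u: "\<And>e. e \<in> A \<Longrightarrow> u \<in> e \<Longrightarrow> col e \<noteq> c" and w: "\<And>e. e \<in> A \<Longrightarrow> w \<in> e \<Longrightarrow> col e \<noteq> c"
  shows False
proof -
  define Fc where "Fc = {e \<in> F. col e = c}"
  define Fd where "Fd = {e \<in> F. col e = d}"
  have finF: "finite F" using F(1) finite_A finite_subset by blast
  then have fin: "finite Fc" "finite Fd" by (auto simp: Fc_def Fd_def)
  have "\<forall>e\<in>A. \<exists>p. e = {fst p, snd p} \<and> fst p \<in> H \<and> snd p \<notin> H"
    using edge_ends by fastforce
  then obtain p where p: "\<forall>e\<in>A. e = {fst (p e), snd (p e)} \<and> fst (p e) \<in> H \<and> snd (p e) \<notin> H"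
    by (rule bchoice[THEN exE])
  define h where "h e = fst (p e)" for e
  define s where "s e = snd (p e)" for e
  note ps = p[folded h_def s_def, rule_format]
  have eq: "e = {h e, s e}" and hH: "h e \<in> H" and sH: "s e \<notin> H" if "e \<in> A" for e
    by (fact ps[OF that, THEN conjunct1] ps[OF that, THEN conjunct2, THEN conjunct1]
        ps[OF that, THEN conjunct2, THEN conjunct2])+
  have he: "h e \<in> e" and se: "s e \<in> e" if "e \<in> A" for e using eq[OF that] by (metis insertI1 insertI2)+
  have FP: "proper_edge_coloring F col" using proper_edge_coloring_subset[OF P F(1)] .
  have inj: "inj_on g G" if "G \<subseteq> F" "\<And>e. e \<in> G \<Longrightarrow> g e \<in> e" "\<And>e. e \<in> G \<Longrightarrow> col e = b" for g :: "'a set \<Rightarrow> 'a" and G b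
  proof (rule inj_onI)
    fix e f assume ef: "e \<in> G" "f \<in> G" "g e = g f"
    show "e = f"
    proof (rule proper_eqD[OF FP])
      show "g e \<in> e" "g e \<in> f" using that(2) ef by metis+
      show "col e = col f" using that(3) ef by metis
    qed (use that(1) ef in auto)
  qed
  have end_in: "h e \<in> e" "s e \<in> e" if "e \<in> F" for e using he[of e] se[of e] that F(1) by blast+
  have sub: "Fc \<subseteq> F" "Fd \<subseteq> F" by (auto simp: Fc_def Fd_def)
  have colcd: "col e = c" if "e \<in> Fc" for e using that by (simp add: Fc_def)
  have coldd: "col e = d" if "e \<in> Fd" for e using that by (simp add: Fd_def)
  have inj_h: "inj_on h Fc" "inj_on h Fd"
    using inj[OF sub(1) _ colcd, of h] inj[OF sub(2) _ coldd, of h] end_in(1) sub by blast+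
  have inj_s: "inj_on s Fc" "inj_on s Fd"
    using inj[OF sub(1) _ colcd, of s] inj[OF sub(2) _ coldd, of s] end_in(2) sub by blast+
  have other: "\<exists>f\<in>F. v \<in> f \<and> col f \<in> {c, d} - {col e}"
    if e: "e \<in> F" "v \<in> e" "v \<noteq> u" "v \<noteq> w" for e v
  proof -
    have "2 \<le> vertex_degree F v" using links_ge2[OF F(3)] e by blast
    then obtain f where f: "f \<in> F" "v \<in> f" "f \<noteq> e" using vertex_degree_ge2_other[of F v e] by blast
    have "col f \<noteq> col e" using proper_eqD[OF FP f(1) e(1) f(2) e(2)] f(3) by blast
    then show ?thesis using f F(2) by blast
  qed
  have hu: "h e = v" if "e \<in> F" "v \<in> e" "v \<in> H" for e v
    using hubs_eq[of e v "h e"] he[of e] hH[of e] that F(1) by blast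
  have su: "s e = v" if "e \<in> F" "v \<in> e" "v \<notin> H" for e v
  proof -
    have "e \<in> A" using that(1) F(1) by blast
    from eq[OF this] hH[OF this] show ?thesis using that(2,3) by (metis insertE singletonD)
  qed
  obtain eu where eu: "eu \<in> F" "u \<in> eu" using F(3) vertex_degree_1E unfolding links_def by metis
  have "col eu = d" using F(2) eu u[of eu] F(1) by blast
  then have "u \<in> h ` Fd" using eu hu[OF eu uw(1)] by (force simp: Fd_def)
  moreover have "h ` Fc \<subseteq> h ` Fd - {u}"
  proof
    fix v assume "v \<in> h ` Fc"
    then obtain e where e: "e \<in> F" "col e = c" "v = h e" unfolding Fc_def by blast
    have v: "v \<in> e" "v \<in> H" using end_in(1)[OF e(1)] e(3) hH[of e] e(1) F(1) by blast+
    have "v \<noteq> u" "v \<noteq> w" using u[of e] w[of e] v(1) e F(1) by blast+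
    then obtain f where f: "f \<in> F" "v \<in> f" "col f \<in> {c, d} - {col e}" using other[OF e(1) v(1)] by blast
    then have "col f = d" using e(2) by auto
    note f = f(1,2) this
    then have "v \<in> h ` Fd" using hu[OF f(1,2) v(2)] by (force simp: Fd_def)
    then show "v \<in> h ` Fd - {u}" using \<open>v \<noteq> u\<close> by blast
  qed
  ultimately have "h ` Fc \<subset> h ` Fd" by blast
  then have "card (h ` Fc) < card (h ` Fd)"
    using fin by (intro psubset_card_mono) simp_all
  also have "\<dots> = card Fd" using inj_h(2) by (rule card_image)
  also have "\<dots> = card (s ` Fd)" using inj_s(2) by (rule card_image[symmetric])
  also have "\<dots> \<le> card (s ` Fc)"
  proof (rule card_mono)
    show "s ` Fd \<subseteq> s ` Fc"
    proof
      fix v assume "v \<in> s ` Fd"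
      then obtain e where e: "e \<in> F" "col e = d" "v = s e" unfolding Fd_def by blast
      have v: "v \<in> e" "v \<notin> H" using end_in(2)[OF e(1)] e(3) sH[of e] e(1) F(1) by blast+
      have "v \<noteq> u" "v \<noteq> w" using v(2) uw by blast+
      then obtain f where f: "f \<in> F" "v \<in> f" "col f \<in> {c, d} - {col e}" using other[OF e(1) v(1)] by blast
      then have "col f = c" using e(2) by auto
      note f = f(1,2) this
      then show "v \<in> s ` Fc" using su[OF f(1,2) v(2)] by (force simp: Fc_def)
    qed
  qed (use fin in simp)
  also have "\<dots> = card Fc" using inj_s(1) by (rule card_image)
  also have "\<dots> = card (h ` Fc)" using inj_h(1) by (rule card_image[symmetric])
  finally show False by simp
qed

text \<open>Marks the neighbours \<open>i\<close> of the last hub at which colour \<open>c\<close>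
  is dangerous: with \<open>c\<close> on the last edge, a two-coloured path from \<open>u\<close> to
  \<open>i\<close> would be prolonged to the last hub.\<close>

definition reached :: "'a set \<Rightarrow> ('a set \<Rightarrow> nat) \<Rightarrow> nat \<Rightarrow> 'a \<Rightarrow> 'a \<Rightarrow> bool" where
  "reached D col c u i \<longleftrightarrow> (\<exists>F\<subseteq>colored D. col ` F \<subseteq> {c, the (far D col i)} \<and> links F u i)"

text \<open>Before entering \<open>w\<close> by the \<open>c\<close>-edge \<open>wi\<close>, the
  link passes through the only other edge at \<open>i\<close>, of colour \<open>m\<close>. So
  \<open>d = m\<close>, and dropping \<open>wi\<close> leaves a link from \<open>u\<close> to
  \<open>i\<close> among the edges coloured before.\<close>

lemma link_through_last:
  assumes uw: "u \<in> H" "w \<in> H" "u \<noteq> w" and D: "D = H - {w}"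
    and a: "inj_on a (nbrs w)" and i: "i \<in> nbrs w" "a i = c" "far D col i = Some m" "m \<noteq> c"
    and F: "F \<subseteq> A" "recolor w a col ` F \<subseteq> {c, d}" "links F u w"
    and e: "e \<in> F" "w \<in> e" "recolor w a col e = c"
  shows "d = m \<and> reached D col c u i"
proof -
  have D': "D \<subseteq> H" "w \<notin> D" using D by auto
  obtain i' where i': "i' \<in> nbrs w" "e = {w, i'}" "i' \<notin> H" "i' \<noteq> w"
    using hub_edge[OF _ e(2) uw(2)] e(1) F(1) by blast
  have "a i' = c" using e(3) i' recolor_star by simp
  then have ii: "i' = i" using inj_onD[OF a _ i'(1) i(1)] i(2) by simp
  note i' = i'[unfolded ii]
  have "i \<noteq> u" using i'(3) uw by blast
  then have "2 \<le> vertex_degree F i" using links_ge2[OF F(3), of i] e(1) i'(2,4) by blast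
  then obtain g where g: "g \<in> F" "i \<in> g" "g \<noteq> e" using vertex_degree_ge2_other[of F i e] by blast
  have star_w: "f = e" if "f \<in> F" "w \<in> f" for f
    using F(3) e(1,2) that vertex_degree_1E[of F w] unfolding links_def by metis
  have wf: "f \<in> colored D \<and> recolor w a col f = col f" if f: "f \<in> F" "f \<noteq> e" for f
  proof -
    have "w \<notin> f" using star_w f by blast
    moreover obtain h where "h \<in> f" "h \<in> H" using edge_ends[of f] f(1) F(1) by blast
    ultimately show ?thesis using f F(1) D recolor_other by (auto simp: colored_def)
  qed
  have "{w, i} \<in> A" using i(1) by (simp add: nbrs_def)
  then have "far D col i = Some (col g)" using far_Some[OF D'(1) uw(2) D'(2) _ _ g(2)] wf[OF g(1,3)] by blast
  then have colg: "col g = m" using i(3) by simp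
  then have dm: "d = m" using wf[OF g(1,3)] F(2) g(1) i(4) by force
  define F' where "F' = F - {e}"
  have F'c: "F' \<subseteq> colored D" using wf unfolding F'_def by blast
  have col: "col ` F' \<subseteq> {c, m}"
  proof
    fix q assume "q \<in> col ` F'"
    then obtain f where f: "f \<in> F" "f \<noteq> e" "q = col f" unfolding F'_def by blast
    have "recolor w a col f \<in> {c, d}" using F(2) f(1) by blast
    then show "q \<in> {c, m}" using wf[OF f(1,2)] f(3) dm by simp
  qed
  have one: "vertex_degree F' i = 1"
  proof (rule vertex_degree_eq1[of g])
    show "g \<in> F'" "i \<in> g" using g by (auto simp: F'_def)
    show "f = g" if f: "f \<in> F'" "i \<in> f" for f
    proof -
      have "f = e \<or> f = g"
        using nonhub_edges[of e g f i] e(1) g f F(1) i'(2,3) unfolding F'_def by blast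
      then show ?thesis using f(1) by (simp add: F'_def)
    qed
  qed
  have same: "vertex_degree F' v = vertex_degree F v" if "v \<noteq> w" "v \<noteq> i" for v
    using that i'(2) by (intro vertex_degree_cong) (auto simp: F'_def)
  have "links F' u i"
    unfolding links_def
  proof (intro conjI ballI one)
    show "vertex_degree F' u = 1" using same[OF uw(3)] \<open>i \<noteq> u\<close> F(3) unfolding links_def by metis
    fix v assume v: "v \<in> \<Union>F' - {u, i}"
    then have "v \<noteq> w" using star_w unfolding F'_def by blast
    moreover have "v \<in> \<Union>F" using v unfolding F'_def by blast
    ultimately show "2 \<le> vertex_degree F' v" using links_ge2[OF F(3), of v] same[of v] v by simp
  qed
  then have "reached D col c u i" unfolding reached_def using F'c col i(3) by auto
  then show ?thesis using dm by blast
qed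

text \<open>For the case that the far side lacks \<open>c\<close> at \<open>w\<close>. Let
  \<open>x0\<close> be a neighbour of \<open>w\<close> whose far colour \<open>m x0\<close> is not
  \<open>c\<close>. If no path from \<open>u\<close> in \<open>c\<close> and \<open>m x0\<close>
  reaches \<open>x0\<close>, the edge to \<open>x0\<close> gets \<open>c\<close>. If one does and
  another neighbour \<open>j\<close> has a different far colour, \<open>x0\<close> gets
  \<open>c\<close> and \<open>j\<close> gets \<open>m x0\<close>, so both colours of the dangerous
  path occur at \<open>w\<close>. If all far colours agree, a second neighbour gets
  \<open>c\<close>, since the path from \<open>u\<close> ends at \<open>x0\<close> and not
  there.\<close>

lemma coloring_using:
  assumes conn: "connected_edges A" "H \<subseteq> \<Union>A" and uw: "u \<in> H" "w \<in> H" "u \<noteq> w" and c: "c < k"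
    and degu: "vertex_degree A u < k" and deg: "\<And>v. vertex_degree A v \<le> k"
    and degw: "2 \<le> vertex_degree A w" "vertex_degree A w < k"
  obtains col where "bicycle_free A col" "col ` A \<subseteq> {..<k}"
    "\<And>e. e \<in> A \<Longrightarrow> u \<in> e \<Longrightarrow> col e \<noteq> c" "\<exists>e\<in>A. w \<in> e \<and> col e = c"
    "\<And>F d e. F \<subseteq> A \<Longrightarrow> col ` F \<subseteq> {c, d} \<Longrightarrow> links F u w \<Longrightarrow> e \<in> F \<Longrightarrow> w \<in> e \<Longrightarrow> col e = c \<Longrightarrow>
      \<exists>e'\<in>A. w \<in> e' \<and> col e' = d"
proof -
  obtain col where col: "admissible u c k {w} col"
    using admissible_exists[OF conn uw(1,2) c degu deg] by blast
  define D where "D = H - {w}"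
  have D: "D \<subseteq> H" "w \<notin> D" and ins: "insert w D = H" using uw by (auto simp: D_def)
  have bf: "bicycle_free (colored D) col" and im: "col ` colored D \<subseteq> {..<k}"
    and cu: "\<And>e. e \<in> colored D \<Longrightarrow> u \<in> e \<Longrightarrow> col e \<noteq> c"
    using col uw(3) unfolding admissible_def D_def by blast+
  obtain e0 x0 where e0: "e0 \<in> colored D" "x0 \<in> e0" "x0 \<notin> H" "{w, x0} \<in> A" "col e0 \<noteq> c"
    using col uw(3) unfolding admissible_def D_def by blast
  note result = that
  note P = bicycle_free_proper[OF bf]
  define m where "m i = the (far D col i)" for i
  have nbrA: "{w, i} \<in> A \<and> i \<notin> H \<and> i \<noteq> w" if "i \<in> nbrs w" for i
    using that nbr_nonhub[OF uw(2)] nbr_neq by (auto simp: nbrs_def)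
  have far: "\<exists>g\<in>colored D. i \<in> g \<and> far D col i = Some (m i) \<and> col g = m i \<and> (\<forall>g'\<in>colored D. i \<in> g' \<longrightarrow> g' = g)"
    if i: "i \<in> nbrs w" for i
  proof -
    have i': "{w, i} \<in> A" "i \<notin> H" "i \<noteq> w" using nbrA[OF i] by auto
    have "vertex_degree A i = 2" using nonhub_degree i' by blast
    then obtain g where g: "g \<in> A" "i \<in> g" "g \<noteq> {w, i}" using vertex_degree_ge2_other[of A i "{w, i}"] by auto
    obtain h where h: "h \<in> H" "g = {h, i}" using hub_edge_nonhub[OF g(1,2) i'(2)] by blast
    then have gc: "g \<in> colored D" using g by (auto simp: colored_def D_def)
    have "far D col i = Some (col g)" using far_Some[OF D(1) uw(2) D(2) i'(1) gc g(2)] .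
    moreover from this have "m i = col g" by (simp add: m_def)
    moreover have "g' = g" if g': "g' \<in> colored D" "i \<in> g'" for g'
    proof -
      have "g' \<noteq> {w, i}" using not_colored_star[OF D(2) uw(2) D(1) g'(1)] by blast
      then show ?thesis
        using nonhub_edges[of "{w, i}" g g' i] i' g g' colored_subset by blast
    qed
    ultimately have "i \<in> g \<and> far D col i = Some (m i) \<and> col g = m i \<and> (\<forall>g'\<in>colored D. i \<in> g' \<longrightarrow> g' = g)"
      using g(2) by metis
    then show ?thesis using gc by (rule bexI)
  qed
  have mk: "m i < k" if "i \<in> nbrs w" for i using far[OF that] im by (metis image_subset_iff lessThan_iff)
  have farm: "far D col i = Some (m i)" if "i \<in> nbrs w" for i using far[OF that] by blast
  \<comment> \<open>In \<open>K p\<close> the vertex \<open>u\<close> has degree at most 1 because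
    \<open>c\<close> is absent at \<open>u\<close>, and so does each neighbour of \<open>w\<close>,
    which has a single coloured edge. Hence \<open>links_unique\<close> applies to paths between
    them.\<close>
  define K where "K p = {e \<in> colored D. col e \<in> {c, p}}" for p
  have K: "simple_edges (K p)" "finite (K p)" "vertex_degree (K p) v \<le> 2" "vertex_degree (K p) u \<le> 1" for p v
  proof -
    show "simple_edges (K p)" using simple_edges_subset[OF simple_colored[of D], of "K p"] by (auto simp: K_def)
    then show fin: "finite (K p)" by (rule simple_edges_finite)
    have KP: "proper_edge_coloring (K p) col"
      by (rule proper_edge_coloring_subset[OF P]) (auto simp: K_def)
    show "vertex_degree (K p) v \<le> 2"
      by (rule proper_bicolored_degree[OF KP, of c p]) (auto simp: K_def)
    show "vertex_degree (K p) u \<le> 1"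
    proof (rule vertex_degree_le1[OF fin])
      fix e f assume ef: "e \<in> K p" "f \<in> K p" "u \<in> e" "u \<in> f"
      have "col e = p" "col f = p" using ef cu unfolding K_def by blast+
      then show "e = f" using proper_eqD[OF KP ef] by simp
    qed
  qed
  have Kn: "vertex_degree (K p) i \<le> 1" if "i \<in> nbrs w" for p i
    by (rule vertex_degree_le1[OF K(2)]) (use far[OF that] in \<open>unfold K_def, blast\<close>)
  have reachedD: "\<exists>F\<subseteq>colored D. col ` F \<subseteq> {c, m i} \<and> links F u i" if "reached D col c u i" for i
    using that unfolding reached_def m_def .
  have far_linkD: "\<exists>F\<subseteq>colored D. col ` F \<subseteq> {m i, m j} \<and> links F i j" if "far_link D col i j" for i j
    using that unfolding far_link_def m_def .
  have uni: "\<not> (reached D col c u i \<and> reached D col c u j)"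
    if ij: "i \<in> nbrs w" "j \<in> nbrs w" "i \<noteq> j" "m i = m j" for i j
  proof
    assume "reached D col c u i \<and> reached D col c u j"
    then obtain F F' where F: "F \<subseteq> colored D" "col ` F \<subseteq> {c, m i}" "links F u i"
      and F': "F' \<subseteq> colored D" "col ` F' \<subseteq> {c, m j}" "links F' u j"
      using reachedD[of i] reachedD[of j] by metis
    have "F \<subseteq> K (m i)" "F' \<subseteq> K (m i)" using F F' unfolding K_def ij(4) by auto
    moreover have "u \<noteq> i" "u \<noteq> j" using nbrA[OF ij(1)] nbrA[OF ij(2)] uw(1) by auto
    ultimately show False
      using links_unique[OF K(1) K(3) _ F(3) _ F'(3) K(4) Kn[OF ij(1)] Kn[OF ij(2)]] ij(3) by blast
  qed
  \<comment> \<open>The swap between \<open>i\<close> and \<open>j\<close> would need a second path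
    out of \<open>i\<close> in the same two colours, besides the one to \<open>u\<close>.\<close>
  have uni': "\<not> far_link D col i j"
    if ij: "i \<in> nbrs w" "j \<in> nbrs w" "i \<noteq> j" "m j = c" "reached D col c u i" for i j
  proof
    assume "far_link D col i j"
    then obtain F F' where F: "F \<subseteq> colored D" "col ` F \<subseteq> {c, m i}" "links F i u"
      and F': "F' \<subseteq> colored D" "col ` F' \<subseteq> {m i, m j}" "links F' i j"
      using reachedD[OF ij(5)] far_linkD[of i j] links_sym by metis
    have "F \<subseteq> K (m i)" "F' \<subseteq> K (m i)" using F F'(1) F'(2)[unfolded ij(4)] unfolding K_def by auto
    moreover have "u \<noteq> i" "u \<noteq> j" using nbrA[OF ij(1)] nbrA[OF ij(2)] uw(1) by auto
    ultimately show False
      using links_unique[OF K(1) K(3) _ F(3) _ F'(3) Kn[OF ij(1)] K(4) Kn[OF ij(2)]] ij(3) by blast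
  qed
  have cw: "card (nbrs w) < card {..<k}" using degw card_nbrs by simp
  \<comment> \<open>Only the edges to \<open>J\<close> are prescribed;
    \<open>vertex_degree A w < k\<close> leaves room for the greedy completion of the star.\<close>
  have finish: thesis
    if sa: "star_assignment J {..<k} (far D col) (far_link D col) a0" "J \<subseteq> nbrs w"
      and i: "i \<in> J" "a0 i = c" "m i \<noteq> c"
      and ok: "reached D col c u i \<Longrightarrow> \<exists>j\<in>J. a0 j = m i" for J a0 i
  proof -
    obtain a where a: "star_assignment (nbrs w) {..<k} (far D col) (far_link D col) a" "\<forall>j\<in>J. a j = a0 j"
      using star_extend_less[OF sa finite_lessThan cw] by blast
    have ak: "a ` nbrs w \<subseteq> {..<k}" and inj: "inj_on a (nbrs w)" using a(1) unfolding star_assignment_def by blast+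
    have iN: "i \<in> nbrs w" and ai: "a i = c" using i sa(2) a(2) by auto
    show thesis
    proof (rule result[of "recolor w a col"])
      show "bicycle_free A (recolor w a col)"
        using recolor_bicycle_free[OF D(1) uw(2) D(2) bf a(1)] ins colored_H by simp
      show "recolor w a col ` A \<subseteq> {..<k}"
        using recolor_image[OF uw(2) im ak] ins colored_H by simp
      show "recolor w a col e \<noteq> c" if e: "e \<in> A" "u \<in> e" for e
      proof -
        have "w \<notin> e" using hubs_eq[OF e uw(1), of w] uw by blast
        moreover have "e \<in> colored D" using e uw by (auto simp: colored_def D_def)
        ultimately show ?thesis using cu[of e] e(2) recolor_other[of w e a col] by simp
      qed
      have "recolor w a col {w, i} = c" using recolor_star[of i w a col] nbrA[OF iN] ai by simp
      then show "\<exists>e\<in>A. w \<in> e \<and> recolor w a col e = c" using nbrA[OF iN] by blast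
      fix F d e assume F: "F \<subseteq> A" "recolor w a col ` F \<subseteq> {c, d}" "links F u w"
        and e: "e \<in> F" "w \<in> e" "recolor w a col e = c"
      have "d = m i \<and> reached D col c u i"
        by (rule link_through_last[OF uw D_def inj iN ai farm[OF iN] i(3) F e])
      then obtain j where j: "j \<in> J" "a0 j = d" using ok by blast
      then have jN: "j \<in> nbrs w" and "a j = d" using sa(2) a(2) by auto
      then have "recolor w a col {w, j} = d" using recolor_star[of j w a col] nbrA[OF jN] by simp
      then show "\<exists>e'\<in>A. w \<in> e' \<and> recolor w a col e' = d" using nbrA[OF jN] by blast
    qed
  qed
  have single: thesis if i: "i \<in> nbrs w" "m i \<noteq> c" "\<not> reached D col c u i" for i
  proof (rule finish[of "{i}" "\<lambda>_. c" i])
    show "star_assignment {i} {..<k} (far D col) (far_link D col) (\<lambda>_. c)"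
      using farm[OF i(1)] i(2) c by (auto simp: star_assignment_def)
  qed (use i in auto)
  have x0: "x0 \<in> nbrs w" using e0(4) by (simp add: nbrs_def)
  have "far D col x0 = Some (col e0)" using far_Some[OF D(1) uw(2) D(2) e0(4,1,2)] .
  then have mx0: "m x0 \<noteq> c" using e0(5) by (simp add: m_def)
  show thesis
  proof (cases "reached D col c u x0")
    case False
    then show ?thesis using single[OF x0 mx0] by blast
  next
    case r: True
    show ?thesis
    proof (cases "\<exists>j\<in>nbrs w. m j \<noteq> m x0")
      case True
      then obtain j where j: "j \<in> nbrs w" "m j \<noteq> m x0" by blast
      then have jx: "j \<noteq> x0" by blast
      have sw: "m j = c \<Longrightarrow> \<not> far_link D col x0 j" "m j = c \<Longrightarrow> \<not> far_link D col j x0"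
        using uni'[OF x0 j(1) jx[symmetric] _ r] far_link_sym by blast+
      show ?thesis
      proof (rule finish[of "{x0, j}" "\<lambda>y. if y = x0 then c else m x0" x0])
        show "star_assignment {x0, j} {..<k} (far D col) (far_link D col) (\<lambda>y. if y = x0 then c else m x0)"
          using farm[OF x0] farm[OF j(1)] mx0 j(2) jx c mk[OF x0] sw
          by (auto simp: star_assignment_def)
      qed (use x0 j mx0 jx in auto)
    next
      case False
      have "\<not> nbrs w \<subseteq> {x0}"
      proof
        assume "nbrs w \<subseteq> {x0}"
        then have "card (nbrs w) \<le> 1" using card_mono[of "{x0}" "nbrs w"] by simp
        then show False using degw card_nbrs by simp
      qed
      then obtain j where j: "j \<in> nbrs w" "j \<noteq> x0" by blast
      then have mj: "m j = m x0" using False by blast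
      then have "\<not> reached D col c u j" using uni[OF x0 j(1)] j(2) r by auto
      then show ?thesis using single[OF j(1)] mj mx0 by simp
    qed
  qed
qed

end

section \<open>Gluing colourings\<close>

definition colorable :: "nat \<Rightarrow> 'a set set \<Rightarrow> bool" where
  "colorable k E \<longleftrightarrow> (\<exists>col. bicycle_free E col \<and> col ` E \<subseteq> {..<k})"

text \<open>\<open>P\<close> is sent injectively into the complement of \<open>Q\<close>, which is
  large enough, and the remaining elements fill what is left.\<close>

lemma permutation_avoiding:
  assumes X: "finite X" "P \<subseteq> X" "Q \<subseteq> X" "card P + card Q \<le> card X"
  obtains \<pi> where "bij_betw \<pi> X X" "\<pi> ` P \<inter> Q = {}"
proof -
  have fin: "finite P" "finite Q" using X finite_subset by blast+
  have "card P \<le> card (X - Q)" using X fin by (simp add: card_Diff_subset)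
  then obtain P' where P': "P' \<subseteq> X - Q" "card P' = card P" "finite P'"
    using obtain_subset_with_card_n by metis
  obtain f where f: "bij_betw f P P'" using finite_same_card_bij[OF fin(1) P'(3)] P'(2) by auto
  have P'X: "P' \<subseteq> X" using P'(1) by blast
  have "card (X - P) = card (X - P')" using X P' P'X fin by (simp add: card_Diff_subset)
  then obtain g where g: "bij_betw g (X - P) (X - P')" using finite_same_card_bij X(1) by blast
  let ?p = "\<lambda>x. if x \<in> P then f x else g x"
  have 1: "bij_betw ?p P P'" using f by (rule bij_betw_cong[THEN iffD1, rotated]) simp
  have 2: "bij_betw ?p (X - P) (X - P')" using g by (rule bij_betw_cong[THEN iffD1, rotated]) simp
  have "bij_betw ?p (P \<union> (X - P)) (P' \<union> (X - P'))" using 1 2 by (rule bij_betw_combine) blast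
  then have "bij_betw ?p X X" using X(2) P'X by (simp add: Un_absorb1 Un_Diff_cancel)
  moreover have "?p ` P \<inter> Q = {}" using 1 P'(1) unfolding bij_betw_def by blast
  ultimately show ?thesis using that by blast
qed

lemma bicycle_free_inj_recolor:
  assumes col: "bicycle_free E col" and inj: "inj_on \<pi> C" and C: "col ` E \<subseteq> C"
  shows "bicycle_free E (\<pi> \<circ> col)"
proof (rule bicycle_freeI)
  show "proper_edge_coloring E (\<pi> \<circ> col)"
    unfolding proper_edge_coloring_def
  proof (intro ballI impI)
    fix e f assume ef: "e \<in> E" "f \<in> E" "e \<noteq> f" "e \<inter> f \<noteq> {}"
    then have "col e \<noteq> col f" using bicycle_free_proper[OF col] unfolding proper_edge_coloring_def by blast
    then show "(\<pi> \<circ> col) e \<noteq> (\<pi> \<circ> col) f" using inj_on_contraD[OF inj] ef C by (metis comp_apply image_subset_iff)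
  qed
  fix F a b assume F: "F \<subseteq> E" "F \<noteq> {}" "(\<pi> \<circ> col) ` F \<subseteq> {a, b}" and deg: "\<And>v. v \<in> \<Union>F \<Longrightarrow> 2 \<le> vertex_degree F v"
  have "col ` F \<subseteq> {inv_into C \<pi> a, inv_into C \<pi> b}"
  proof
    fix q assume "q \<in> col ` F"
    then obtain e where e: "e \<in> F" "q = col e" by blast
    have "inv_into C \<pi> (\<pi> q) = q" using inv_into_f_f[OF inj] e F(1) C by blast
    moreover have "\<pi> q = a \<or> \<pi> q = b" using F(3) e by auto
    ultimately show "q \<in> {inv_into C \<pi> a, inv_into C \<pi> b}" by auto
  qed
  then show False using bicycle_free_empty[OF col F(1)] deg F(2) by blast
qed

lemma bicycle_free_subset: "bicycle_free E col \<Longrightarrow> F \<subseteq> E \<Longrightarrow> bicycle_free F col"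
  unfolding bicycle_free_def using proper_edge_coloring_subset by (metis order_trans)

text \<open>A two-coloured cycle cannot cross the single vertex \<open>w\<close>: in its part inside
  \<open>A\<close> every vertex other than \<open>w\<close> has degree 2, so by parity
  \<open>w\<close> does not have degree 1, and that part has minimum degree 2 by itself.\<close>

lemma bicycle_free_glue:
  assumes E: "simple_edges (A \<union> B)" and sep: "\<Union>A \<inter> \<Union>B \<subseteq> {w}"
    and A: "bicycle_free A \<phi>" and B: "bicycle_free B \<psi>"
    and w: "\<And>e f. e \<in> A \<Longrightarrow> f \<in> B \<Longrightarrow> w \<in> e \<Longrightarrow> w \<in> f \<Longrightarrow> \<phi> e \<noteq> \<psi> f"
  shows "bicycle_free (A \<union> B) (\<lambda>e. if e \<in> A then \<phi> e else \<psi> e)" (is "bicycle_free _ ?col")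
proof (rule bicycle_freeI)
  have sA: "simple_edges A" using simple_edges_subset[OF E] by blast
  have disj: "A \<inter> B = {}" using sep_disjoint[OF sA sep] .
  have Bcol: "?col e = \<psi> e" if "e \<in> B" for e using that disj by auto
  have cross: "\<phi> e \<noteq> \<psi> f" if ef: "e \<in> A" "f \<in> B" "e \<inter> f \<noteq> {}" for e f
  proof -
    obtain v where v: "v \<in> e" "v \<in> f" using ef(3) by blast
    then have "v = w" using sep ef(1,2) by blast
    then show ?thesis using w ef v by blast
  qed
  show P: "proper_edge_coloring (A \<union> B) ?col"
    unfolding proper_edge_coloring_def
  proof (intro ballI impI)
    fix e f assume ef: "e \<in> A \<union> B" "f \<in> A \<union> B" "e \<noteq> f" "e \<inter> f \<noteq> {}"
    have fe: "f \<inter> e \<noteq> {}" using ef(4) by blast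
    show "?col e \<noteq> ?col f"
    proof (cases "e \<in> A"; cases "f \<in> A")
      assume "e \<in> A" "f \<in> A"
      then show ?thesis using bicycle_free_proper[OF A] ef(3,4) unfolding proper_edge_coloring_def by simp
    next
      assume "e \<in> A" "f \<notin> A"
      then show ?thesis using cross[of e f] ef by simp
    next
      assume "e \<notin> A" "f \<in> A"
      then show ?thesis using cross[of f e] ef fe by simp
    next
      assume "e \<notin> A" "f \<notin> A"
      then show ?thesis using bicycle_free_proper[OF B] ef unfolding proper_edge_coloring_def by simp
    qed
  qed
  fix F a b assume F: "F \<subseteq> A \<union> B" "F \<noteq> {}" "?col ` F \<subseteq> {a, b}" and deg: "\<And>v. v \<in> \<Union>F \<Longrightarrow> 2 \<le> vertex_degree F v"
  define F1 where "F1 = F \<inter> A"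
  have sF1: "simple_edges F1" using simple_edges_subset[OF sA, of F1] by (simp add: F1_def)
  have FP: "proper_edge_coloring F ?col" using proper_edge_coloring_subset[OF P F(1)] .
  have deg2: "vertex_degree F v = 2" if "v \<in> \<Union>F" for v
    using deg[OF that] proper_bicolored_degree[OF FP F(3), of v] by simp
  have same: "vertex_degree F1 v = 2" if v: "v \<in> \<Union>F1" "v \<noteq> w" for v
  proof -
    have "v \<notin> \<Union>B" using v sep unfolding F1_def by blast
    then have "vertex_degree F1 v = vertex_degree F v"
      using F(1) unfolding F1_def by (intro vertex_degree_cong) blast
    then show ?thesis using deg2[of v] v(1) unfolding F1_def by auto
  qed
  have "F1 = {}"
  proof (rule bicycle_free_empty[OF A])
    show "F1 \<subseteq> A" by (simp add: F1_def)
    show "\<phi> ` F1 \<subseteq> {a, b}" using F(3) unfolding F1_def by auto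
    show "2 \<le> vertex_degree F1 v" if v: "v \<in> \<Union>F1" for v
    proof (cases "v = w")
      case True
      have "vertex_degree F1 w \<noteq> 1"
      proof
        assume "vertex_degree F1 w = 1"
        then have "odd (vertex_degree F1 w)" by simp
        then obtain y where y: "y \<noteq> w" "odd (vertex_degree F1 y)" using odd_vertex_pair[OF sF1] by blast
        have "y \<in> \<Union>F1" by (rule ccontr) (use y(2) vertex_degree_0[of y F1] in simp)
        then show False using same[of y] y by simp
      qed
      moreover have "0 < vertex_degree F1 w" using vertex_degree_pos[OF simple_edges_finite[OF sF1]] v True by blast
      ultimately show ?thesis using True by simp
    qed (use same[OF v] in simp)
  qed
  then have FB: "F \<subseteq> B" using F(1) unfolding F1_def by blast
  have "\<psi> e = ?col e" if "e \<in> F" for e by (rule Bcol[symmetric]) (use FB that in blast)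
  then have "\<psi> ` F = ?col ` F" by (intro image_cong refl)
  then show False using bicycle_free_empty[OF B FB] deg F(2,3) by metis
qed

lemma colorable_glue:
  assumes E: "simple_edges (A \<union> B)" and sep: "\<Union>A \<inter> \<Union>B \<subseteq> {w}"
    and A: "colorable k A" and B: "colorable k B"
    and deg: "vertex_degree (A \<union> B) w \<le> k"
  shows "colorable k (A \<union> B)"
proof -
  obtain \<phi> \<psi> where \<phi>: "bicycle_free A \<phi>" "\<phi> ` A \<subseteq> {..<k}" and \<psi>: "bicycle_free B \<psi>" "\<psi> ` B \<subseteq> {..<k}"
    using A B unfolding colorable_def by blast
  define P where "P = \<psi> ` {e \<in> B. w \<in> e}"
  define Q where "Q = \<phi> ` {e \<in> A. w \<in> e}"
  have sA: "simple_edges A" and sB: "simple_edges B" using simple_edges_subset[OF E] by blast+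
  have "card P + card Q = vertex_degree (A \<union> B) w"
    unfolding P_def Q_def using proper_card_star[OF bicycle_free_proper[OF \<phi>(1)], of w]
      proper_card_star[OF bicycle_free_proper[OF \<psi>(1)], of w]
      vertex_degree_Un[OF simple_edges_finite[OF sA] simple_edges_finite[OF sB] sep_disjoint[OF sA sep], of w]
    by simp
  then have "card P + card Q \<le> card {..<k}" using deg by simp
  moreover have "P \<subseteq> {..<k}" "Q \<subseteq> {..<k}" using \<phi>(2) \<psi>(2) unfolding P_def Q_def by blast+
  ultimately obtain \<pi> where \<pi>: "bij_betw \<pi> {..<k} {..<k}" "\<pi> ` P \<inter> Q = {}"
    using permutation_avoiding[OF finite_lessThan] by metis
  have \<pi>\<psi>: "bicycle_free B (\<pi> \<circ> \<psi>)"
    using bicycle_free_inj_recolor[OF \<psi>(1) _ \<psi>(2)] \<pi>(1) by (simp add: bij_betw_def)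
  have "\<phi> e \<noteq> (\<pi> \<circ> \<psi>) f" if "e \<in> A" "f \<in> B" "w \<in> e" "w \<in> f" for e f
    using \<pi>(2) that unfolding P_def Q_def by force
  then have "bicycle_free (A \<union> B) (\<lambda>e. if e \<in> A then \<phi> e else (\<pi> \<circ> \<psi>) e)"
    by (rule bicycle_free_glue[OF E sep \<phi>(1) \<pi>\<psi>])
  moreover have "(\<lambda>e. if e \<in> A then \<phi> e else (\<pi> \<circ> \<psi>) e) ` (A \<union> B) \<subseteq> {..<k}"
  proof -
    have "\<pi> (\<psi> e) < k" if "e \<in> B" for e using \<pi>(1) \<psi>(2) that unfolding bij_betw_def by blast
    moreover have "\<phi> e < k" if "e \<in> A" for e using \<phi>(2) that by blast
    ultimately show ?thesis by auto
  qed
  ultimately show ?thesis unfolding colorable_def by blast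
qed

section \<open>Adding an edge across a separation\<close>

lemma proper_edge_coloring_insert:
  assumes col: "proper_edge_coloring E col" and p: "\<And>f. f \<in> E \<Longrightarrow> f \<inter> e \<noteq> {} \<Longrightarrow> col f \<noteq> p"
  shows "proper_edge_coloring (insert e E) (col(e := p))"
  unfolding proper_edge_coloring_def
proof (intro ballI impI)
  fix f g assume fg: "f \<in> insert e E" "g \<in> insert e E" "f \<noteq> g" "f \<inter> g \<noteq> {}"
  show "(col(e := p)) f \<noteq> (col(e := p)) g"
  proof (cases "f = e")
    case True
    then have "g \<in> E" "g \<inter> e \<noteq> {}" using fg by blast+
    then show ?thesis using p[of g] True fg(3) by auto
  next
    case False
    then have f: "f \<in> E" using fg by blast
    show ?thesis
    proof (cases "g = e")
      case True
      then have "f \<inter> e \<noteq> {}" using fg by blast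
      then show ?thesis using p[OF f] True False by auto
    next
      case g: False
      then have "g \<in> E" using fg by blast
      then have "col f \<noteq> col g" using col f fg unfolding proper_edge_coloring_def by blast
      then show ?thesis using False g by simp
    qed
  qed
qed

lemma bicycle_free_insert:
  assumes col: "bicycle_free E col" and e: "e \<notin> E" and p: "\<And>f. f \<in> E \<Longrightarrow> f \<inter> e \<noteq> {} \<Longrightarrow> col f \<noteq> p"
    and no: "\<And>F a b. F \<subseteq> insert e E \<Longrightarrow> e \<in> F \<Longrightarrow> (col(e := p)) ` F \<subseteq> {a, b} \<Longrightarrow>
      (\<And>v. v \<in> \<Union>F \<Longrightarrow> 2 \<le> vertex_degree F v) \<Longrightarrow> False"
  shows "bicycle_free (insert e E) (col(e := p))"
proof (rule bicycle_freeI)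
  show "proper_edge_coloring (insert e E) (col(e := p))"
    by (rule proper_edge_coloring_insert[OF bicycle_free_proper[OF col] p])
  fix F a b assume F: "F \<subseteq> insert e E" "F \<noteq> {}" "(col(e := p)) ` F \<subseteq> {a, b}"
    and deg: "\<And>v. v \<in> \<Union>F \<Longrightarrow> 2 \<le> vertex_degree F v"
  show False
  proof (cases "e \<in> F")
    case True
    then show False using no[OF F(1) _ F(3)] deg by blast
  next
    case False
    then have FE: "F \<subseteq> E" using F(1) by blast
    have "col ` F = (col(e := p)) ` F" using False by (intro image_cong) auto
    then show False using bicycle_free_empty[OF col FE] F(2,3) deg by metis
  qed
qed

text \<open>A new two-coloured cycle contains \<open>uz\<close>. Its part in \<open>A\<close> has
  degree 1 at \<open>u\<close> and by parity also at \<open>w\<close>, so it is a link in colours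
  \<open>c\<close> and \<open>d\<close>. The edge by which the cycle leaves \<open>w\<close> lies in
  \<open>B\<close> and would repeat a colour that \<open>A\<close> has at \<open>w\<close>.\<close>

lemma bicycle_free_close:
  assumes E: "simple_edges (insert {u, z} (A \<union> B))" and sep: "\<Union>A \<inter> \<Union>B \<subseteq> {w}" "u \<notin> \<Union>B" "z \<notin> \<Union>A"
    and ne: "w \<noteq> u" "w \<noteq> z" "u \<noteq> z"
    and A: "bicycle_free A \<phi>" and B: "bicycle_free B \<psi>"
    and w: "\<And>e f. e \<in> A \<Longrightarrow> f \<in> B \<Longrightarrow> w \<in> e \<Longrightarrow> w \<in> f \<Longrightarrow> \<phi> e \<noteq> \<psi> f"
    and cu: "\<And>e. e \<in> A \<Longrightarrow> u \<in> e \<Longrightarrow> \<phi> e \<noteq> c" and cz: "\<And>e. e \<in> B \<Longrightarrow> z \<in> e \<Longrightarrow> \<psi> e \<noteq> c"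
    and links: "\<And>F d. F \<subseteq> A \<Longrightarrow> \<phi> ` F \<subseteq> {c, d} \<Longrightarrow> links F u w \<Longrightarrow>
      {c, d} \<subseteq> \<phi> ` {e \<in> A. w \<in> e}"
  shows "bicycle_free (insert {u, z} (A \<union> B)) ((\<lambda>e. if e \<in> A then \<phi> e else \<psi> e)({u, z} := c))"
    (is "bicycle_free ?E (?g({u, z} := c))")
proof -
  have sAB: "simple_edges (A \<union> B)" using simple_edges_subset[OF E] by blast
  have sA: "simple_edges A" using simple_edges_subset[OF E] by blast
  have disj: "A \<inter> B = {}" using sep_disjoint[OF sA sep(1)] .
  have uz: "{u, z} \<notin> A" "{u, z} \<notin> B" using sep by blast+
  let ?col = "?g({u, z} := c)"
  have colA: "?col e = \<phi> e" if "e \<in> A" for e using that uz by auto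
  have colB: "?col e = \<psi> e" if "e \<in> B" for e using that uz disj by auto
  have AB: "bicycle_free (A \<union> B) ?g" by (rule bicycle_free_glue[OF sAB sep(1) A B w])
  have cAB: "?g e \<noteq> c" if e: "e \<in> A \<union> B" "e \<inter> {u, z} \<noteq> {}" for e
  proof (cases "e \<in> A")
    case True
    then have "u \<in> e" using e(2) sep(3) by blast
    then show ?thesis using cu[OF True] True by simp
  next
    case False
    then have eB: "e \<in> B" using e by blast
    then have "z \<in> e" using e(2) sep(2) by blast
    then show ?thesis using cz[OF eB] False by simp
  qed
  have P: "proper_edge_coloring ?E ?col"
    by (rule proper_edge_coloring_insert[OF bicycle_free_proper[OF AB] cAB])
  show ?thesis
  proof (rule bicycle_free_insert[OF AB _ cAB])
    show "{u, z} \<notin> A \<union> B" using uz by blast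
    fix F a b assume F: "F \<subseteq> ?E" and uzF: "{u, z} \<in> F" and F3: "?col ` F \<subseteq> {a, b}"
      and deg: "\<And>v. v \<in> \<Union>F \<Longrightarrow> 2 \<le> vertex_degree F v"
    have FP: "proper_edge_coloring F ?col" using proper_edge_coloring_subset[OF P F] .
    have deg2: "vertex_degree F v = 2" if "v \<in> \<Union>F" for v
      using deg[OF that] proper_bicolored_degree[OF FP F3, of v] by simp
    define F1 where "F1 = F \<inter> A"
    have sF1: "simple_edges F1" using simple_edges_subset[OF sA, of F1] by (simp add: F1_def)
    have F1F: "F1 \<subseteq> F" by (simp add: F1_def)
    have "c \<in> {a, b}" using F3 uzF by force
    then obtain d where d: "{a, b} = {c, d}" by blast
    have colF: "?col e = c \<or> ?col e = d" if "e \<in> F" for e using F3 that d by blast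
    have inner: "vertex_degree F1 v = 2" if v: "v \<in> \<Union>F1" "v \<noteq> w" "v \<noteq> u" for v
    proof -
      have "v \<notin> \<Union>B" "v \<noteq> z" using v sep unfolding F1_def by blast+
      then have "vertex_degree F1 v = vertex_degree F v"
        using F v(3) unfolding F1_def by (intro vertex_degree_cong) blast
      moreover have "v \<in> \<Union>F" using v(1) F1F by blast
      ultimately show ?thesis using deg2 by simp
    qed
    have u1: "vertex_degree F1 u = 1"
    proof -
      have "u \<in> \<Union>F" using uzF by blast
      then obtain g where g: "g \<in> F" "u \<in> g" "g \<noteq> {u, z}" "\<And>f. f \<in> F \<Longrightarrow> u \<in> f \<Longrightarrow> f = {u, z} \<or> f = g"
        using vertex_degree_2E[OF deg2 uzF, of u] by blast
      have "g \<in> A" using F g(1,2,3) sep(2) by blast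
      then show ?thesis
        using g uz(1) by (intro vertex_degree_eq1[of g]) (auto simp: F1_def)
    qed
    then have "odd (vertex_degree F1 u)" by simp
    then obtain y where y: "y \<noteq> u" "odd (vertex_degree F1 y)" using odd_vertex_pair[OF sF1] by blast
    have "y \<in> \<Union>F1" by (rule ccontr) (use y(2) vertex_degree_0[of y F1] in simp)
    then have "y = w" using inner[of y] y by fastforce
    have finF: "finite F" using F simple_edges_finite[OF E] finite_subset by blast
    have "w \<in> \<Union>F" using \<open>y \<in> \<Union>F1\<close> \<open>y = w\<close> F1F by blast
    have w1: "vertex_degree F1 w = 1"
    proof -
      have "vertex_degree F1 w \<le> 2"
        using vertex_degree_mono[OF finF F1F, of w] deg2[OF \<open>w \<in> \<Union>F\<close>] by simp
      moreover have "odd (vertex_degree F1 w)" using y(2) \<open>y = w\<close> by simp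
      ultimately show ?thesis by (metis One_nat_def dvd_refl even_Suc le_Suc_eq le_zero_eq numeral_2_eq_2 even_zero)
    qed
    obtain e where e: "e \<in> F1" "w \<in> e" "\<And>e'. e' \<in> F1 \<Longrightarrow> w \<in> e' \<Longrightarrow> e' = e"
      using vertex_degree_1E[OF w1] by blast
    have "links F1 u w"
      unfolding links_def using u1 w1 inner by auto
    moreover have "\<phi> ` F1 \<subseteq> {c, d}"
    proof
      fix q assume "q \<in> \<phi> ` F1"
      then obtain f where f: "f \<in> F" "f \<in> A" "q = \<phi> f" unfolding F1_def by blast
      then show "q \<in> {c, d}" using colF[OF f(1)] colA[OF f(2)] by simp
    qed
    ultimately have cd: "{c, d} \<subseteq> \<phi> ` {e \<in> A. w \<in> e}" using links[of F1 d] unfolding F1_def by blast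
    obtain f where f: "f \<in> F" "w \<in> f" "f \<noteq> e"
      using vertex_degree_ge2_other[OF deg[OF \<open>w \<in> \<Union>F\<close>], of e] by blast
    have "f \<notin> A" using e(3) f unfolding F1_def by blast
    moreover have "f \<noteq> {u, z}" using f(2) ne by blast
    ultimately have fB: "f \<in> B" using F f(1) by blast
    have "\<psi> f \<in> {c, d}" using colF[OF f(1)] colB[OF fB] by simp
    then obtain e' where "e' \<in> A" "w \<in> e'" "\<phi> e' = \<psi> f" using cd by force
    then show False using w[OF _ fB _ f(2)] by blast
  qed
qed

text \<open>The permutation of the colours on \<open>B\<close> has to fix \<open>c\<close>, to keep
  it absent at \<open>z\<close>. Since exactly one side uses \<open>c\<close> at \<open>w\<close>,
  the other colours at \<open>w\<close> number at most \<open>k - 1\<close> in total and can be kept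
  apart within the remaining \<open>k - 1\<close> colours.\<close>

lemma colorable_close:
  assumes E: "simple_edges (insert {u, z} (A \<union> B))" and sep: "\<Union>A \<inter> \<Union>B \<subseteq> {w}" "u \<notin> \<Union>B" "z \<notin> \<Union>A"
    and ne: "w \<noteq> u" "w \<noteq> z" "u \<noteq> z" and c: "c < k"
    and A: "bicycle_free A \<phi>" "\<phi> ` A \<subseteq> {..<k}" and B: "bicycle_free B \<psi>" "\<psi> ` B \<subseteq> {..<k}"
    and deg: "vertex_degree A w + vertex_degree B w \<le> k"
    and cw: "c \<in> \<phi> ` {e \<in> A. w \<in> e} \<longleftrightarrow> c \<notin> \<psi> ` {e \<in> B. w \<in> e}"
    and cu: "\<And>e. e \<in> A \<Longrightarrow> u \<in> e \<Longrightarrow> \<phi> e \<noteq> c" and cz: "\<And>e. e \<in> B \<Longrightarrow> z \<in> e \<Longrightarrow> \<psi> e \<noteq> c"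
    and links: "\<And>F d. F \<subseteq> A \<Longrightarrow> \<phi> ` F \<subseteq> {c, d} \<Longrightarrow> links F u w \<Longrightarrow>
      {c, d} \<subseteq> \<phi> ` {e \<in> A. w \<in> e}"
  shows "colorable k (insert {u, z} (A \<union> B))"
proof -
  define P where "P = \<psi> ` {e \<in> B. w \<in> e}"
  define Q where "Q = \<phi> ` {e \<in> A. w \<in> e}"
  have sub: "P \<subseteq> {..<k}" "Q \<subseteq> {..<k}" using A(2) B(2) unfolding P_def Q_def by blast+
  then have fin: "finite P" "finite Q" using finite_subset by blast+
  have PQ: "card P + card Q \<le> k"
    unfolding P_def Q_def using proper_card_star[OF bicycle_free_proper[OF A(1)], of w]
      proper_card_star[OF bicycle_free_proper[OF B(1)], of w] deg by simp
  have "card (P - {c}) + card (Q - {c}) \<le> card ({..<k} - {c})"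
  proof (cases "c \<in> P")
    case True
    then have "c \<notin> Q" using cw unfolding P_def Q_def by blast
    moreover have "card P > 0" using True fin(1) card_gt_0_iff by blast
    ultimately show ?thesis using True PQ c fin by (simp add: card_Diff_singleton)
  next
    case False
    then have "c \<in> Q" using cw unfolding P_def Q_def by blast
    moreover from this have "card Q > 0" using fin(2) card_gt_0_iff by blast
    ultimately show ?thesis using False PQ c fin by (simp add: card_Diff_singleton)
  qed
  moreover have "P - {c} \<subseteq> {..<k} - {c}" "Q - {c} \<subseteq> {..<k} - {c}" using sub by blast+
  ultimately obtain \<rho> where \<rho>: "bij_betw \<rho> ({..<k} - {c}) ({..<k} - {c})" "\<rho> ` (P - {c}) \<inter> (Q - {c}) = {}"
    using permutation_avoiding[OF finite_Diff[OF finite_lessThan]] by metis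
  define \<pi> where "\<pi> i = (if i = c then c else \<rho> i)" for i
  have im: "\<rho> i < k" "\<rho> i \<noteq> c" if "i < k" "i \<noteq> c" for i using \<rho>(1) that unfolding bij_betw_def by blast+
  have inj: "inj_on \<pi> {..<k}"
  proof (rule inj_onI)
    fix i j assume ij: "i \<in> {..<k}" "j \<in> {..<k}" "\<pi> i = \<pi> j"
    have "inj_on \<rho> ({..<k} - {c})" using \<rho>(1) by (simp add: bij_betw_def)
    then show "i = j" using ij im[of i] im[of j] inj_onD[of \<rho> "{..<k} - {c}" i j]
      unfolding \<pi>_def by (auto split: if_splits)
  qed
  have \<pi>k: "\<pi> i < k" if "i < k" for i using im that c unfolding \<pi>_def by simp
  have \<pi>c: "\<pi> i = c \<longleftrightarrow> i = c" if "i < k" for i using im that unfolding \<pi>_def by simp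
  have \<psi>k: "\<psi> e < k" if "e \<in> B" for e using B(2) that by blast
  have bf: "bicycle_free B (\<pi> \<circ> \<psi>)" using bicycle_free_inj_recolor[OF B(1) inj B(2)] .
  have w: "\<phi> e \<noteq> (\<pi> \<circ> \<psi>) f" if ef: "e \<in> A" "f \<in> B" "w \<in> e" "w \<in> f" for e f
  proof
    assume eq: "\<phi> e = (\<pi> \<circ> \<psi>) f"
    have e: "\<phi> e \<in> Q" and f: "\<psi> f \<in> P" using ef unfolding P_def Q_def by blast+
    show False
    proof (cases "\<psi> f = c")
      case True
      then have "\<phi> e = c" using eq by (simp add: \<pi>_def)
      then show False using cw e f True unfolding P_def Q_def by metis
    next
      case False
      then have "\<phi> e = \<rho> (\<psi> f)" "\<phi> e \<noteq> c" using eq im(2)[OF \<psi>k[OF ef(2)]] by (auto simp: \<pi>_def)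
      then show False using \<rho>(2) e f False by blast
    qed
  qed
  have cz': "(\<pi> \<circ> \<psi>) e \<noteq> c" if "e \<in> B" "z \<in> e" for e
    using cz[OF that] \<pi>c[OF \<psi>k[OF that(1)]] by simp
  have "bicycle_free (insert {u, z} (A \<union> B)) ((\<lambda>e. if e \<in> A then \<phi> e else (\<pi> \<circ> \<psi>) e)({u, z} := c))"
    by (rule bicycle_free_close[OF E sep ne A(1) bf w cu cz' links])
  moreover have "((\<lambda>e. if e \<in> A then \<phi> e else (\<pi> \<circ> \<psi>) e)({u, z} := c)) ` (insert {u, z} (A \<union> B)) \<subseteq> {..<k}"
  proof -
    have "\<pi> (\<psi> e) < k" if "e \<in> B" for e using \<pi>k[OF \<psi>k[OF that]] .
    moreover have "\<phi> e < k" if "e \<in> A" for e using A(2) that by blast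
    ultimately show ?thesis using c by auto
  qed
  ultimately show ?thesis unfolding colorable_def by blast
qed

section \<open>Separable graphs and contraction\<close>

text \<open>The parts are edge sets, \<open>A\<close> on the side of \<open>u\<close> and
  \<open>B\<close> on that of \<open>z\<close>. The inclusion in \<open>{w}\<close> also covers the
  case that deleting the edge disconnects \<open>u\<close> from \<open>z\<close>; then
  \<open>w\<close> is a dummy.\<close>

definition edge_separation :: "'a set set \<Rightarrow> 'a \<Rightarrow> 'a \<Rightarrow> 'a \<Rightarrow> 'a set set \<Rightarrow> 'a set set \<Rightarrow> bool" where
  "edge_separation E u z w A B \<longleftrightarrow>
     A \<union> B = E - {{u, z}} \<and> \<Union>A \<inter> \<Union>B \<subseteq> {w} \<and> u \<notin> \<Union>B \<and> z \<notin> \<Union>A"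

definition edge_separable :: "'a set set \<Rightarrow> bool" where
  "edge_separable E \<longleftrightarrow> (\<forall>u z. {u, z} \<in> E \<longrightarrow> (\<exists>w A B. edge_separation E u z w A B))"

text \<open>Excludes cut vertices and, through disjoint parts, disconnection. A violation hands over
  the two parts to be glued.\<close>

definition biconnected_edges :: "'a set set \<Rightarrow> bool" where
  "biconnected_edges E \<longleftrightarrow> (\<forall>X Y w. X \<union> Y = E \<longrightarrow> \<Union>X \<inter> \<Union>Y \<subseteq> {w} \<longrightarrow> X = {} \<or> Y = {})"

lemma edge_separation_sym: "edge_separation E u z w A B \<Longrightarrow> edge_separation E z u w B A"
  unfolding edge_separation_def by (simp add: insert_commute Un_commute Int_commute)

lemma edge_separable_subset:
  assumes "edge_separable E" "F \<subseteq> E"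
  shows "edge_separable F"
  unfolding edge_separable_def
proof (intro allI impI)
  fix u z assume uz: "{u, z} \<in> F"
  then obtain w A B where "edge_separation E u z w A B"
    using assms unfolding edge_separable_def by blast
  then have s: "A \<union> B = E - {{u, z}}" "\<Union>A \<inter> \<Union>B \<subseteq> {w}" "u \<notin> \<Union>B" "z \<notin> \<Union>A"
    unfolding edge_separation_def by blast+
  have "(A \<inter> F) \<union> (B \<inter> F) = (A \<union> B) \<inter> F" by blast
  also have "\<dots> = F - {{u, z}}" unfolding s(1) using assms(2) by blast
  finally have un: "(A \<inter> F) \<union> (B \<inter> F) = F - {{u, z}}" .
  have "\<Union>(A \<inter> F) \<inter> \<Union>(B \<inter> F) \<subseteq> {w}" "u \<notin> \<Union>(B \<inter> F)" "z \<notin> \<Union>(A \<inter> F)" using s(2-4) by blast+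
  with un have "edge_separation F u z w (A \<inter> F) (B \<inter> F)" unfolding edge_separation_def by (intro conjI)
  then show "\<exists>w A B. edge_separation F u z w A B" by blast
qed

text \<open>The connected part \<open>M\<close> is replaced by the path \<open>z\<close>, \<open>u\<close>, \<open>t\<close>.\<close>

lemma edge_separable_contract:
  assumes simple: "simple_edges E" and sep: "edge_separable E"
    and E: "E = B \<union> M" and BM: "\<Union>B \<inter> \<Union>M \<subseteq> {z, t}" and conn: "connected_edges M"
    and zu: "{z, u} \<in> M" "\<And>e. e \<in> M \<Longrightarrow> z \<in> e \<Longrightarrow> e = {z, u}"
    and tf: "f \<in> M" "t \<in> f" "\<And>e. e \<in> M \<Longrightarrow> t \<in> e \<Longrightarrow> e = f"
    and ne: "z \<noteq> t" "u \<noteq> z" "u \<noteq> t"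
  shows "edge_separable (B \<union> {{z, u}, {u, t}})" (is "edge_separable ?E'")
proof -
  have uB: "u \<notin> \<Union>B" using BM zu(1) ne by blast
  have "B \<inter> M = {}"
  proof (rule ccontr)
    assume "B \<inter> M \<noteq> {}"
    then obtain e where e: "e \<in> B" "e \<in> M" by blast
    then have sub: "e \<subseteq> {z, t}" using BM by blast
    obtain p q where "e = {p, q}" "p \<noteq> q" using simple_edges_nonempty[OF simple, of e] e E by blast
    then have "e = {z, t}" using sub by blast
    then have "e = {z, u}" using zu(2) e(2) by blast
    then show False using \<open>e = {z, t}\<close> ne by (simp add: doubleton_eq_iff)
  qed
  \<comment> \<open>Stated for \<open>zu\<close> on the side of \<open>p\<close>; the other case
    follows by exchanging \<open>p\<close> and \<open>q\<close>.\<close>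
  have claim: "\<exists>w A' B'. edge_separation ?E' p q w A' B'"
    if pq: "{p, q} \<in> B" and s: "edge_separation E p q w' A1 B1" and zuA: "{z, u} \<in> A1" for p q w' A1 B1
  proof -
    have un: "A1 \<union> B1 = E - {{p, q}}" and I: "\<Union>A1 \<inter> \<Union>B1 \<subseteq> {w'}" and p: "p \<notin> \<Union>B1" and q: "q \<notin> \<Union>A1"
      using s unfolding edge_separation_def by blast+
    have "A1 \<subseteq> E" using un by blast
    then have disj: "A1 \<inter> B1 = {}" using sep_disjoint[OF _ I] simple_edges_subset[OF simple] by metis
    have pu: "p \<noteq> u" "q \<noteq> u" using pq uB by blast+
    have MA: "M \<subseteq> A1 \<union> B1" using un E pq \<open>B \<inter> M = {}\<close> by blast
    have new: "{z, u} \<notin> B" "{u, t} \<notin> B" using uB by blast+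
    have zA: "z \<in> \<Union>A1" using zuA by blast
    have in1: "e \<in> A1 \<or> e \<in> B1" if "e \<in> B" "e \<noteq> {p, q}" for e
    proof -
      have "e \<in> E - {{p, q}}" using that E by simp
      then show ?thesis unfolding un[symmetric] by simp
    qed
    have "{p, q} \<notin> A1 \<union> B1" unfolding un by simp
    then have "(A1 \<inter> B) \<union> (B1 \<inter> B) = B - {{p, q}}" using in1 by blast
    moreover have "?E' - {{p, q}} = (B - {{p, q}}) \<union> {{z, u}, {u, t}}"
    proof -
      have "{p, q} \<noteq> {z, u}" "{p, q} \<noteq> {u, t}" using new pq by metis+
      then have "{{z, u}, {u, t}} - {{p, q}} = {{z, u}, {u, t}}" by (intro Diff_triv) simp
      then show ?thesis by (simp only: Un_Diff)
    qed
    ultimately have split: "?E' - {{p, q}} = ((A1 \<inter> B) \<union> (B1 \<inter> B)) \<union> {{z, u}, {u, t}}" by simp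
    show ?thesis
    \<comment> \<open>If both end edges of \<open>M\<close> are on one side, the whole path joins
      that side. Otherwise \<open>w'\<close> cuts the connected \<open>M\<close> at a vertex other
      than \<open>z\<close> and \<open>t\<close>, so it is not on \<open>B\<close>, and
      \<open>u\<close> takes over as the separating vertex.\<close>
    proof (cases "f \<in> A1")
      case True
      have tA: "t \<in> \<Union>A1" using True tf(2) by blast
      have "edge_separation ?E' p q w' ((A1 \<inter> B) \<union> {{z, u}, {u, t}}) (B1 \<inter> B)"
        unfolding edge_separation_def
      proof (intro conjI)
        show "(A1 \<inter> B) \<union> {{z, u}, {u, t}} \<union> (B1 \<inter> B) = ?E' - {{p, q}}"
          unfolding split by blast
        show "\<Union>((A1 \<inter> B) \<union> {{z, u}, {u, t}}) \<inter> \<Union>(B1 \<inter> B) \<subseteq> {w'}"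
        proof
          fix x assume x: "x \<in> \<Union>((A1 \<inter> B) \<union> {{z, u}, {u, t}}) \<inter> \<Union>(B1 \<inter> B)"
          then have "x \<noteq> u" using uB by blast
          then have "x \<in> \<Union>A1 \<or> x = z \<or> x = t" using x by blast
          then have "x \<in> \<Union>A1" using zA tA by blast
          then show "x \<in> {w'}" using x I by blast
        qed
        show "p \<notin> \<Union>(B1 \<inter> B)" using p by blast
        have "q \<noteq> z" "q \<noteq> t" using q zA tA by blast+
        then show "q \<notin> \<Union>((A1 \<inter> B) \<union> {{z, u}, {u, t}})" using q pu by blast
      qed
      then show ?thesis by blast
    next
      case False
      then have fB: "f \<in> B1" using MA tf(1) by blast
      then have tB: "t \<in> \<Union>B1" using tf(2) by blast
      have "(M \<inter> A1) \<union> (M \<inter> B1) = M" using MA by blast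
      moreover have "M \<inter> A1 \<noteq> {}" "M \<inter> B1 \<noteq> {}" using zu(1) zuA tf(1) fB by blast+
      ultimately have "\<Union>(M \<inter> A1) \<inter> \<Union>(M \<inter> B1) \<noteq> {}"
        using conn unfolding connected_edges_def by blast
      then obtain x where x: "x \<in> \<Union>(M \<inter> A1)" "x \<in> \<Union>(M \<inter> B1)" by blast
      then have xw: "x = w'" using I by blast
      have "x \<noteq> z"
      proof
        assume "x = z"
        then have "{z, u} \<in> B1" using x(2) zu(2) by blast
        then show False using zuA disj by blast
      qed
      moreover have "x \<noteq> t"
      proof
        assume "x = t"
        then have "f \<in> A1" using x(1) tf(3) by blast
        then show False using False by blast
      qed
      ultimately have wB: "w' \<notin> \<Union>B" "w' \<noteq> z" "w' \<noteq> t" using x(1) xw BM by blast+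
      have "edge_separation ?E' p q u (insert {z, u} (A1 \<inter> B)) (insert {u, t} (B1 \<inter> B))"
        unfolding edge_separation_def
      proof (intro conjI)
        show "insert {z, u} (A1 \<inter> B) \<union> insert {u, t} (B1 \<inter> B) = ?E' - {{p, q}}"
          unfolding split by blast
        show "\<Union>(insert {z, u} (A1 \<inter> B)) \<inter> \<Union>(insert {u, t} (B1 \<inter> B)) \<subseteq> {u}"
        proof
          fix y assume y: "y \<in> \<Union>(insert {z, u} (A1 \<inter> B)) \<inter> \<Union>(insert {u, t} (B1 \<inter> B))"
          show "y \<in> {u}"
          proof (rule ccontr)
            assume "y \<notin> {u}"
            then have ya: "y = z \<or> y \<in> \<Union>A1 \<and> y \<in> \<Union>B" and yb: "y = t \<or> y \<in> \<Union>B1" using y by blast+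
            have "y \<in> \<Union>A1" using ya zA by blast
            moreover have "y \<in> \<Union>B1" using yb tB by blast
            ultimately have "y = w'" using I by blast
            then show False using ya wB by blast
          qed
        qed
        have "p \<noteq> t" "q \<noteq> z" using p q tB zA by blast+
        then show "p \<notin> \<Union>(insert {u, t} (B1 \<inter> B))" "q \<notin> \<Union>(insert {z, u} (A1 \<inter> B))"
          using p q pu by blast+
      qed
      then show ?thesis by blast
    qed
  qed
  \<comment> \<open>Each edge of the new path is separated by the outer end of the other one,
    because \<open>u\<close> has no further edges.\<close>
  have 1: "edge_separation ?E' z u t B {{u, t}}"
    unfolding edge_separation_def
  proof (intro conjI)
    show "B \<union> {{u, t}} = ?E' - {{z, u}}" using uB ne by (auto simp: doubleton_eq_iff)
  qed (use uB ne in auto)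
  have 2: "edge_separation ?E' t u z B {{z, u}}"
    unfolding edge_separation_def
  proof (intro conjI)
    show "B \<union> {{z, u}} = ?E' - {{t, u}}" using uB ne by (auto simp: doubleton_eq_iff)
  qed (use uB ne in auto)
  show ?thesis
    unfolding edge_separable_def
  proof (intro allI impI)
    fix p q assume pq: "{p, q} \<in> ?E'"
    then consider "{p, q} \<in> B" | "{p, q} = {z, u}" | "{p, q} = {u, t}" by blast
    then show "\<exists>w A B. edge_separation ?E' p q w A B"
    proof cases
      case pqB: 1
      then obtain w' A1 B1 where s: "edge_separation E p q w' A1 B1"
        using sep E unfolding edge_separable_def by blast
      have "{z, u} \<noteq> {p, q}" using pqB uB by blast
      then have "{z, u} \<in> A1 \<union> B1" using s zu(1) E unfolding edge_separation_def by blast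
      then show ?thesis
      proof
        assume "{z, u} \<in> A1"
        then show ?thesis using claim[OF pqB s] by blast
      next
        assume zuB: "{z, u} \<in> B1"
        have "{q, p} \<in> B" using pqB by (simp add: insert_commute)
        from claim[OF this edge_separation_sym[OF s] zuB] obtain w A' B'
          where "edge_separation ?E' q p w A' B'" by blast
        from edge_separation_sym[OF this] show ?thesis by blast
      qed
    next
      case 2
      then have "p = z \<and> q = u \<or> p = u \<and> q = z" by (simp add: doubleton_eq_iff)
      then show ?thesis using 1 edge_separation_sym[OF 1] by blast
    next
      case 3
      then have "p = u \<and> q = t \<or> p = t \<and> q = u" by (simp add: doubleton_eq_iff)
      then show ?thesis using 2 edge_separation_sym[OF 2] by blast
    qed
  qed
qed

lemma vertex_degree_contract:
  assumes fin: "finite B" "finite M" and BM: "B \<inter> M = {}"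
    and zu: "{z, u} \<in> M" and tf: "f \<in> M" "t \<in> f" and ne: "z \<noteq> t" "u \<noteq> t" and uB: "u \<notin> \<Union>B"
  shows "vertex_degree (B \<union> {{z, u}, {u, t}}) v \<le> max 2 (vertex_degree (B \<union> M) v)"
proof -
  have Un: "vertex_degree (B \<union> M) v = vertex_degree B v + vertex_degree M v"
    using vertex_degree_Un[OF fin BM] .
  show ?thesis
  proof (cases "v = u")
    case True
    then have "vertex_degree (B \<union> {{z, u}, {u, t}}) v = vertex_degree {{z, u}, {u, t}} v"
      using uB by (intro vertex_degree_cong) blast
    also have "\<dots> \<le> card {{z, u}, {u, t}}" unfolding vertex_degree_def by (intro card_mono) auto
    also have "\<dots> \<le> 2" by (simp add: card_insert_if)
    finally show ?thesis by simp
  next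
    case vu: False
    show ?thesis
    proof (cases "v = t")
      case True
      have "vertex_degree (B \<union> {{z, u}, {u, t}}) v = vertex_degree (insert {u, t} B) v"
        using True ne by (intro vertex_degree_cong) auto
      also have "\<dots> = vertex_degree B v + 1"
        using vertex_degree_insert[OF fin(1), of "{u, t}" v] uB True by auto
      also have "\<dots> \<le> vertex_degree (B \<union> M) v"
        using vertex_degree_pos[OF fin(2), of v] tf True Un by fastforce
      finally show ?thesis by simp
    next
      case False
      have "vertex_degree (B \<union> {{z, u}, {u, t}}) v = vertex_degree (insert {z, u} B) v"
        using False vu by (intro vertex_degree_cong) auto
      also have "\<dots> \<le> vertex_degree (B \<union> M) v"
        using fin zu by (intro vertex_degree_mono) auto
      finally show ?thesis by simp
    qed
  qed
qed

lemma bicycle_free_pendant: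
  assumes col: "bicycle_free E col" and v: "v \<in> e" "v \<notin> \<Union>E"
    and p: "\<And>f. f \<in> E \<Longrightarrow> f \<inter> e \<noteq> {} \<Longrightarrow> col f \<noteq> p"
  shows "bicycle_free (insert e E) (col(e := p))"
proof (rule bicycle_free_insert[OF col _ p])
  show "e \<notin> E" using v by blast
  fix F a b assume F: "F \<subseteq> insert e E" "e \<in> F" and deg: "\<And>v. v \<in> \<Union>F \<Longrightarrow> 2 \<le> vertex_degree F v"
  have "2 \<le> vertex_degree F v" using deg F(2) v(1) by blast
  then obtain f where "f \<in> F" "v \<in> f" "f \<noteq> e" using vertex_degree_ge2_other[of F v e] by blast
  then show False using F(1) v(2) by blast
qed

text \<open>To restore the path \<open>a, x, y, b\<close>, the edge \<open>ax\<close> keeps its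
  colour, \<open>yb\<close> takes that of \<open>xb\<close>, and \<open>xy\<close> takes a third
  one. A cycle through \<open>xy\<close> uses all three edges and hence three colours.\<close>

lemma colorable_subdivide:
  assumes simple: "simple_edges E" and k: "3 \<le> k" and E: "E = B \<union> {{a, x}, {x, y}, {y, b}}"
    and xy: "x \<notin> \<Union>B" "y \<notin> \<Union>B" and ne: "a \<noteq> b" "a \<noteq> x" "a \<noteq> y" "b \<noteq> x" "b \<noteq> y" "x \<noteq> y"
    and col: "colorable k (B \<union> {{a, x}, {x, b}})"
  shows "colorable k E"
proof -
  obtain c where c: "bicycle_free (B \<union> {{a, x}, {x, b}}) c" "c ` (B \<union> {{a, x}, {x, b}}) \<subseteq> {..<k}"
    using col unfolding colorable_def by blast
  note cP = bicycle_free_proper[OF c(1)]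
  define p where "p = c {a, x}"
  define q where "q = c {x, b}"
  have pq: "p \<noteq> q" unfolding p_def q_def
  proof
    assume "c {a, x} = c {x, b}"
    then have "{a, x} = {x, b}" by (intro proper_eqD[OF cP, of _ _ x]) auto
    then show False using ne by (auto simp: doubleton_eq_iff)
  qed
  have pk: "p < k" "q < k" using c(2) unfolding p_def q_def by auto
  have "\<not> {..<k} \<subseteq> {p, q}"
  proof
    assume "{..<k} \<subseteq> {p, q}"
    then have "card {..<k} \<le> card {p, q}" by (intro card_mono) auto
    then show False using k pq by simp
  qed
  then obtain r where r: "r < k" "r \<noteq> p" "r \<noteq> q" by blast
  define E1 where "E1 = insert {a, x} B"
  have E1: "E1 \<subseteq> B \<union> {{a, x}, {x, b}}" by (auto simp: E1_def)
  have yE1: "y \<notin> \<Union>E1" using xy ne by (auto simp: E1_def)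
  have c2: "bicycle_free (insert {y, b} E1) (c({y, b} := q))"
  proof (rule bicycle_free_pendant[OF bicycle_free_subset[OF c(1) E1], of y])
    fix f assume f: "f \<in> E1" "f \<inter> {y, b} \<noteq> {}"
    then have bf: "b \<in> f" using yE1 by blast
    have "f \<noteq> {x, b}" using f(1) xy(1) ne by (auto simp: E1_def doubleton_eq_iff)
    moreover have "f \<in> B \<union> {{a, x}, {x, b}}" using f(1) E1 by blast
    ultimately show "c f \<noteq> q" using proper_eqD[OF cP, of f "{x, b}" b] bf unfolding q_def by blast
  qed (use yE1 in auto)
  let ?c = "(c({y, b} := q))({x, y} := r)"
  have nin: "{x, y} \<notin> insert {y, b} E1" using xy(1) ne by (auto simp: E1_def doubleton_eq_iff)
  have yb: "{y, b} \<noteq> {a, x}" "{y, b} \<noteq> {x, y}" "{a, x} \<noteq> {x, y}" using ne by (auto simp: doubleton_eq_iff)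
  have xe: "f = {a, x}" if "f \<in> insert {y, b} E1" "x \<in> f" for f
    using that xy(1) ne unfolding E1_def by blast
  have ye: "f = {y, b}" if "f \<in> insert {y, b} E1" "y \<in> f" for f
    using that yE1 by blast
  have "bicycle_free (insert {x, y} (insert {y, b} E1)) ?c"
  proof (rule bicycle_free_insert[OF c2 nin])
    fix f assume "f \<in> insert {y, b} E1" "f \<inter> {x, y} \<noteq> {}"
    then have "f = {a, x} \<or> f = {y, b}" using xe ye by blast
    then show "(c({y, b} := q)) f \<noteq> r" using r yb unfolding p_def by auto
  next
    fix F a' b' assume F: "F \<subseteq> insert {x, y} (insert {y, b} E1)" "{x, y} \<in> F" "?c ` F \<subseteq> {a', b'}"
      and deg: "\<And>v. v \<in> \<Union>F \<Longrightarrow> 2 \<le> vertex_degree F v"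
    have "2 \<le> vertex_degree F x" "2 \<le> vertex_degree F y" using deg F(2) by blast+
    then obtain f g where f: "f \<in> F" "x \<in> f" "f \<noteq> {x, y}" and g: "g \<in> F" "y \<in> g" "g \<noteq> {x, y}"
      using vertex_degree_ge2_other[of F x "{x, y}"] vertex_degree_ge2_other[of F y "{x, y}"] by metis
    have "f = {a, x}" using xe[of f] f F(1) by blast
    moreover have "g = {y, b}" using ye[of g] g F(1) by blast
    ultimately have "{?c {a, x}, ?c {y, b}, ?c {x, y}} \<subseteq> {a', b'}" using F(2,3) f(1) g(1) by blast
    moreover have "?c {a, x} = p" "?c {y, b} = q" "?c {x, y} = r" using yb by (auto simp: p_def)
    ultimately have "{p, q, r} \<subseteq> {a', b'}" by simp
    then show False using pq r by auto
  qed
  moreover have "insert {x, y} (insert {y, b} E1) = E" unfolding E1_def E by blast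
  moreover have "?c ` E \<subseteq> {..<k}"
  proof
    fix i assume "i \<in> ?c ` E"
    then obtain e where e: "e \<in> E" "i = ?c e" by blast
    show "i \<in> {..<k}"
    proof (cases "e = {x, y} \<or> e = {y, b}")
      case True
      then show ?thesis using e(2) r(1) pk by auto
    next
      case False
      then have "e \<in> B \<union> {{a, x}, {x, b}}" using e(1) E by blast
      then show ?thesis using c(2) False e(2) by auto
    qed
  qed
  ultimately show ?thesis unfolding colorable_def by metis
qed

section \<open>Minimal pieces\<close>

lemma biconnected_edgesD:
  assumes "biconnected_edges E" "X \<union> Y = E" "X \<noteq> {}" "Y \<noteq> {}" "\<And>x. x \<in> \<Union>X \<Longrightarrow> x \<in> \<Union>Y \<Longrightarrow> x = w"
  shows False
proof -
  have "\<Union>X \<inter> \<Union>Y \<subseteq> {w}" using assms(5) by blast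
  then show False using assms(1-4) unfolding biconnected_edges_def by blast
qed

lemma vertex_degree_le2I: "{e \<in> E. v \<in> e} \<subseteq> {p, q} \<Longrightarrow> vertex_degree E v \<le> 2"
proof -
  assume "{e \<in> E. v \<in> e} \<subseteq> {p, q}"
  then have "card {e \<in> E. v \<in> e} \<le> card {p, q}" by (intro card_mono) auto
  also have "\<dots> \<le> 2" by (simp add: card_insert_if)
  finally show ?thesis by (simp add: vertex_degree_def)
qed

lemma biconnected_degree_ge2:
  assumes simple: "simple_edges E" and bi: "biconnected_edges E" and large: "1 < card E" and v: "v \<in> \<Union>E"
  shows "2 \<le> vertex_degree E v"
proof (rule ccontr)
  assume d: "\<not> ?thesis"
  obtain e where e: "e \<in> E" "v \<in> e" using v by blast
  obtain x where x: "e = {v, x}" using simple_edges_other[OF simple e] by blast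
  have only: "f = e" if "f \<in> E" "v \<in> f" for f
    using vertex_degree_lt2_unique[OF simple_edges_finite[OF simple] _ e(1) that(1) e(2) that(2)] d by simp
  have "E - {e} \<noteq> {}"
  proof
    assume "E - {e} = {}"
    then have "card E \<le> card {e}" by (intro card_mono) auto
    then show False using large by simp
  qed
  then show False using biconnected_edgesD[OF bi, of "{e}" "E - {e}" x] e x only by blast
qed

text \<open>The graphs left over in the induction: a cut vertex would allow gluing, adjacent
  vertices of degree 2 a contraction, and up to three edges can simply receive distinct
  colours.\<close>

locale reduced_graph =
  fixes E :: "'a set set"
  assumes simple: "simple_edges E"
    and separable: "edge_separable E"
    and biconnected: "biconnected_edges E"
    and large: "3 < card E"
    and no_adjacent_degree_2: "{x, y} \<in> E \<Longrightarrow> \<not> (vertex_degree E x \<le> 2 \<and> vertex_degree E y \<le> 2)"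
begin

lemma finite_E: "finite E" using simple by (rule simple_edges_finite)

lemma degree_ge2: "v \<in> \<Union>E \<Longrightarrow> 2 \<le> vertex_degree E v"
  using biconnected_degree_ge2[OF simple biconnected] large by simp

text \<open>Two edges are demanded of the side \<open>A\<close> so that minimality is not wasted on
  a trivial side.\<close>

definition piece :: "'a \<Rightarrow> 'a \<Rightarrow> 'a \<Rightarrow> 'a set set \<Rightarrow> 'a set set \<Rightarrow> bool" where
  "piece u z w A B \<longleftrightarrow> {u, z} \<in> E \<and> edge_separation E u z w A B \<and> 2 \<le> card A"

text \<open>Some end \<open>u\<close> of an edge has degree at least 3, and all its edges but
  \<open>uz\<close> lie in \<open>A\<close>, as \<open>u\<close> is not on \<open>B\<close>.\<close>

lemma piece_exists: "\<exists>u z w A B. piece u z w A B"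
proof -
  have "E \<noteq> {}" using large by auto
  then obtain e where "e \<in> E" by blast
  then obtain a b where ab: "{a, b} \<in> E" using simple_edges_nonempty[OF simple] by metis
  then obtain u z where uz: "{u, z} \<in> E" "2 < vertex_degree E u"
    using no_adjacent_degree_2[OF ab] by (metis insert_commute not_le)
  then obtain w A B where s: "edge_separation E u z w A B"
    using separable unfolding edge_separable_def by blast
  then have un: "A \<union> B = E - {{u, z}}" and u: "u \<notin> \<Union>B" unfolding edge_separation_def by blast+
  have AE: "A \<subseteq> E" using un by blast
  have finA: "finite A" using AE finite_E finite_subset by blast
  have "{e \<in> E. u \<in> e} \<subseteq> insert {u, z} A"
  proof
    fix e assume e: "e \<in> {e \<in> E. u \<in> e}"
    then have "e = {u, z} \<or> e \<in> A \<union> B" unfolding un by blast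
    then show "e \<in> insert {u, z} A" using e u by blast
  qed
  then have "vertex_degree E u \<le> card (insert {u, z} A)"
    unfolding vertex_degree_def using finA by (intro card_mono) auto
  also have "\<dots> \<le> card A + 1" using finA by (simp add: card_insert_if)
  finally have "2 \<le> card A" using uz(2) by simp
  then show ?thesis using uz(1) s unfolding piece_def by blast
qed

end

locale minimal_piece = reduced_graph +
  fixes u z w :: 'a and A B :: "'a set set"
  assumes piece: "piece u z w A B"
    and minimal: "piece u' z' w' A' B' \<Longrightarrow> card A \<le> card A'"
begin

text \<open>The complement of \<open>A\<close> in \<open>E\<close>. It can meet \<open>A\<close>
  only in \<open>u\<close> and \<open>w\<close> (\<open>outer_A\<close>); arguments about
  \<open>A\<close> rest on this together with the biconnectivity of \<open>E\<close>.\<close>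

definition outer :: "'a set set" where
  "outer = insert {u, z} B"

lemma uzE: "{u, z} \<in> E" and un: "A \<union> B = E - {{u, z}}" and sep: "\<Union>A \<inter> \<Union>B \<subseteq> {w}"
  and uB: "u \<notin> \<Union>B" and zA: "z \<notin> \<Union>A" and cardA: "2 \<le> card A"
  using piece unfolding piece_def edge_separation_def by blast+

lemma uz: "u \<noteq> z" using simple_edge_doubleton[OF simple uzE] .

lemma AE: "A \<subseteq> E" and BE: "B \<subseteq> E" and uzAB: "{u, z} \<notin> A" "{u, z} \<notin> B"
  using un by blast+

lemma finA: "finite A" and finB: "finite B" using AE BE finite_E finite_subset by blast+

lemma simpleA: "simple_edges A" and simpleB: "simple_edges B"
  using simple_edges_subset[OF simple] AE BE by blast+

lemma disj: "A \<inter> B = {}" using sep_disjoint[OF simpleA sep] .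

lemma E_eq: "E = insert {u, z} (A \<union> B)" unfolding un using uzE by blast

lemma outer_E: "A \<union> outer = E" "outer \<subseteq> E" "outer \<noteq> {}" "A \<inter> outer = {}"
  using uzAB disj unfolding outer_def E_eq by blast+

lemma outer_A: "x \<in> \<Union>A \<Longrightarrow> x \<in> \<Union>outer \<Longrightarrow> x = u \<or> x = w"
  using sep zA unfolding outer_def by blast

lemma edge_cases: "e \<in> E \<Longrightarrow> e = {u, z} \<or> e \<in> A \<or> e \<in> B"
  using E_eq by blast

lemma degree_u: "vertex_degree E u = vertex_degree A u + 1"
proof -
  have "vertex_degree E u = vertex_degree (insert {u, z} A) u"
    using edge_cases uB uzE AE by (intro vertex_degree_cong) blast
  then show ?thesis using vertex_degree_insert[OF finA uzAB(1), of u] by simp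
qed

lemma degree_z: "vertex_degree E z = vertex_degree B z + 1"
proof -
  have "vertex_degree E z = vertex_degree (insert {u, z} B) z"
    using edge_cases zA uzE BE by (intro vertex_degree_cong) blast
  then show ?thesis using vertex_degree_insert[OF finB uzAB(2), of z] by simp
qed

lemma degree_A: "v \<in> \<Union>A \<Longrightarrow> v \<noteq> u \<Longrightarrow> v \<noteq> w \<Longrightarrow> vertex_degree A v = vertex_degree E v"
  using edge_cases zA sep AE by (intro vertex_degree_cong) blast

lemma uA: "u \<in> \<Union>A"
proof -
  have "2 \<le> vertex_degree E u" using degree_ge2 uzE by blast
  then have "0 < vertex_degree A u" using degree_u by simp
  then show ?thesis using vertex_degree_pos[OF finA] by blast
qed

text \<open>If \<open>w\<close> were missing from one side, \<open>u\<close> would be the only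
  contact between \<open>A\<close> and the rest, a cut vertex.\<close>

lemma wAB: "w \<in> \<Union>A" "w \<in> \<Union>B"
proof -
  have "w \<in> \<Union>A \<inter> \<Union>B"
  proof (rule ccontr)
    assume "w \<notin> \<Union>A \<inter> \<Union>B"
    then have "\<And>x. x \<in> \<Union>A \<Longrightarrow> x \<in> \<Union>outer \<Longrightarrow> x = u" using sep zA unfolding outer_def by blast
    then show False using biconnected_edgesD[OF biconnected outer_E(1) _ outer_E(3)] uA by blast
  qed
  then show "w \<in> \<Union>A" "w \<in> \<Union>B" by blast+
qed

lemma wu: "w \<noteq> u" and wz: "w \<noteq> z" using wAB uB zA by blast+

lemma degree_w: "vertex_degree E w = vertex_degree A w + vertex_degree B w"
proof -
  have "vertex_degree E w = vertex_degree (A \<union> B) w"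
    using edge_cases wu wz AE BE by (intro vertex_degree_cong) blast
  then show ?thesis using vertex_degree_Un[OF finA finB disj, of w] by simp
qed

lemma degree_Bw_pos: "0 < vertex_degree B w"
  using vertex_degree_pos[OF finB] wAB(2) by blast

lemma card_Diff_A: "e \<in> A \<Longrightarrow> card (A - {e}) + 1 = card A"
  using card_Suc_Diff1[OF finA] by simp

lemma smaller_piece:
  assumes "{u', z'} \<in> E" "edge_separation E u' z' w' A' B'" "card A' < card A"
  shows "card A' < 2"
proof (rule ccontr)
  assume "\<not> ?thesis"
  then have "piece u' z' w' A' B'" using assms unfolding piece_def by simp
  then show False using minimal assms(3) by fastforce
qed

lemma card_A_2:
  assumes "e \<in> A" "card (A - {e}) < 2"
  obtains e' where "A = {e, e'}" "e \<noteq> e'"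
proof -
  have "card (A - {e}) = 1" using assms card_Diff_A[of e] cardA by simp
  then obtain e' where "A - {e} = {e'}" by (meson card_1_singletonE)
  then show ?thesis using that[of e'] assms(1) by blast
qed

text \<open>If \<open>wt\<close> were the only edge of \<open>A\<close> at \<open>w\<close>, moving
  the separating vertex to \<open>t\<close> would give a smaller piece. The exceptions are
  \<open>t = u\<close>, a cut vertex, and \<open>A\<close> being a path \<open>u, t, w\<close>,
  where \<open>u\<close> and \<open>t\<close> are adjacent of degree 2.\<close>

lemma degree_Aw: "2 \<le> vertex_degree A w"
proof (rule ccontr)
  assume d: "\<not> ?thesis"
  obtain e where e: "e \<in> A" "w \<in> e" using wAB by blast
  obtain t where t: "e = {w, t}" "t \<noteq> w" using simple_edges_other[OF simpleA e] by blast
  have only: "f = e" if "f \<in> A" "w \<in> f" for f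
    using vertex_degree_lt2_unique[OF finA _ e(1) that(1) e(2) that(2)] d by simp
  then have wA': "w \<notin> \<Union>(A - {e})" by blast
  show False
  proof (cases "t = u")
    case True
    have "card (A - {e}) > 0" using cardA card_Diff_A[OF e(1)] by simp
    then have ne: "A - {e} \<noteq> {}" by (metis card.empty less_irrefl)
    have "(A - {e}) \<union> insert e outer = E" using outer_E(1) e(1) by blast
    moreover have "x = u" if x: "x \<in> \<Union>(A - {e})" "x \<in> \<Union>(insert e outer)" for x
    proof -
      have "x \<noteq> w" using wA' x(1) by blast
      moreover have "x \<in> e \<or> x = u \<or> x = w" using x outer_A[of x] by blast
      ultimately show ?thesis using t True by blast
    qed
    ultimately show False using biconnected_edgesD[OF biconnected _ ne] by blast
  next
    case False
    have tA: "t \<in> \<Union>A" using e t by blast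
    have tB: "t \<notin> \<Union>B" using tA sep t(2) by blast
    have tz: "t \<noteq> z" using tA zA by blast
    have "edge_separation E u z t (A - {e}) (insert e B)"
      unfolding edge_separation_def
    proof (intro conjI)
      show "(A - {e}) \<union> insert e B = E - {{u, z}}" unfolding un[symmetric] using e(1) by blast
      show "\<Union>(A - {e}) \<inter> \<Union>(insert e B) \<subseteq> {t}"
      proof
        fix x assume x: "x \<in> \<Union>(A - {e}) \<inter> \<Union>(insert e B)"
        then have "x \<noteq> w" using wA' by blast
        moreover have "x \<in> \<Union>A" using x by blast
        moreover have "x \<in> e \<or> x \<in> \<Union>B" using x by blast
        ultimately show "x \<in> {t}" using t sep by blast
      qed
      show "u \<notin> \<Union>(insert e B)" using uB t wu False by blast
      show "z \<notin> \<Union>(A - {e})" using zA by blast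
    qed
    then have "card (A - {e}) < 2" using smaller_piece[OF uzE] card_Diff_A[OF e(1)] by simp
    then obtain e' where e': "A = {e, e'}" "e \<noteq> e'" using card_A_2[OF e(1)] by metis
    have ue': "u \<in> e'" using uA e'(1) t wu False by blast
    have "2 \<le> vertex_degree E t" using degree_ge2 tA AE by blast
    then obtain f where f: "f \<in> E" "t \<in> f" "f \<noteq> e" using vertex_degree_ge2_other[of E t e] by blast
    have "f \<noteq> {u, z}" using f(2) False tz by blast
    then have "f = e'" using edge_cases[OF f(1)] f tB e'(1) by blast
    then have e'_eq: "e' = {u, t}"
      using ue' f(2) False simple_edges_other[OF simpleA, of e' u] e'(1) by blast
    have "{g \<in> E. t \<in> g} \<subseteq> {e, e'}"
    proof
      fix g assume g: "g \<in> {g \<in> E. t \<in> g}"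
      have "g \<noteq> {u, z}" using g False tz by blast
      then show "g \<in> {e, e'}" using edge_cases[of g] g tB e'(1) by blast
    qed
    moreover have "{g \<in> E. u \<in> g} \<subseteq> {{u, z}, e'}"
    proof
      fix g assume g: "g \<in> {g \<in> E. u \<in> g}"
      have "g \<noteq> e" using g t False wu by blast
      then show "g \<in> {{u, z}, e'}" using edge_cases[of g] g uB e'(1) by blast
    qed
    ultimately have "vertex_degree E u \<le> 2 \<and> vertex_degree E t \<le> 2"
      by (intro conjI vertex_degree_le2I)
    moreover have "{u, t} \<in> E" using e'_eq e'(1) AE by blast
    ultimately show False using no_adjacent_degree_2 by blast
  qed
qed

text \<open>If \<open>us\<close> were the only edge of \<open>A\<close> at \<open>u\<close>, it
  could replace \<open>uz\<close> as the separated edge, with \<open>s\<close> in the role of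
  \<open>u\<close> and a smaller side. The exceptions are \<open>s = w\<close>, a cut vertex, and a
  side of two edges, where \<open>u\<close> and \<open>s\<close> are adjacent of degree 2.\<close>

lemma degree_u3: "3 \<le> vertex_degree E u"
proof (rule ccontr)
  assume "\<not> ?thesis"
  then have d: "vertex_degree A u < 2" using degree_u by simp
  obtain e where e: "e \<in> A" "u \<in> e" using uA by blast
  obtain s where s: "e = {u, s}" "s \<noteq> u" using simple_edges_other[OF simpleA e] by blast
  have only: "f = e" if "f \<in> A" "u \<in> f" for f
    using vertex_degree_lt2_unique[OF finA _ e(1) that(1) e(2) that(2)] d by simp
  then have uA': "u \<notin> \<Union>(A - {e})" by blast
  have sA: "s \<in> \<Union>A" using e s by blast
  then have sz: "s \<noteq> z" using zA by blast
  show False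
  proof (cases "s = w")
    case True
    have "card (A - {e}) > 0" using cardA card_Diff_A[OF e(1)] by simp
    then have ne: "A - {e} \<noteq> {}" by (metis card.empty less_irrefl)
    have "(A - {e}) \<union> insert e outer = E" using outer_E(1) e(1) by blast
    moreover have "x = w" if x: "x \<in> \<Union>(A - {e})" "x \<in> \<Union>(insert e outer)" for x
    proof -
      have "x \<noteq> u" using uA' x(1) by blast
      moreover have "x \<in> e \<or> x = u \<or> x = w" using x outer_A[of x] by blast
      ultimately show ?thesis using s True by blast
    qed
    ultimately show False using biconnected_edgesD[OF biconnected _ ne] by blast
  next
    case False
    have sB: "s \<notin> \<Union>B" using sA sep False by blast
    have suE: "{s, u} \<in> E" using e(1) s(1) AE by (metis insert_commute subsetD)
    have "edge_separation E s u w (A - {e}) outer"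
      unfolding edge_separation_def
    proof (intro conjI)
      have "e = {s, u}" using s(1) by blast
      moreover have "e \<notin> outer" using e(1) outer_E(4) by blast
      ultimately show "(A - {e}) \<union> outer = E - {{s, u}}" unfolding outer_E(1)[symmetric] by blast
      show "\<Union>(A - {e}) \<inter> \<Union>outer \<subseteq> {w}" using outer_A uA' by blast
      show "s \<notin> \<Union>outer" using sB s(2) sz unfolding outer_def by blast
      show "u \<notin> \<Union>(A - {e})" using uA' .
    qed
    then have "card (A - {e}) < 2" using smaller_piece[OF suE] card_Diff_A[OF e(1)] by simp
    then obtain e' where e': "A = {e, e'}" "e \<noteq> e'" using card_A_2[OF e(1)] by metis
    have "{g \<in> E. s \<in> g} \<subseteq> {e, e'}"
    proof
      fix g assume g: "g \<in> {g \<in> E. s \<in> g}"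
      have "g \<noteq> {u, z}" using g s(2) sz by blast
      then show "g \<in> {e, e'}" using edge_cases[of g] g sB e'(1) by blast
    qed
    then have "vertex_degree E s \<le> 2" by (rule vertex_degree_le2I)
    moreover have "vertex_degree E u \<le> 2" using d degree_u by simp
    ultimately show False using no_adjacent_degree_2[OF suE] by blast
  qed
qed

text \<open>A component of \<open>A\<close> contains both \<open>u\<close> and \<open>w\<close>, or
  it would hang on the rest of \<open>E\<close> by one vertex; so there cannot be two of
  them.\<close>

lemma connected_A: "connected_edges A"
  unfolding connected_edges_def
proof (intro allI impI)
  have both: "u \<in> \<Union>X \<and> w \<in> \<Union>X" if XY: "X \<union> Y = A" "\<Union>X \<inter> \<Union>Y = {}" "X \<noteq> {}" for X Y
  proof (rule ccontr)
    assume no: "\<not> (u \<in> \<Union>X \<and> w \<in> \<Union>X)"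
    have "X \<union> (Y \<union> outer) = E" using XY(1) outer_E(1) by blast
    moreover have "x = (if u \<in> \<Union>X then u else w)" if x: "x \<in> \<Union>X" "x \<in> \<Union>(Y \<union> outer)" for x
    proof -
      have "x \<in> \<Union>outer" using x XY(2) by blast
      moreover have "x \<in> \<Union>A" using x(1) XY(1) by blast
      ultimately have "x = u \<or> x = w" using outer_A by blast
      then show ?thesis using no x(1) by auto
    qed
    ultimately show False
      using biconnected_edgesD[OF biconnected, of X "Y \<union> outer" "if u \<in> \<Union>X then u else w"] XY(3) outer_E(3)
      by blast
  qed
  fix X Y assume XY: "X \<union> Y = A" "\<Union>X \<inter> \<Union>Y = {}"
  have YX: "Y \<union> X = A" "\<Union>Y \<inter> \<Union>X = {}" using XY by blast+
  show "X = {} \<or> Y = {}" using both[OF XY] both[OF YX] XY(2) by blast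
qed

lemma degree_A2:
  assumes "t \<in> \<Union>A" "3 \<le> vertex_degree E t"
  shows "2 \<le> vertex_degree A t"
proof (cases "t = w")
  case True then show ?thesis using degree_Aw by simp
next
  case False
  then show ?thesis using assms degree_u degree_A[of t] by (cases "t = u") auto
qed

section \<open>No edge of a minimal piece joins two vertices of degree at least 3\<close>

lemma split_meets_outer:
  assumes st: "{s, t} \<in> A" and t3: "3 \<le> vertex_degree E t" and S: "edge_separation E s t w' S T"
  shows "\<not> outer \<subseteq> S"
proof
  assume O: "outer \<subseteq> S"
  have un': "S \<union> T = E - {{s, t}}" and I: "\<Union>S \<inter> \<Union>T \<subseteq> {w'}" and sT: "s \<notin> \<Union>T" and tS: "t \<notin> \<Union>S"
    using S unfolding edge_separation_def by blast+
  have TE: "T \<subseteq> E" "S \<subseteq> E" "{s, t} \<notin> T" using un' by blast+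
  have "S \<inter> T = {}" using sep_disjoint[OF simple_edges_subset[OF simple TE(2)] I] .
  then have TA: "T \<subseteq> A - {{s, t}}" using TE O outer_E(1) by blast
  have finT: "finite T" using TE(1) finite_E finite_subset by blast
  have "{e \<in> E. t \<in> e} \<subseteq> insert {s, t} {e \<in> T. t \<in> e}"
  proof
    fix e assume e: "e \<in> {e \<in> E. t \<in> e}"
    then have "e = {s, t} \<or> e \<in> S \<union> T" unfolding un' by blast
    then show "e \<in> insert {s, t} {e \<in> T. t \<in> e}" using e tS by blast
  qed
  then have "vertex_degree E t \<le> card (insert {s, t} {e \<in> T. t \<in> e})"
    unfolding vertex_degree_def using finT by (intro card_mono) auto
  also have "\<dots> \<le> card (insert {s, t} T)" using finT by (intro card_mono) auto
  also have "\<dots> \<le> card T + 1" using finT by (simp add: card_insert_if)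
  \<comment> \<open>So \<open>T\<close>, lying inside \<open>A\<close> without \<open>st\<close>,
    would be a smaller side, now for the edge \<open>ts\<close>.\<close>
  finally have "2 \<le> card T" using t3 by simp
  moreover have "{t, s} \<in> E" using st AE by (metis insert_commute subsetD)
  ultimately have "card A \<le> card T" using minimal edge_separation_sym[OF S] unfolding piece_def by blast
  moreover have "card T < card A" using TA st finA by (intro psubset_card_mono) auto
  ultimately show False by simp
qed

text \<open>Both \<open>S\<close> and \<open>T\<close> take a part of \<open>outer\<close>. Were
  \<open>w'\<close> on \<open>A\<close>, each of these parts could touch the rest of
  \<open>E\<close> only in \<open>u\<close> or \<open>w\<close>, and by biconnectivity in both; then
  \<open>S\<close> and \<open>T\<close> would share two vertices.\<close>

lemma split_outer_not_in_A:
  assumes st: "{s, t} \<in> A" and s3: "3 \<le> vertex_degree E s" and t3: "3 \<le> vertex_degree E t"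
    and S: "edge_separation E s t w' S T"
  shows "w' \<notin> \<Union>A"
proof
  assume wA: "w' \<in> \<Union>A"
  have un': "S \<union> T = E - {{s, t}}" and I: "\<Union>S \<inter> \<Union>T \<subseteq> {w'}"
    using S unfolding edge_separation_def by blast+
  define OS where "OS = outer \<inter> S"
  define OT where "OT = outer \<inter> T"
  have "{t, s} \<in> A" using st by (simp add: insert_commute)
  then have nS: "\<not> outer \<subseteq> S" and nT: "\<not> outer \<subseteq> T"
    using split_meets_outer[OF st t3 S] split_meets_outer[OF _ s3 edge_separation_sym[OF S]] by blast+
  have cover: "outer \<subseteq> S \<union> T" unfolding un' using outer_E(2,4) st by blast
  have O: "OS \<union> OT = outer" "OS \<noteq> {}" "OT \<noteq> {}" using nS nT cover unfolding OS_def OT_def by blast+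
  have share: "x = w'" if "x \<in> \<Union>OS" "x \<in> \<Union>OT" for x using that I unfolding OS_def OT_def by blast
  have both: "u \<in> \<Union>P \<and> w \<in> \<Union>P"
    if P: "P \<union> Q = outer" "P \<noteq> {}" and sh: "\<And>x. x \<in> \<Union>P \<Longrightarrow> x \<in> \<Union>Q \<Longrightarrow> x = w'" for P Q
  proof (rule ccontr)
    assume no: "\<not> (u \<in> \<Union>P \<and> w \<in> \<Union>P)"
    have "P \<union> (A \<union> Q) = E" using P(1) outer_E(1) by blast
    moreover have "x = (if u \<in> \<Union>P then u else w)" if x: "x \<in> \<Union>P" "x \<in> \<Union>(A \<union> Q)" for x
    proof -
      have "x \<in> \<Union>A" using x sh[of x] wA by blast
      moreover have "x \<in> \<Union>outer" using x(1) P(1) by blast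
      ultimately have "x = u \<or> x = w" using outer_A by blast
      then show ?thesis using no x(1) by auto
    qed
    ultimately show False
      using biconnected_edgesD[OF biconnected, of P "A \<union> Q" "if u \<in> \<Union>P then u else w"] P(2) st by blast
  qed
  have OT': "OT \<union> OS = outer" using O(1) by blast
  have "u \<in> \<Union>OS \<and> w \<in> \<Union>OS" using both[OF O(1,2) share] .
  moreover have "u \<in> \<Union>OT \<and> w \<in> \<Union>OT" using both[OF OT' O(3)] share by blast
  ultimately show False using share wu by metis
qed

text \<open>Without another contact at \<open>u\<close> or \<open>w\<close>, the edges of
  \<open>A\<close> in \<open>T\<close> would hang on the rest of \<open>E\<close> by
  \<open>t\<close> alone.\<close>

lemma split_inner_end:
  assumes st: "{s, t} \<in> A" and t3: "3 \<le> vertex_degree E t" and S: "edge_separation E s t w' S T"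
    and w'A: "w' \<notin> \<Union>A"
  shows "\<exists>x\<in>{u, w}. x \<in> \<Union>(A \<inter> T) \<and> x \<noteq> t"
proof (rule ccontr)
  assume no: "\<not> ?thesis"
  have un': "S \<union> T = E - {{s, t}}" and I: "\<Union>S \<inter> \<Union>T \<subseteq> {w'}" and sT: "s \<notin> \<Union>T" and tS: "t \<notin> \<Union>S"
    using S unfolding edge_separation_def by blast+
  have tA: "t \<in> \<Union>A" using st by blast
  obtain g where g: "g \<in> A" "t \<in> g" "g \<noteq> {s, t}"
    using vertex_degree_ge2_other[OF degree_A2[OF tA t3]] by blast
  have "g \<in> S \<union> T" unfolding un' using g AE by blast
  then have ne: "A \<inter> T \<noteq> {}" using g tS by blast
  have "(A \<inter> T) \<union> (insert {s, t} ((A \<inter> S) \<union> outer)) = E"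
  proof
    show "E \<subseteq> (A \<inter> T) \<union> (insert {s, t} ((A \<inter> S) \<union> outer))"
    proof
      fix e assume e: "e \<in> E"
      then have "e \<in> A \<or> e \<in> outer" using outer_E(1) by blast
      moreover have "e = {s, t} \<or> e \<in> S \<union> T" unfolding un' using e by blast
      ultimately show "e \<in> (A \<inter> T) \<union> (insert {s, t} ((A \<inter> S) \<union> outer))" by blast
    qed
    show "(A \<inter> T) \<union> (insert {s, t} ((A \<inter> S) \<union> outer)) \<subseteq> E" using AE outer_E(2) st by blast
  qed
  moreover have "x = t" if x: "x \<in> \<Union>(A \<inter> T)" "x \<in> \<Union>(insert {s, t} ((A \<inter> S) \<union> outer))" for x
  proof -
    have "x \<in> \<Union>A" "x \<noteq> s" using x(1) sT by blast+
    moreover have "x \<notin> \<Union>(A \<inter> S)" using x(1) I w'A by blast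
    ultimately have "x = t \<or> x \<in> \<Union>outer" using x(2) by blast
    then show ?thesis using outer_A[OF \<open>x \<in> \<Union>A\<close>] no x(1) by blast
  qed
  ultimately show False using biconnected_edgesD[OF biconnected _ ne] by blast
qed

text \<open>In this position the part of \<open>A\<close> in \<open>T\<close> is a smaller side for
  the edge \<open>ts\<close>, again with \<open>w\<close> as separating vertex; the degree of
  \<open>t\<close> gives it at least two edges.\<close>

lemma split_ends_swapped:
  assumes st: "{s, t} \<in> A" and t3: "3 \<le> vertex_degree E t" and S: "edge_separation E s t w' S T"
    and w'A: "w' \<notin> \<Union>A" and w: "w \<in> \<Union>(A \<inter> T)" "w \<noteq> t" and u: "u \<in> \<Union>(A \<inter> S)"
  shows False
proof -
  have un': "S \<union> T = E - {{s, t}}" and I: "\<Union>S \<inter> \<Union>T \<subseteq> {w'}" and sT: "s \<notin> \<Union>T" and tS: "t \<notin> \<Union>S"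
    using S unfolding edge_separation_def by blast+
  have tA: "t \<in> \<Union>A" using st by blast
  have tu: "t \<noteq> u" using u tS by blast
  have inner: "x \<notin> \<Union>(A \<inter> S)" if "x \<in> \<Union>(A \<inter> T)" for x using that I w'A by blast
  have stn: "{s, t} \<notin> S \<union> T" "{s, t} \<notin> outer" unfolding un' using st outer_E(4) by blast+
  have "edge_separation E t s w (A \<inter> T) ((A \<inter> S) \<union> outer)"
    unfolding edge_separation_def
  proof (intro conjI)
    show "(A \<inter> T) \<union> ((A \<inter> S) \<union> outer) = E - {{t, s}}"
    proof
      show "(A \<inter> T) \<union> ((A \<inter> S) \<union> outer) \<subseteq> E - {{t, s}}"
      proof
        fix e assume e: "e \<in> (A \<inter> T) \<union> ((A \<inter> S) \<union> outer)"
        then have "e \<noteq> {s, t}" using stn by blast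
        moreover have "e \<in> E" using e AE outer_E(2) by blast
        ultimately show "e \<in> E - {{t, s}}" by (simp add: insert_commute)
      qed
      show "E - {{t, s}} \<subseteq> (A \<inter> T) \<union> ((A \<inter> S) \<union> outer)"
      proof
        fix e assume e: "e \<in> E - {{t, s}}"
        then have "e \<in> E - {{s, t}}" by (simp add: insert_commute)
        then have "e \<in> S \<union> T" unfolding un' .
        moreover have "e \<in> A \<or> e \<in> outer" using e outer_E(1) by blast
        ultimately show "e \<in> (A \<inter> T) \<union> ((A \<inter> S) \<union> outer)" by blast
      qed
    qed
    show "\<Union>(A \<inter> T) \<inter> \<Union>((A \<inter> S) \<union> outer) \<subseteq> {w}"
    proof
      fix x assume x: "x \<in> \<Union>(A \<inter> T) \<inter> \<Union>((A \<inter> S) \<union> outer)"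
      then have "x \<in> \<Union>A" "x \<in> \<Union>outer" using inner by blast+
      then have "x = u \<or> x = w" by (rule outer_A)
      then show "x \<in> {w}" using inner u x by blast
    qed
    show "t \<notin> \<Union>((A \<inter> S) \<union> outer)" using tS outer_A[OF tA] tu w(2) by blast
    show "s \<notin> \<Union>(A \<inter> T)" using sT by blast
  qed
  moreover have "{t, s} \<in> E" using st AE by (metis insert_commute subsetD)
  moreover have "2 \<le> card (A \<inter> T)"
  proof -
    have "{e \<in> A. t \<in> e} \<subseteq> insert {s, t} (A \<inter> T)"
    proof
      fix e assume e: "e \<in> {e \<in> A. t \<in> e}"
      then have "e = {s, t} \<or> e \<in> S \<union> T" unfolding un' using AE by blast
      then show "e \<in> insert {s, t} (A \<inter> T)" using e tS by blast
    qed
    then have "vertex_degree A t \<le> card (insert {s, t} (A \<inter> T))"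
      unfolding vertex_degree_def using finA by (intro card_mono) auto
    also have "\<dots> \<le> card (A \<inter> T) + 1" using finA by (simp add: card_insert_if)
    finally show ?thesis using t3 degree_A[OF tA tu] w(2) by simp
  qed
  ultimately have "card A \<le> card (A \<inter> T)" using minimal unfolding piece_def by blast
  moreover have "A \<inter> T \<subset> A" using st stn by blast
  then have "card (A \<inter> T) < card A" using finA by (rule psubset_card_mono[rotated])
  ultimately show False by simp
qed

text \<open>The parts of \<open>A\<close> in \<open>S\<close> and in \<open>T\<close> share no
  vertex, so one of them contains \<open>u\<close> and the other \<open>w\<close>; exchanging
  \<open>s\<close> and \<open>t\<close> covers both arrangements.\<close>

lemma sparse:
  assumes st: "{s, t} \<in> A" and s3: "3 \<le> vertex_degree E s" and t3: "3 \<le> vertex_degree E t"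
  shows False
proof -
  obtain w' S T where S: "edge_separation E s t w' S T"
    using separable st AE unfolding edge_separable_def by blast
  note S' = edge_separation_sym[OF S]
  have ts: "{t, s} \<in> A" using st by (simp add: insert_commute)
  have w': "w' \<notin> \<Union>A" by (rule split_outer_not_in_A[OF st s3 t3 S])
  have I: "\<Union>S \<inter> \<Union>T \<subseteq> {w'}" using S unfolding edge_separation_def by blast
  obtain x where x: "x \<in> {u, w}" "x \<in> \<Union>(A \<inter> T)" "x \<noteq> t" using split_inner_end[OF st t3 S w'] by blast
  obtain y where y: "y \<in> {u, w}" "y \<in> \<Union>(A \<inter> S)" "y \<noteq> s" using split_inner_end[OF ts s3 S' w'] by blast
  have "x \<noteq> y" using x y I w' by blast
  then consider "x = w" "y = u" | "x = u" "y = w" using x(1) y(1) by blast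
  then show False
  proof cases
    case 1
    then show False using split_ends_swapped[OF st t3 S w'] x y by blast
  next
    case 2
    then show False using split_ends_swapped[OF ts s3 S' w'] x y by blast
  qed
qed

text \<open>Degrees are taken in \<open>E\<close>: inside \<open>A\<close> the ends \<open>u\<close>
  and \<open>w\<close> may have degree 2, yet they have to count as hubs.\<close>

definition hubs :: "'a set" where
  "hubs = {v \<in> \<Union>A. 3 \<le> vertex_degree E v}"

lemma hub_u: "u \<in> hubs" using uA degree_u3 by (simp add: hubs_def)

lemma hub_w: "w \<in> hubs" using wAB(1) degree_w degree_Aw degree_Bw_pos by (simp add: hubs_def)

lemma hub_edges_A: "hub_edges A hubs"
proof
  show "simple_edges A" by (rule simpleA)
  show "\<exists>h x. e = {h, x} \<and> h \<in> hubs \<and> x \<notin> hubs" if e: "e \<in> A" for e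
  proof -
    obtain p q where pq: "e = {p, q}" using simple_edges_nonempty[OF simpleA e] by blast
    have "p \<in> \<Union>A" "q \<in> \<Union>A" using pq e by blast+
    moreover have "\<not> (vertex_degree E p \<le> 2 \<and> vertex_degree E q \<le> 2)"
      using no_adjacent_degree_2 e pq AE by blast
    ultimately consider "p \<in> hubs" "q \<notin> hubs" | "q \<in> hubs" "p \<notin> hubs"
      using sparse[of p q] e pq unfolding hubs_def by fastforce
    then show ?thesis
    proof cases
      case 1 then show ?thesis using pq by blast
    next
      case 2 then show ?thesis using pq by (metis insert_commute)
    qed
  qed
  show "vertex_degree A x = 2" if x: "x \<in> \<Union>A" "x \<notin> hubs" for x
  proof -
    have "x \<noteq> u" "x \<noteq> w" using x hub_u hub_w by blast+
    then have "vertex_degree A x = vertex_degree E x" using degree_A x(1) by blast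
    moreover have "2 \<le> vertex_degree E x" using degree_ge2 x(1) AE by blast
    moreover have "vertex_degree E x < 3" using x unfolding hubs_def by auto
    ultimately show ?thesis by simp
  qed
qed

end

section \<open>Colouring separable graphs\<close>

text \<open>The contracted graph is smaller, as a path of two edges replaces at least three; its
  degrees are at most 2 or at most the old ones.\<close>

lemma colorable_contract:
  fixes E :: "'a set set"
  assumes k: "3 \<le> k" and simple: "simple_edges E" and sep: "edge_separable E" and deg: "\<And>v. vertex_degree E v \<le> k"
    and IH: "\<And>E' :: 'a set set. simple_edges E' \<Longrightarrow> edge_separable E' \<Longrightarrow> (\<forall>v. vertex_degree E' v \<le> k) \<Longrightarrow>
      card E' < card E \<Longrightarrow> colorable k E'"
    and E: "E = B \<union> M" "B \<inter> M = {}" "\<Union>B \<inter> \<Union>M \<subseteq> {z, t}" and M: "connected_edges M" "2 < card M"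
    and zu: "{z, u} \<in> M" "\<And>e. e \<in> M \<Longrightarrow> z \<in> e \<Longrightarrow> e = {z, u}"
    and tf: "f \<in> M" "t \<in> f" "\<And>e. e \<in> M \<Longrightarrow> t \<in> e \<Longrightarrow> e = f"
    and ne: "z \<noteq> t" "u \<noteq> z" "u \<noteq> t"
  shows "colorable k (B \<union> {{z, u}, {u, t}})" (is "colorable k ?E'")
proof (rule IH)
  have fin: "finite B" "finite M" using simple_edges_finite[OF simple] E(1) by auto
  have uB: "u \<notin> \<Union>B" using E(3) zu(1) ne by blast
  show "edge_separable ?E'" by (rule edge_separable_contract[OF simple sep E(1,3) M(1) zu tf ne])
  show "simple_edges ?E'" using simple ne unfolding E(1) simple_edges_def by auto
  show "\<forall>v. vertex_degree ?E' v \<le> k"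
  proof
    fix v
    have "vertex_degree ?E' v \<le> max 2 (vertex_degree (B \<union> M) v)"
      by (rule vertex_degree_contract[OF fin E(2) zu(1) tf(1,2) ne(1,3) uB])
    then show "vertex_degree ?E' v \<le> k" using deg[of v] k E(1) by simp
  qed
  have "card ?E' \<le> card B + card {{z, u}, {u, t}}" by (rule card_Un_le)
  also have "\<dots> \<le> card B + 2" by (simp add: card_insert_if)
  also have "\<dots> < card E" unfolding E(1) using card_Un_disjoint[OF fin E(2)] M(2) by simp
  finally show "card ?E' < card E" .
qed

context minimal_piece
begin

lemma degree_A_le: "vertex_degree A v \<le> vertex_degree E v"
  using vertex_degree_mono[OF finite_E AE] .

lemma simple_parts: "simple_edges (insert {u, z} (A \<union> B))"
  using simple E_eq by simp

text \<open>\<open>B\<close> leaves \<open>c\<close> free at \<open>w\<close>, so \<open>A\<close>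
  has to use it there. A link in \<open>c\<close> and \<open>d\<close> then finds both colours at
  \<open>w\<close>: if it arrives by a \<open>d\<close>-edge this is immediate, and if it arrives by
  the \<open>c\<close>-edge it is the last property of \<open>coloring_using\<close>.\<close>

lemma colorable_if_missing:
  assumes deg: "\<And>v. vertex_degree E v \<le> k" and \<psi>: "bicycle_free B \<psi>" "\<psi> ` B \<subseteq> {..<k}" and c: "c < k"
    and cz: "\<And>e. e \<in> B \<Longrightarrow> z \<in> e \<Longrightarrow> \<psi> e \<noteq> c" and cw: "\<And>e. e \<in> B \<Longrightarrow> w \<in> e \<Longrightarrow> \<psi> e \<noteq> c"
  shows "colorable k E"
proof -
  interpret hub_edges A hubs by (rule hub_edges_A)
  have hA: "hubs \<subseteq> \<Union>A" by (auto simp: hubs_def)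
  have degA: "vertex_degree A v \<le> k" for v using degree_A_le deg order_trans by blast
  have du: "vertex_degree A u < k" using deg[of u] degree_u by simp
  have dw: "vertex_degree A w < k" using deg[of w] degree_w degree_Bw_pos by simp
  obtain \<phi> where \<phi>: "bicycle_free A \<phi>" "\<phi> ` A \<subseteq> {..<k}"
    and cu: "\<And>e. e \<in> A \<Longrightarrow> u \<in> e \<Longrightarrow> \<phi> e \<noteq> c" and cA: "\<exists>e\<in>A. w \<in> e \<and> \<phi> e = c"
    and l: "\<And>F d e. F \<subseteq> A \<Longrightarrow> \<phi> ` F \<subseteq> {c, d} \<Longrightarrow> links F u w \<Longrightarrow> e \<in> F \<Longrightarrow> w \<in> e \<Longrightarrow> \<phi> e = c \<Longrightarrow>
      \<exists>e'\<in>A. w \<in> e' \<and> \<phi> e' = d"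
    by (rule coloring_using[OF connected_A hA hub_u hub_w wu[symmetric] c du degA degree_Aw dw]) (rule that)
  have links: "{c, d} \<subseteq> \<phi> ` {e \<in> A. w \<in> e}" if F: "F \<subseteq> A" "\<phi> ` F \<subseteq> {c, d}" "links F u w" for F d
  proof -
    have "vertex_degree F w = 1" using F(3) unfolding links_def by blast
    then obtain e where e: "e \<in> F" "w \<in> e" by (rule vertex_degree_1E)
    have "\<exists>e'\<in>A. w \<in> e' \<and> \<phi> e' = d"
    proof (cases "\<phi> e = c")
      case True
      then show ?thesis using l[OF F e] by blast
    next
      case False
      then have "\<phi> e = d" using F(2) e(1) by blast
      then show ?thesis using e F(1) by blast
    qed
    then show ?thesis using cA by blast
  qed
  have star: "c \<in> \<phi> ` {e \<in> A. w \<in> e} \<longleftrightarrow> c \<notin> \<psi> ` {e \<in> B. w \<in> e}" using cA cw by blast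
  have dAB: "vertex_degree A w + vertex_degree B w \<le> k" using degree_w deg[of w] by simp
  have "colorable k (insert {u, z} (A \<union> B))"
    by (rule colorable_close[OF _ sep uB zA wu wz uz c \<phi> \<psi> dAB star cu cz links])
      (rule simple_parts)
  then show ?thesis using E_eq by simp
qed

text \<open>\<open>B\<close> occupies \<open>c\<close> at \<open>w\<close>, so \<open>A\<close>
  avoids it there, and \<open>no_link_avoiding\<close> rules out dangerous links altogether. The
  second edge of \<open>B\<close> at \<open>w\<close> pays for the colour given up in
  \<open>A\<close>.\<close>

lemma colorable_if_present:
  assumes deg: "\<And>v. vertex_degree E v \<le> k" and \<psi>: "bicycle_free B \<psi>" "\<psi> ` B \<subseteq> {..<k}" and c: "c < k"
    and cz: "\<And>e. e \<in> B \<Longrightarrow> z \<in> e \<Longrightarrow> \<psi> e \<noteq> c"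
    and cw: "\<exists>e\<in>B. w \<in> e \<and> \<psi> e = c" and Bw: "2 \<le> vertex_degree B w"
  shows "colorable k E"
proof -
  interpret hub_edges A hubs by (rule hub_edges_A)
  have hA: "hubs \<subseteq> \<Union>A" by (auto simp: hubs_def)
  have degA: "vertex_degree A v \<le> k" for v using degree_A_le deg order_trans by blast
  have du: "vertex_degree A u < k" using deg[of u] degree_u by simp
  have dw: "vertex_degree A w + 1 < k" using deg[of w] degree_w Bw by simp
  obtain \<phi> where \<phi>: "bicycle_free A \<phi>" "\<phi> ` A \<subseteq> {..<k}"
    and cu: "\<And>e. e \<in> A \<Longrightarrow> u \<in> e \<Longrightarrow> \<phi> e \<noteq> c" and cA: "\<And>e. e \<in> A \<Longrightarrow> w \<in> e \<Longrightarrow> \<phi> e \<noteq> c"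
    by (rule coloring_avoiding[OF connected_A hA hub_u hub_w wu[symmetric] c du degA dw]) (rule that)
  have links: "{c, d} \<subseteq> \<phi> ` {e \<in> A. w \<in> e}" if F: "F \<subseteq> A" "\<phi> ` F \<subseteq> {c, d}" "links F u w" for F d
  proof -
    have False by (rule no_link_avoiding[OF bicycle_free_proper[OF \<phi>(1)] F hub_u hub_w cu cA])
    then show ?thesis ..
  qed
  have "c \<notin> \<phi> ` {e \<in> A. w \<in> e}" using cA by auto
  moreover have "c \<in> \<psi> ` {e \<in> B. w \<in> e}" using cw by auto
  ultimately have star: "c \<in> \<phi> ` {e \<in> A. w \<in> e} \<longleftrightarrow> c \<notin> \<psi> ` {e \<in> B. w \<in> e}" by simp
  have dAB: "vertex_degree A w + vertex_degree B w \<le> k" using degree_w deg[of w] by simp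
  have "colorable k (insert {u, z} (A \<union> B))"
    by (rule colorable_close[OF _ sep uB zA wu wz uz c \<phi> \<psi> dAB star cu cz links])
      (rule simple_parts)
  then show ?thesis using E_eq by simp
qed

lemma card_B_less: "card B < card E"
  using BE uzE uzAB finite_E by (intro psubset_card_mono) auto

text \<open>With a single edge \<open>wt\<close> of \<open>B\<close> at \<open>w\<close> there may
  be no room for avoiding \<open>c\<close> in \<open>A\<close>, so \<open>B\<close> must be coloured
  without \<open>c\<close> at \<open>w\<close>. Contracting \<open>A\<close> and its two attached
  edges to the path \<open>z, u, t\<close> achieves this: the colour of \<open>zu\<close>, taken as
  \<open>c\<close>, is absent at \<open>z\<close> in \<open>B\<close>, and \<open>wt\<close>
  inherits the colour of \<open>ut\<close>, which differs from it.\<close>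

lemma colorable_single_end:
  assumes k: "3 \<le> k" and deg: "\<And>v. vertex_degree E v \<le> k"
    and IH: "\<And>E' :: 'a set set. simple_edges E' \<Longrightarrow> edge_separable E' \<Longrightarrow> (\<forall>v. vertex_degree E' v \<le> k) \<Longrightarrow>
      card E' < card E \<Longrightarrow> colorable k E'"
    and Bw: "vertex_degree B w = 1"
  shows "colorable k E"
proof -
  obtain f where f: "f \<in> B" "w \<in> f" and only: "\<And>e. e \<in> B \<Longrightarrow> w \<in> e \<Longrightarrow> e = f"
    using vertex_degree_1E[OF Bw] by blast
  obtain t where t: "f = {w, t}" "t \<noteq> w" using simple_edges_other[OF simpleB f] by blast
  define B0 where "B0 = B - {f}"
  have wB0: "w \<notin> \<Union>B0" using only unfolding B0_def by blast
  have B_eq: "B = insert f B0" using f(1) unfolding B0_def by blast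
  have tB: "t \<in> \<Union>B" using f t by blast
  then have tA: "t \<notin> \<Union>A" using sep t(2) by blast
  have tu: "t \<noteq> u" using tB uB by blast
  define M where "M = insert {u, z} (insert f A)"
  have E_BM: "E = B0 \<union> M" unfolding M_def E_eq B_eq by blast
  have B0A: "x \<notin> \<Union>A" if "x \<in> \<Union>B0" for x using that wB0 sep unfolding B0_def by blast
  show ?thesis
  proof (cases "t = z")
    case True
    \<comment> \<open>Otherwise \<open>z\<close> would be a cut vertex. The single edge
      \<open>wz\<close> is then given colour 1, and \<open>c\<close> is 0.\<close>
    have "B0 = {}"
    proof (rule ccontr)
      assume ne: "B0 \<noteq> {}"
      have "x = z" if x: "x \<in> \<Union>B0" "x \<in> \<Union>M" for x
      proof -
        have "x \<noteq> w" using wB0 x(1) by blast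
        moreover have "x \<noteq> u" using x(1) uB unfolding B0_def by blast
        ultimately show ?thesis using x(2) B0A[OF x(1)] t(1) True unfolding M_def by blast
      qed
      moreover have "M \<noteq> {}" unfolding M_def by blast
      ultimately show False using biconnected_edgesD[OF biconnected E_BM[symmetric] ne] by blast
    qed
    then have B1: "B = {f}" using B_eq by simp
    have bf: "bicycle_free B (\<lambda>_. 1)"
    proof (rule bicycle_freeI)
      show "proper_edge_coloring B (\<lambda>_. 1)" unfolding B1 proper_edge_coloring_def by blast
      fix F a b assume F: "F \<subseteq> B" "F \<noteq> {}" and d: "\<And>v. v \<in> \<Union>F \<Longrightarrow> 2 \<le> vertex_degree F v"
      have "F = {f}" using F B1 by blast
      then have "vertex_degree F w = 1" using f(2) by (intro vertex_degree_eq1[of f]) auto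
      moreover have "w \<in> \<Union>F" using \<open>F = {f}\<close> f(2) by blast
      ultimately show False using d[of w] by simp
    qed
    show ?thesis
      by (rule colorable_if_missing[OF deg bf, of 0]) (use k in auto)
  next
    case False
    define E' where "E' = B0 \<union> {{z, u}, {u, t}}"
    have zu: "{z, u} = {u, z}" by blast
    have fz: "z \<notin> f" using t False wz by blast
    have M_z: "e = {z, u}" if "e \<in> M" "z \<in> e" for e using that fz zA zu unfolding M_def by blast
    have M_t: "e = f" if "e \<in> M" "t \<in> e" for e using that tA tu False unfolding M_def by blast
    \<comment> \<open>Both extra edges touch the connected set \<open>A\<close>, one at
      \<open>u\<close> and one at \<open>w\<close>.\<close>
    have conn: "connected_edges M"
      unfolding connected_edges_def
    proof (intro allI impI)
      have half: "Y = {}" if XY: "X \<union> Y = M" "\<Union>X \<inter> \<Union>Y = {}" "Y \<inter> A = {}" for X Y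
      proof (rule ccontr)
        assume "Y \<noteq> {}"
        have "A \<subseteq> X" using XY(1,3) unfolding M_def by blast
        then have "u \<in> \<Union>X" "w \<in> \<Union>X" using uA wAB(1) by blast+
        moreover obtain e where e: "e \<in> Y" using \<open>Y \<noteq> {}\<close> by blast
        then have "e \<in> M" "e \<notin> A" using XY(1,3) by blast+
        then have "e = {u, z} \<or> e = f" unfolding M_def by blast
        then have "u \<in> e \<or> w \<in> e" using f(2) by blast
        ultimately show False using XY(2) e by blast
      qed
      fix X Y assume XY: "X \<union> Y = M" "\<Union>X \<inter> \<Union>Y = {}"
      have YX: "Y \<union> X = M" "\<Union>Y \<inter> \<Union>X = {}" using XY by blast+
      have "(X \<inter> A) \<union> (Y \<inter> A) = A" using XY(1) unfolding M_def by blast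
      moreover have "\<Union>(X \<inter> A) \<inter> \<Union>(Y \<inter> A) = {}" using XY(2) by blast
      ultimately have "X \<inter> A = {} \<or> Y \<inter> A = {}"
        using connected_A unfolding connected_edges_def by blast
      then show "X = {} \<or> Y = {}" using half[OF XY] half[OF YX] by blast
    qed
    have B0M: "\<Union>B0 \<inter> \<Union>M \<subseteq> {z, t}"
    proof
      fix x assume x: "x \<in> \<Union>B0 \<inter> \<Union>M"
      have "x \<noteq> w" "x \<noteq> u" using x wB0 uB unfolding B0_def by blast+
      then show "x \<in> {z, t}" using x B0A[of x] t(1) unfolding M_def by blast
    qed
    have uB0: "u \<notin> \<Union>B0" using uB unfolding B0_def by blast
    have zuM: "{z, u} \<in> M" using zu unfolding M_def by blast
    have fM: "f \<in> M" "t \<in> f" using t(1) unfolding M_def by blast+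
    have BM0: "B0 \<inter> M = {}" using disj uzAB unfolding B0_def M_def by blast
    have "f \<notin> A" "{u, z} \<notin> insert f A" using f(1) disj uzAB by blast+
    then have cM: "2 < card M" unfolding M_def using finA cardA by simp
    have "z \<noteq> t" "u \<noteq> z" "u \<noteq> t" using False uz tu by auto
    from colorable_contract[OF k simple separable deg IH E_BM BM0 B0M conn cM zuM M_z fM M_t this]
    obtain c where c: "bicycle_free E' c" "c ` E' \<subseteq> {..<k}"
      unfolding colorable_def E'_def by blast
    note cP = bicycle_free_proper[OF c(1)]
    have inE': "{z, u} \<in> E'" "{u, t} \<in> E'" "B0 \<subseteq> E'" unfolding E'_def by blast+
    let ?\<psi> = "c(f := c {u, t})"
    have fB0: "f \<notin> B0" unfolding B0_def by blast
    have "bicycle_free (insert f B0) ?\<psi>"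
    proof (rule bicycle_free_pendant[OF bicycle_free_subset[OF c(1) inE'(3)] f(2) wB0])
      fix g assume g: "g \<in> B0" "g \<inter> f \<noteq> {}"
      then have "t \<in> g" using wB0 t(1) by blast
      moreover have "g \<noteq> {u, t}" using g(1) uB0 by blast
      ultimately show "c g \<noteq> c {u, t}" using proper_eqD[OF cP, of g "{u, t}" t] g(1) inE' by blast
    qed
    then have bf: "bicycle_free B ?\<psi>" using B_eq by simp
    have ne: "c {u, t} \<noteq> c {z, u}"
    proof
      assume "c {u, t} = c {z, u}"
      then have "{u, t} = {z, u}" using inE' by (intro proper_eqD[OF cP, of _ _ u]) auto
      then show False using False by (simp add: doubleton_eq_iff)
    qed
    show ?thesis
    proof (rule colorable_if_missing[OF deg bf, of "c {z, u}"])
      show "?\<psi> ` B \<subseteq> {..<k}" using c(2) inE' B_eq by auto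
      show "c {z, u} < k" using c(2) inE' by blast
      show "?\<psi> e \<noteq> c {z, u}" if e: "e \<in> B" "z \<in> e" for e
      proof -
        have "e \<noteq> f" using e(2) fz by blast
        then have e0: "e \<in> B0" using e(1) unfolding B0_def by blast
        have "e \<noteq> {z, u}" using e0 uB0 by blast
        then have "c e \<noteq> c {z, u}" using proper_eqD[OF cP, of e "{z, u}" z] e0 e(2) inE' by blast
        then show ?thesis using \<open>e \<noteq> f\<close> by simp
      qed
      show "?\<psi> e \<noteq> c {z, u}" if e: "e \<in> B" "w \<in> e" for e
        using only[OF e] ne by simp
    qed
  qed
qed

lemma colorable_minimal:
  assumes k: "3 \<le> k" and deg: "\<And>v. vertex_degree E v \<le> k"
    and IH: "\<And>E' :: 'a set set. simple_edges E' \<Longrightarrow> edge_separable E' \<Longrightarrow> (\<forall>v. vertex_degree E' v \<le> k) \<Longrightarrow>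
      card E' < card E \<Longrightarrow> colorable k E'"
  shows "colorable k E"
proof (cases "vertex_degree B w = 1")
  case True
  then show ?thesis using colorable_single_end[OF k deg IH] by blast
next
  case False
  then have Bw: "2 \<le> vertex_degree B w" using degree_Bw_pos by simp
  have "\<forall>v. vertex_degree B v \<le> k" using vertex_degree_mono[OF finite_E BE] deg order_trans by blast
  then obtain \<psi> where \<psi>: "bicycle_free B \<psi>" "\<psi> ` B \<subseteq> {..<k}"
    using IH[OF simpleB edge_separable_subset[OF separable BE] _ card_B_less]
    unfolding colorable_def by blast
  have "card (\<psi> ` {e \<in> B. z \<in> e}) = vertex_degree B z"
    using proper_card_star[OF bicycle_free_proper[OF \<psi>(1)]] .
  \<comment> \<open>The edge \<open>uz\<close> counts for the degree of \<open>z\<close> in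
    \<open>E\<close> but is not in \<open>B\<close>, so a colour is left over for it.\<close>
  also have "\<dots> < k" using degree_z deg[of z] by simp
  finally have "\<not> {..<k} \<subseteq> \<psi> ` {e \<in> B. z \<in> e}"
    using card_mono[of "\<psi> ` {e \<in> B. z \<in> e}" "{..<k}"] finB by auto
  then obtain c where c: "c < k" "c \<notin> \<psi> ` {e \<in> B. z \<in> e}" by blast
  have cz: "\<And>e. e \<in> B \<Longrightarrow> z \<in> e \<Longrightarrow> \<psi> e \<noteq> c" using c(2) by blast
  show ?thesis
  proof (cases "\<exists>e\<in>B. w \<in> e \<and> \<psi> e = c")
    case True
    then show ?thesis using colorable_if_present[OF deg \<psi> c(1) cz _ Bw] by blast
  next
    case False
    then show ?thesis using colorable_if_missing[OF deg \<psi> c(1) cz] by blast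
  qed
qed

end

text \<open>Distinct colours suffice: an edge set of minimum degree 2 contains three edges, namely
  any edge and one further edge at each of its ends.\<close>

lemma colorable_small:
  assumes E: "simple_edges E" and card: "card E \<le> k"
  shows "colorable k E"
proof -
  obtain col where col: "bij_betw col E {0..<card E}"
    using ex_bij_betw_finite_nat[OF simple_edges_finite[OF E]] by blast
  then have inj: "inj_on col E" by (simp add: bij_betw_def)
  have "bicycle_free E col"
  proof (rule bicycle_freeI)
    show "proper_edge_coloring E col" using inj unfolding proper_edge_coloring_def inj_on_def by blast
    fix F a b assume F: "F \<subseteq> E" "F \<noteq> {}" "col ` F \<subseteq> {a, b}" and deg: "\<And>v. v \<in> \<Union>F \<Longrightarrow> 2 \<le> vertex_degree F v"
    obtain e where e: "e \<in> F" using F(2) by blast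
    then obtain p q where pq: "e = {p, q}" "p \<noteq> q" using simple_edges_nonempty[OF E] F(1) by blast
    have "2 \<le> vertex_degree F p" "2 \<le> vertex_degree F q" using deg e pq by blast+
    then obtain f g where f: "f \<in> F" "p \<in> f" "f \<noteq> e" and g: "g \<in> F" "q \<in> g" "g \<noteq> e"
      using vertex_degree_ge2_other[of F p e] vertex_degree_ge2_other[of F q e] by metis
    have "f \<noteq> g"
    proof
      assume "f = g"
      obtain x where x: "f = {p, x}" using simple_edges_other[OF E, of f p] f(1,2) F(1) by blast
      then have "x = q" using g(2) \<open>f = g\<close> pq(2) by blast
      then show False using x f(3) pq(1) by simp
    qed
    have "card {e, f, g} = 3" using f(3) g(3) \<open>f \<noteq> g\<close> by simp
    moreover have "card (col ` {e, f, g}) = card {e, f, g}"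
      using inj e f(1) g(1) F(1) by (intro card_image inj_on_subset[OF inj]) auto
    moreover have "card (col ` {e, f, g}) \<le> card {a, b}"
      using F(3) e f(1) g(1) by (intro card_mono) auto
    moreover have "card {a, b} \<le> 2" by (simp add: card_insert_if)
    ultimately show False by simp
  qed
  moreover have "col ` E \<subseteq> {..<k}" using col card unfolding bij_betw_def by auto
  ultimately show ?thesis unfolding colorable_def by blast
qed

lemma vertex_degree_le2E:
  assumes E: "finite E" and "vertex_degree E v \<le> 2" "e \<in> E" "f \<in> E" "g \<in> E" "v \<in> e" "v \<in> f" "v \<in> g" "e \<noteq> f"
  shows "g = e \<or> g = f"
proof (rule ccontr)
  assume "\<not> ?thesis"
  then have "g \<noteq> e" "g \<noteq> f" by blast+
  then have "card {e, f, g} = 3" using assms(9) by simp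
  moreover have "card {e, f, g} \<le> vertex_degree E v"
    unfolding vertex_degree_def using assms by (intro card_mono) auto
  ultimately show False using assms(2) by simp
qed

text \<open>The path \<open>a, x, y, b\<close> is contracted to \<open>a, x, b\<close>. Its ends
  differ, since otherwise \<open>a\<close> would be a cut vertex, the graph having more than three
  edges.\<close>

lemma colorable_adjacent_degree_2:
  fixes E :: "'a set set"
  assumes k: "3 \<le> k" and simple: "simple_edges E" and sepE: "edge_separable E" and deg: "\<And>v. vertex_degree E v \<le> k"
    and IH: "\<And>E' :: 'a set set. simple_edges E' \<Longrightarrow> edge_separable E' \<Longrightarrow> (\<forall>v. vertex_degree E' v \<le> k) \<Longrightarrow>
      card E' < card E \<Longrightarrow> colorable k E'"
    and bi: "biconnected_edges E" and large: "3 < card E"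
    and xy: "{x, y} \<in> E" "vertex_degree E x \<le> 2" "vertex_degree E y \<le> 2"
  shows "colorable k E"
proof -
  note fin = simple_edges_finite[OF simple]
  have xyne: "x \<noteq> y" using simple_edge_doubleton[OF simple xy(1)] .
  have "2 \<le> vertex_degree E x" "2 \<le> vertex_degree E y" using biconnected_degree_ge2[OF simple bi _, of x] biconnected_degree_ge2[OF simple bi _, of y] large xy(1) by force+
  then obtain ex ey where ex: "ex \<in> E" "x \<in> ex" "ex \<noteq> {x, y}" and ey: "ey \<in> E" "y \<in> ey" "ey \<noteq> {x, y}"
    using vertex_degree_ge2_other[of E x "{x, y}"] vertex_degree_ge2_other[of E y "{x, y}"] by metis
  obtain a where a: "ex = {x, a}" "a \<noteq> x" using simple_edges_other[OF simple ex(1,2)] by blast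
  obtain b where b: "ey = {y, b}" "b \<noteq> y" using simple_edges_other[OF simple ey(1,2)] by blast
  have ay: "a \<noteq> y" using a ex(3) by blast
  have bx: "b \<noteq> x" using b ey(3) by blast
  have ax_eq: "ex = {a, x}" using a(1) by blast
  have x_edges: "e = {a, x} \<or> e = {x, y}" if "e \<in> E" "x \<in> e" for e
    using vertex_degree_le2E[OF fin xy(2) ex(1) xy(1) that(1) ex(2) _ that(2) ex(3)] ax_eq by blast
  have y_edges: "e = {y, b} \<or> e = {x, y}" if "e \<in> E" "y \<in> e" for e
    using vertex_degree_le2E[OF fin xy(3) ey(1) xy(1) that(1) ey(2) _ that(2) ey(3)] b(1) by blast
  define M where "M = {{a, x}, {x, y}, {y, b}}"
  define B where "B = E - M"
  have ME: "M \<subseteq> E" using ex(1) xy(1) ey(1) ax_eq b(1) unfolding M_def by blast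
  then have E: "E = B \<union> M" and BM0: "B \<inter> M = {}" unfolding B_def by blast+
  have xB: "x \<notin> \<Union>B" and yB: "y \<notin> \<Union>B" using x_edges y_edges unfolding B_def M_def by blast+
  have BM: "\<Union>B \<inter> \<Union>M \<subseteq> {a, b}" using xB yB unfolding M_def by blast
  have cardM: "card M \<le> 3" unfolding M_def by (simp add: card_insert_if)
  have finM: "finite B" "finite M" using fin E by auto
  have Bne: "B \<noteq> {}" using cardM large E by auto
  have ab: "a \<noteq> b"
  proof
    assume "a = b"
    then have "\<And>v. v \<in> \<Union>B \<Longrightarrow> v \<in> \<Union>M \<Longrightarrow> v = a" using BM by blast
    then show False using biconnected_edgesD[OF bi E[symmetric] Bne] unfolding M_def by blast
  qed
  have cM: "card M = 3" unfolding M_def using ab a(2) b(2) ay bx xyne by (auto simp: card_insert_if doubleton_eq_iff)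
  have conn: "connected_edges M"
    unfolding connected_edges_def
  proof (intro allI impI)
    have half: "Y = {}" if XY: "X \<union> Y = M" "\<Union>X \<inter> \<Union>Y = {}" "{x, y} \<in> X" for X Y
    proof (rule ccontr)
      assume "Y \<noteq> {}"
      then obtain e where e: "e \<in> Y" by blast
      then have "e \<in> M" using XY(1) by blast
      then have "x \<in> e \<or> y \<in> e" unfolding M_def by blast
      then show False using XY(2,3) e by blast
    qed
    fix X Y assume XY: "X \<union> Y = M" "\<Union>X \<inter> \<Union>Y = {}"
    have YX: "Y \<union> X = M" "\<Union>Y \<inter> \<Union>X = {}" using XY by blast+
    have "{x, y} \<in> X \<union> Y" unfolding XY(1) M_def by blast
    then show "X = {} \<or> Y = {}" using half[OF XY] half[OF YX] by blast
  qed
  define E' where "E' = B \<union> {{a, x}, {x, b}}"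
  have M_mem: "{a, x} \<in> M" "{y, b} \<in> M" "b \<in> {y, b}" unfolding M_def by blast+
  have Ma: "e = {a, x}" if "e \<in> M" "a \<in> e" for e using that ab a(2) ay unfolding M_def by blast
  have Mb: "e = {y, b}" if "e \<in> M" "b \<in> e" for e using that ab b(2) bx unfolding M_def by blast
  have "colorable k E'"
    unfolding E'_def
    by (rule colorable_contract[OF k simple sepE deg IH E BM0 BM conn _ M_mem(1) Ma M_mem(2,3) Mb])
      (use ab a(2) bx cM in auto)
  then show ?thesis
    unfolding E'_def
    using colorable_subdivide[OF simple k E[unfolded M_def] xB yB ab a(2) ay bx b(2) xyne]
    by blast
qed

text \<open>\<open>k\<close> stays fixed while parts may have a smaller maximum degree, so all
  colourings in the induction share one palette.\<close>

theorem colorable_separable: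
  fixes E :: "'a set set"
  assumes "3 \<le> k" "simple_edges E" "edge_separable E" "\<And>v. vertex_degree E v \<le> k"
  shows "colorable k E"
  using assms(2-4)
proof (induction "card E" arbitrary: E rule: less_induct)
  case less
  note simple = less.prems(1) and sepE = less.prems(2) and deg = less.prems(3)
  note fin = simple_edges_finite[OF simple]
  have IH: "colorable k E'" if "simple_edges E'" "edge_separable E'" "\<forall>v. vertex_degree E' v \<le> k"
    "card E' < card E" for E' :: "'a set set" using less.hyps[OF that(4,1,2)] that(3) by blast
  have sub: "colorable k E'" if "E' \<subset> E" for E'
  proof (rule IH)
    have s: "E' \<subseteq> E" using that by blast
    show "simple_edges E'" "edge_separable E'"
      using simple_edges_subset[OF simple s] edge_separable_subset[OF sepE s] .
    show "\<forall>v. vertex_degree E' v \<le> k" using vertex_degree_mono[OF fin s] deg order_trans by blast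
    show "card E' < card E" using psubset_card_mono[OF fin that] .
  qed
  show ?case
  proof (cases "card E \<le> 3")
    case True
    then show ?thesis using colorable_small[OF simple] assms(1) by simp
  next
    case large: False
    show ?thesis
    proof (cases "biconnected_edges E")
      case False
      then obtain X Y w where XY: "X \<union> Y = E" "\<Union>X \<inter> \<Union>Y \<subseteq> {w}" "X \<noteq> {}" "Y \<noteq> {}"
        unfolding biconnected_edges_def by blast
      have "X \<subseteq> E" using XY(1) by blast
      then have d: "X \<inter> Y = {}" using sep_disjoint[OF simple_edges_subset[OF simple] XY(2)] by blast
      have "X \<subset> E" "Y \<subset> E" using XY(1,3,4) d by blast+
      then have "colorable k (X \<union> Y)"
        using colorable_glue[OF _ XY(2) sub sub] simple deg XY(1) by metis
      then show ?thesis using XY(1) by simp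
    next
      case bi: True
      show ?thesis
      proof (cases "\<exists>x y. {x, y} \<in> E \<and> vertex_degree E x \<le> 2 \<and> vertex_degree E y \<le> 2")
        case True
        then obtain x y where xy: "{x, y} \<in> E" "vertex_degree E x \<le> 2" "vertex_degree E y \<le> 2" by blast
        have l: "3 < card E" using large by simp
        show ?thesis
          by (rule colorable_adjacent_degree_2[OF assms(1) simple sepE deg IH bi l xy])
      next
        case False
        interpret reduced_graph E
          by unfold_locales (use simple sepE bi large False in auto)
        define S where "S = {n. \<exists>u z w A B. piece u z w A B \<and> card A = n}"
        have "\<exists>n. n \<in> S" using piece_exists unfolding S_def by blast
        then have "(LEAST n. n \<in> S) \<in> S" by (rule LeastI_ex)
        then obtain u z w A B where p: "piece u z w A B" "card A = (LEAST n. n \<in> S)"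
          unfolding S_def by blast
        interpret minimal_piece E u z w A B
        proof
          show "piece u z w A B" by (rule p(1))
          show "card A \<le> card A'" if "piece u' z' w' A' B'" for u' z' w' A' B'
            unfolding p(2) by (rule Least_le) (use that in \<open>unfold S_def, blast\<close>)
        qed
        show ?thesis using colorable_minimal[OF assms(1) deg IH] .
      qed
    qed
  qed
qed

section \<open>Chordless graphs are separable\<close>

text \<open>A predicate to be used with \<open>successively\<close>; \<open>adjacency\<close> is the
  same relation as a set of pairs, for closures.\<close>

definition adjacent :: "'a set set \<Rightarrow> 'a \<Rightarrow> 'a \<Rightarrow> bool" where
  "adjacent K x y \<longleftrightarrow> {x, y} \<in> K"

definition adjacency :: "'a set set \<Rightarrow> ('a \<times> 'a) set" where
  "adjacency K = {(x, y). {x, y} \<in> K}"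

lemma adjacent_sym: "adjacent K x y \<Longrightarrow> adjacent K y x"
  by (simp add: adjacent_def insert_commute)

lemma successively_adjacent_rev: "successively (adjacent K) xs \<Longrightarrow> successively (adjacent K) (rev xs)"
  by (induction xs rule: rev_induct) (auto simp: successively_append_iff successively_Cons adjacent_sym hd_rev)

lemma successively_adjacent_mono:
  "successively (adjacent K) xs \<Longrightarrow> K \<subseteq> K' \<Longrightarrow> successively (adjacent K') xs"
  by (erule successively_mono) (auto simp: adjacent_def)

lemma successively_join:
  "successively P (xs @ [x]) \<Longrightarrow> successively P (x # ys) \<Longrightarrow> successively P (xs @ x # ys)"
  by (simp add: successively_append_iff)

lemma successively_prefix: "successively P (xs @ x # ys) \<Longrightarrow> successively P (xs @ [x])"
  using successively_append_iff[of P "xs @ [x]" ys] by simp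

lemma cycle_inI:
  assumes "3 \<le> length c" "distinct c" "successively (adjacent K) (c @ [hd c])"
  shows "cycle_in K c"
  unfolding cycle_in_def
proof (intro conjI assms(1,2))
  show "cycle_edges c \<subseteq> K"
  proof
    fix e assume "e \<in> cycle_edges c"
    then obtain i where i: "i < length c" "e = {c ! i, c ! (Suc i mod length c)}"
      unfolding cycle_edges_def by blast
    have "adjacent K ((c @ [hd c]) ! i) ((c @ [hd c]) ! Suc i)"
      using successively_nth[OF assms(3), of i] i(1) by simp
    moreover have "(c @ [hd c]) ! i = c ! i" using i(1) by (simp add: nth_append)
    moreover have "(c @ [hd c]) ! Suc i = c ! (Suc i mod length c)"
    proof (cases "Suc i = length c")
      case True
      moreover have "hd c = c ! 0" using i(1) by (intro hd_conv_nth) auto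
      ultimately show ?thesis using i(1) by (simp add: nth_append)
    next
      case False
      then show ?thesis using i(1) by (simp add: nth_append)
    qed
    ultimately show "e \<in> K" using i(2) by (simp add: adjacent_def)
  qed
qed

text \<open>The walk is shortened to a path while it is built from its far end: if the new start
  already occurs on the path, the loop is cut off. Restarting at each vertex of \<open>T\<close>
  keeps the earlier vertices outside \<open>T\<close>.\<close>

lemma first_hit_path:
  assumes "(s, u) \<in> (adjacency K)\<^sup>*" "u \<in> T" "s \<notin> T"
  shows "\<exists>Q q. q \<in> T \<and> successively (adjacent K) (s # Q @ [q]) \<and> distinct (s # Q) \<and>
    set (s # Q) \<inter> T = {} \<and> set (s # Q @ [q]) \<subseteq> \<Union>K"
  using assms(1,3)
proof (induction rule: converse_rtrancl_induct)
  case base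
  then show ?case using assms(2) by blast
next
  case (step s s')
  have ss: "{s, s'} \<in> K" using step(1) by (simp add: adjacency_def)
  show ?case
  proof (cases "s' \<in> T")
    case True
    then show ?thesis using ss step(4) by (intro exI[of _ "[]"] exI[of _ s']) (auto simp: adjacent_def)
  next
    case False
    then obtain Q q where Q: "q \<in> T" "successively (adjacent K) (s' # Q @ [q])" "distinct (s' # Q)"
      "set (s' # Q) \<inter> T = {}" "set (s' # Q @ [q]) \<subseteq> \<Union>K" using step(3) by blast
    show ?thesis
    proof (cases "s \<in> set (s' # Q)")
      case True
      then obtain l r where lr: "s' # Q = l @ s # r" by (meson split_list)
      have "successively (adjacent K) (l @ s # r @ [q])" using Q(2) lr by (metis append.assoc append_Cons)
      then have "successively (adjacent K) (s # r @ [q])" by (simp add: successively_append_iff)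
      moreover have "distinct (s # r)" using Q(3) unfolding lr by simp
      moreover have "set (s # r) \<inter> T = {}" using Q(4) unfolding lr by auto
      moreover have "set (s # r @ [q]) \<subseteq> \<Union>K"
      proof -
        have "set (s # r @ [q]) \<subseteq> set ((s' # Q) @ [q])" unfolding lr by auto
        then show ?thesis using Q(5) by auto
      qed
      ultimately show ?thesis using Q(1) by blast
    next
      case False
      have "successively (adjacent K) (s # (s' # Q) @ [q])" using Q(2) ss by (simp add: adjacent_def)
      moreover have "set (s # (s' # Q)) \<inter> T = {}" using Q(4) step(4) by auto
      moreover have "set (s # (s' # Q) @ [q]) \<subseteq> \<Union>K" using Q(5) ss by auto
      ultimately show ?thesis using Q(1,3) False by (metis distinct.simps(2))
    qed
  qed
qed

section \<open>Menger's theorem for two paths\<close>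

definition two_paths :: "'a set set \<Rightarrow> 'a \<Rightarrow> 'a \<Rightarrow> 'a list \<Rightarrow> 'a list \<Rightarrow> bool" where
  "two_paths K u v as bs \<longleftrightarrow> successively (adjacent K) (u # as @ [v]) \<and> successively (adjacent K) (u # bs @ [v]) \<and>
     distinct (u # v # as @ bs) \<and> as @ bs \<noteq> []"

lemma two_paths_sym: "two_paths K u v as bs \<Longrightarrow> two_paths K u v bs as"
  unfolding two_paths_def by auto

lemma two_paths_cycle:
  assumes "two_paths K u v as bs"
  shows "\<exists>c. cycle_in K c \<and> {u, v} \<subseteq> set c"
proof -
  let ?c = "u # as @ v # rev bs"
  have "successively (adjacent K) (rev (u # bs @ [v]))"
    using assms unfolding two_paths_def by (intro successively_adjacent_rev) blast
  then have r: "successively (adjacent K) (v # rev bs @ [u])" by simp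
  have "successively (adjacent K) ((u # as) @ [v])" using assms unfolding two_paths_def by simp
  then have "successively (adjacent K) ((u # as) @ v # rev bs @ [u])" using r by (rule successively_join)
  then have "successively (adjacent K) (?c @ [hd ?c])" by simp
  moreover have "distinct ?c" using assms unfolding two_paths_def by auto
  \<comment> \<open>Not both paths are the edge \<open>uv\<close> itself, which excludes a
    degenerate cycle of length 2.\<close>
  moreover have "3 \<le> length ?c"
  proof -
    have "as @ bs \<noteq> []" using assms unfolding two_paths_def by blast
    then have "1 \<le> length as + length bs"
      by (metis One_nat_def Suc_leI length_append length_greater_0_conv)
    then show ?thesis by simp
  qed
  ultimately have "cycle_in K ?c" by (intro cycle_inI)
  then show ?thesis by (intro exI[of _ ?c]) auto
qed

text \<open>The first path is cut at \<open>s\<close>: its initial part is one new path, and the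
  other runs along \<open>bs\<close> to \<open>v\<close> and back over the rest of the first
  path.\<close>

lemma two_paths_step_on:
  assumes t: "two_paths K u v as bs" and vs: "{v, s} \<in> K" and s: "s \<in> set as"
  shows "\<exists>as' bs'. two_paths K u s as' bs'"
proof -
  obtain a1 a2 where a: "as = a1 @ s # a2" using s by (meson split_list)
  have p: "successively (adjacent K) ((u # a1) @ s # a2 @ [v])"
    using t unfolding two_paths_def a by simp
  have "successively (adjacent K) (rev (s # a2 @ [v]))"
    using p[unfolded successively_append_iff] by (intro successively_adjacent_rev) blast
  then have r: "successively (adjacent K) (v # rev a2 @ [s])" by simp
  have "successively (adjacent K) ((u # bs) @ [v])" using t unfolding two_paths_def by simp
  then have "successively (adjacent K) ((u # bs) @ v # rev a2 @ [s])" using r by (rule successively_join)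
  moreover have "successively (adjacent K) (u # a1 @ [s])"
    using successively_prefix[OF p] by simp
  ultimately have "two_paths K u s a1 (bs @ v # rev a2)"
    using t unfolding two_paths_def a by auto
  then show ?thesis by blast
qed

text \<open>One new path goes along \<open>bs\<close> to \<open>v\<close> and on to
  \<open>s\<close>; the other follows \<open>as\<close> up to the hit \<open>q\<close> and then the
  detour backwards to \<open>s\<close>.\<close>

lemma two_paths_step_hit:
  assumes t: "two_paths K u v as bs" and vs: "{v, s} \<in> K"
    and Q: "successively (adjacent K) (s # Q @ [q])" "distinct (s # Q)" "v \<notin> set (s # Q)"
      "set (s # Q) \<inter> ({u} \<union> set as \<union> set bs) = {}" and q: "q = u \<or> q \<in> set as"
  shows "\<exists>as' bs'. two_paths K u s as' bs'"
proof -
  have r: "successively (adjacent K) (q # rev Q @ [s])" using successively_adjacent_rev[OF Q(1)] by simp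
  have "successively (adjacent K) ((u # bs) @ v # [s])"
    by (rule successively_join) (use t vs in \<open>simp_all add: two_paths_def adjacent_def\<close>)
  then have b: "successively (adjacent K) (u # (bs @ [v]) @ [s])" by simp
  show ?thesis
  proof (cases "q = u")
    case True
    have "two_paths K u s (bs @ [v]) (rev Q)"
      using r b t Q unfolding two_paths_def True by auto
    then show ?thesis by blast
  next
    case False
    then obtain a1 a2 where a: "as = a1 @ q # a2" using q by (meson split_list)
    have "successively (adjacent K) ((u # a1) @ q # a2 @ [v])"
      using t unfolding two_paths_def a by simp
    then have "successively (adjacent K) ((u # a1) @ [q])" by (rule successively_prefix)
    then have "successively (adjacent K) ((u # a1) @ q # rev Q @ [s])"
      using r by (rule successively_join)
    then have "two_paths K u s (bs @ [v]) (a1 @ q # rev Q)"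
      using b t Q unfolding two_paths_def a by auto
    then show ?thesis by blast
  qed
qed

lemma two_paths_step:
  assumes t: "two_paths K u v as bs" and vs: "{v, s} \<in> K" "s \<noteq> u"
    and reach: "(s, u) \<in> (adjacency {e \<in> K. v \<notin> e})\<^sup>*"
  shows "\<exists>as' bs'. two_paths K u s as' bs'"
proof -
  note t' = two_paths_sym[OF t]
  consider "s \<in> set as" | "s \<in> set bs" | "s \<notin> {u} \<union> set as \<union> set bs" using vs(2) by blast
  then show ?thesis
  proof cases
    case 1 then show ?thesis using two_paths_step_on[OF t vs(1)] by blast
  next
    case 2 then show ?thesis using two_paths_step_on[OF t' vs(1)] by blast
  next
    case 3
    have "u \<in> {u} \<union> set as \<union> set bs" by simp
    then obtain Q q where Q: "q \<in> {u} \<union> set as \<union> set bs" "successively (adjacent {e \<in> K. v \<notin> e}) (s # Q @ [q])"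
      "distinct (s # Q)" "set (s # Q) \<inter> ({u} \<union> set as \<union> set bs) = {}"
      "set (s # Q @ [q]) \<subseteq> \<Union>{e \<in> K. v \<notin> e}"
      using first_hit_path[OF reach _ 3] by blast
    have QK: "successively (adjacent K) (s # Q @ [q])" using successively_adjacent_mono[OF Q(2)] by blast
    have v: "v \<notin> set (s # Q)" using Q(5) by auto
    have Q4: "set (s # Q) \<inter> ({u} \<union> set bs \<union> set as) = {}" using Q(4) by blast
    consider "q = u \<or> q \<in> set as" | "q = u \<or> q \<in> set bs" using Q(1) by blast
    then show ?thesis
    proof cases
      case 1 then show ?thesis using two_paths_step_hit[OF t vs(1) QK Q(3) v Q(4)] by blast
    next
      case 2 then show ?thesis using two_paths_step_hit[OF t' vs(1) QK Q(3) v Q4] by blast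
    qed
  qed
qed

text \<open>A pair of disjoint paths from \<open>u\<close> is pushed along a path \<open>p\<close>
  from \<open>u\<close> to \<open>z\<close>, one vertex at a time. After deletion of an inner vertex
  \<open>p ! n\<close>, the next vertex still reaches \<open>u\<close>: along \<open>p\<close> to
  \<open>z\<close>, and from there by \<open>avoid\<close>.\<close>

lemma two_paths_exist:
  assumes uz: "u \<noteq> z" "{u, z} \<notin> K" and conn: "(u, z) \<in> (adjacency K)\<^sup>*"
    and avoid: "\<And>w. w \<noteq> u \<Longrightarrow> w \<noteq> z \<Longrightarrow> (z, u) \<in> (adjacency {e \<in> K. w \<notin> e})\<^sup>*"
  shows "\<exists>as bs. two_paths K u z as bs"
proof -
  obtain Q where Q: "successively (adjacent K) (u # Q @ [z])" "distinct (u # Q)" "set (u # Q) \<inter> {z} = {}"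
    using first_hit_path[OF conn, of "{z}"] uz(1) by auto
  define p where "p = u # Q @ [z]"
  define m where "m = Suc (length Q)"
  have len: "length p = Suc m" and dist: "distinct p" and p0: "p ! 0 = u" and pm: "p ! m = z"
    using Q by (auto simp: p_def m_def nth_append)
  have adj: "{p ! i, p ! Suc i} \<in> K" if "i < m" for i
    using successively_nth[of "adjacent K" p i] Q(1) that len unfolding p_def adjacent_def by auto
  \<comment> \<open>The path has an inner vertex since \<open>uz\<close> is not in \<open>K\<close>;
    the base case below needs \<open>p ! 2\<close>.\<close>
  have "Q \<noteq> []" using Q(1) uz(2) by (auto simp: adjacent_def)
  then have m2: "2 \<le> m" by (cases Q) (auto simp: m_def)
  have eq: "p ! i = p ! j \<longleftrightarrow> i = j" if "i \<le> m" "j \<le> m" for i j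
    using nth_eq_iff_index_eq[OF dist] that len by simp
  have to_z: "(p ! j, z) \<in> (adjacency {e \<in> K. p ! n \<notin> e})\<^sup>*" if "n < j" "j \<le> m" for n j
    using that(2,1)
  proof (induction rule: inc_induct)
    case base
    then show ?case using pm by simp
  next
    case (step i)
    have "p ! n \<notin> {p ! i, p ! Suc i}" using eq[of n i] eq[of n "Suc i"] step by auto
    then have "(p ! i, p ! Suc i) \<in> adjacency {e \<in> K. p ! n \<notin> e}"
      using adj[of i] step by (simp add: adjacency_def)
    moreover have "(p ! Suc i, z) \<in> (adjacency {e \<in> K. p ! n \<notin> e})\<^sup>*" using step by simp
    ultimately show ?case by (rule converse_rtrancl_into_rtrancl)
  qed
  have reach: "(p ! Suc n, u) \<in> (adjacency {e \<in> K. p ! n \<notin> e})\<^sup>*" if "0 < n" "n < m" for n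
  proof -
    have "p ! n \<noteq> u" "p ! n \<noteq> z" using eq[of n 0] eq[of n m] that p0 pm by auto
    then have "(z, u) \<in> (adjacency {e \<in> K. p ! n \<notin> e})\<^sup>*" by (rule avoid)
    moreover have "(p ! Suc n, z) \<in> (adjacency {e \<in> K. p ! n \<notin> e})\<^sup>*" using that by (intro to_z) auto
    ultimately show ?thesis by (rule rtrancl_trans[rotated])
  qed
  have "\<exists>as bs. two_paths K u (p ! n) as bs" if "1 \<le> n" "n \<le> m" for n
    using that
  proof (induction n rule: nat_induct_at_least)
    case base
    \<comment> \<open>From \<open>u\<close> to \<open>p ! 1\<close>: the edge itself, and a way
      through \<open>p ! 2\<close> found after deleting \<open>p ! 1\<close>.\<close>
    let ?s = "p ! 1" and ?t = "p ! 2"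
    have "(?t, u) \<in> (adjacency {e \<in> K. ?s \<notin> e})\<^sup>*" using reach[of 1] m2 by (simp add: numeral_2_eq_2)
    moreover have tu: "?t \<noteq> u" using eq[of 2 0] m2 p0 by auto
    ultimately obtain R where R: "successively (adjacent {e \<in> K. ?s \<notin> e}) (?t # R @ [u])" "distinct (?t # R)"
      "set (?t # R) \<inter> {u} = {}" "set (?t # R @ [u]) \<subseteq> \<Union>{e \<in> K. ?s \<notin> e}"
      using first_hit_path[of ?t u _ "{u}"] by blast
    have "successively (adjacent K) (rev (?t # R @ [u]))"
      by (rule successively_adjacent_rev[OF successively_adjacent_mono[OF R(1)]]) blast
    then have "successively (adjacent K) ((u # rev R) @ [?t])" by simp
    moreover have "successively (adjacent K) (?t # [?s])"
      using adj[of 1] m2 by (simp add: adjacent_def numeral_2_eq_2 insert_commute)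
    ultimately have "successively (adjacent K) ((u # rev R) @ ?t # [?s])"
      by (rule successively_join)
    moreover have "successively (adjacent K) (u # [] @ [?s])" using adj[of 0] m2 p0 by (simp add: adjacent_def)
    moreover have "?s \<notin> set (?t # R @ [u])" using R(4) by blast
    ultimately have "two_paths K u ?s [] (rev R @ [?t])"
      using R(2,3) unfolding two_paths_def by auto
    then show ?case by blast
  next
    case (Suc n)
    then obtain as bs where t: "two_paths K u (p ! n) as bs" by auto
    have "p ! Suc n \<noteq> u" using eq[of "Suc n" 0] Suc p0 by auto
    then show ?case using two_paths_step[OF t] adj[of n] reach[of n] Suc by simp
  qed
  from this[of m] show ?thesis using m2 pm by simp
qed

text \<open>\<open>W\<close> is empty or \<open>{w}\<close>, so disconnection and a cut vertex are
  handled at once. \<open>A\<close> collects the edges meeting the component of \<open>u\<close>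
  after deletion of \<open>W\<close>.\<close>

lemma edge_separation_if_unreachable:
  assumes simple: "simple_edges E" and W: "W \<subseteq> {w}" "u \<notin> W" "z \<notin> W"
    and n: "(u, z) \<notin> (adjacency {e \<in> E - {{u, z}}. e \<inter> W = {}})\<^sup>*" (is "_ \<notin> ?R\<^sup>*")
  shows "\<exists>A B. edge_separation E u z w A B"
proof -
  define A where "A = {e \<in> E - {{u, z}}. \<exists>x\<in>e. x \<notin> W \<and> (u, x) \<in> ?R\<^sup>*}"
  define B where "B = E - {{u, z}} - A"
  have reach: "(u, y) \<in> ?R\<^sup>*" if y: "e \<in> A" "y \<in> e" "y \<notin> W" for e y
  proof -
    obtain x where x: "e \<in> E - {{u, z}}" "x \<in> e" "x \<notin> W" "(u, x) \<in> ?R\<^sup>*"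
      using y(1) unfolding A_def by blast
    show ?thesis
    proof (cases "x = y")
      case False
      obtain y' where "e = {x, y'}" using simple_edges_other[OF simple _ x(2)] x(1) by blast
      then have e: "e = {x, y}" using y(2) False by blast
      then have "e \<inter> W = {}" using x(3) y(3) by blast
      then have "(x, y) \<in> ?R" using x(1) e unfolding adjacency_def by simp
      then show ?thesis using x(4) by (rule rtrancl_into_rtrancl[rotated])
    qed (use x in simp)
  qed
  have "edge_separation E u z w A B"
    unfolding edge_separation_def
  proof (intro conjI)
    show "A \<union> B = E - {{u, z}}" unfolding A_def B_def by blast
    show "\<Union>A \<inter> \<Union>B \<subseteq> {w}"
    proof
      fix y assume "y \<in> \<Union>A \<inter> \<Union>B"
      then obtain e f where ef: "e \<in> A" "f \<in> B" "y \<in> e" "y \<in> f" by blast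
      have "y \<in> W"
      proof (rule ccontr)
        assume yW: "y \<notin> W"
        have "(u, y) \<in> ?R\<^sup>*" using reach[OF ef(1,3) yW] .
        then have "f \<in> A" using ef(2,4) yW unfolding A_def B_def by blast
        then show False using ef(2) unfolding B_def by blast
      qed
      then show "y \<in> {w}" using W(1) by blast
    qed
    show "u \<notin> \<Union>B"
    proof
      assume "u \<in> \<Union>B"
      then obtain f where f: "f \<in> B" "u \<in> f" by blast
      then have "f \<in> A" using W(2) unfolding A_def B_def by blast
      then show False using f unfolding B_def by blast
    qed
    show "z \<notin> \<Union>A" using reach W(3) n by blast
  qed
  then show ?thesis by blast
qed

text \<open>
  If no single vertex separates \<open>u\<close> from \<open>z\<close> once the edge \<open>uz\<close> is removed, a cycle through
  both remains, so \<open>uz\<close> is a chord.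
\<close>

lemma chordless_edge_separable:
  assumes simple: "simple_edges E" and ch: "chordless E"
  shows "edge_separable E"
  unfolding edge_separable_def
proof (intro allI impI)
  fix u z assume uz: "{u, z} \<in> E"
  have ne: "u \<noteq> z" using simple_edge_doubleton[OF simple uz] .
  let ?K = "E - {{u, z}}"
  have no: "\<nexists>as bs. two_paths ?K u z as bs"
    using two_paths_cycle[of ?K u z] ch uz unfolding chordless_def chord_def by blast
  show "\<exists>w A B. edge_separation E u z w A B"
  proof (rule ccontr)
    assume c: "\<not> ?thesis"
    \<comment> \<open>With nothing deleted the separating vertex is a dummy, here
      \<open>u\<close>.\<close>
    have "(u, z) \<in> (adjacency {e \<in> ?K. e \<inter> {} = {}})\<^sup>*"
      using edge_separation_if_unreachable[OF simple, of "{}" u u z] c by blast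
    moreover have "{e \<in> ?K. e \<inter> {} = {}} = ?K" by blast
    ultimately have conn: "(u, z) \<in> (adjacency ?K)\<^sup>*" by (simp only:)
    have avoid: "(z, u) \<in> (adjacency {e \<in> ?K. w \<notin> e})\<^sup>*" if w: "w \<noteq> u" "w \<noteq> z" for w
    proof -
      have "(u, z) \<in> (adjacency {e \<in> ?K. e \<inter> {w} = {}})\<^sup>*"
        using edge_separation_if_unreachable[OF simple, of "{w}" w u z] c w by blast
      moreover have "{e \<in> ?K. e \<inter> {w} = {}} = {e \<in> ?K. w \<notin> e}" by blast
      ultimately have "(u, z) \<in> (adjacency {e \<in> ?K. w \<notin> e})\<^sup>*" by (simp only:)
      moreover have "sym (adjacency {e \<in> ?K. w \<notin> e})"
        by (rule symI) (simp add: adjacency_def insert_commute)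
      ultimately show ?thesis by (meson sym_rtrancl symD)
    qed
    have "{u, z} \<notin> ?K" by simp
    then show False using two_paths_exist[OF ne _ conn avoid] no by blast
  qed
qed

section \<open>The acyclic chromatic index\<close>

lemma vertex_degree_cycle_edges:
  assumes c: "3 \<le> length c" "distinct c" and v: "v \<in> set c"
  shows "vertex_degree (cycle_edges c) v = 2"
proof -
  let ?n = "length c"
  obtain i where i: "i < ?n" "c ! i = v" using v by (meson in_set_conv_nth)
  define f where "f j = {c ! j, c ! (Suc j mod ?n)}" for j
  \<comment> \<open>The index of the cyclic predecessor of \<open>v\<close>.\<close>
  define p where "p = (if i = 0 then ?n - 1 else i - 1)"
  have p: "p < ?n" "Suc p mod ?n = i" using i(1) c(1) unfolding p_def by auto
  have eq: "c ! j = c ! k \<longleftrightarrow> j = k" if "j < ?n" "k < ?n" for j k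
    using nth_eq_iff_index_eq[OF c(2)] that by simp
  have lt: "Suc j mod ?n < ?n" for j using c(1) by (intro mod_less_divisor) auto
  have star: "{e \<in> cycle_edges c. v \<in> e} = {f i, f p}"
  proof
    show "{f i, f p} \<subseteq> {e \<in> cycle_edges c. v \<in> e}"
      using i p unfolding cycle_edges_def f_def by auto
    show "{e \<in> cycle_edges c. v \<in> e} \<subseteq> {f i, f p}"
    proof
      fix e assume "e \<in> {e \<in> cycle_edges c. v \<in> e}"
      then obtain j where j: "j < ?n" "e = f j" "v \<in> f j" unfolding cycle_edges_def f_def by blast
      then have "i = j \<or> i = Suc j mod ?n" using i eq[of i j] eq[of i "Suc j mod ?n"] lt unfolding f_def by auto
      then show "e \<in> {f i, f p}"
      proof
        assume "i = Suc j mod ?n"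
        then have "j = p" using j(1) unfolding p_def by (auto simp: mod_Suc split: if_splits)
        then show ?thesis using j(2) by blast
      qed (use j(2) in blast)
    qed
  qed
  \<comment> \<open>Here length at least 3 matters: around a cycle of length 2 both edges would
    coincide.\<close>
  have "f i \<noteq> f p"
  proof
    assume "f i = f p"
    then have "c ! (Suc i mod ?n) \<in> {c ! p, c ! i}" unfolding f_def p(2) by blast
    then have "Suc i mod ?n = p \<or> Suc i mod ?n = i" using eq lt[of i] p(1) i(1) by auto
    then show False using i(1) c(1) unfolding p_def by (auto simp: mod_Suc split: if_splits)
  qed
  then show ?thesis unfolding vertex_degree_def star by simp
qed

lemma Union_cycle_edges: "c \<noteq> [] \<Longrightarrow> \<Union>(cycle_edges c) = set c"
proof
  assume c: "c \<noteq> []"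
  then have "Suc i mod length c < length c" for i by (intro mod_less_divisor) simp
  then show "\<Union>(cycle_edges c) \<subseteq> set c" unfolding cycle_edges_def by auto
  show "set c \<subseteq> \<Union>(cycle_edges c)"
  proof
    fix x assume "x \<in> set c"
    then obtain i where "i < length c" "c ! i = x" by (meson in_set_conv_nth)
    then show "x \<in> \<Union>(cycle_edges c)" unfolding cycle_edges_def by blast
  qed
qed

lemma bicycle_free_acyclic:
  assumes "bicycle_free E col"
  shows "acyclic_edge_coloring E col"
  unfolding acyclic_edge_coloring_def
proof (intro conjI notI)
  show "proper_edge_coloring E col" using bicycle_free_proper[OF assms] .
  assume "\<exists>c. cycle_in E c \<and> card (col ` cycle_edges c) = 2"
  then obtain c where c: "cycle_in E c" "card (col ` cycle_edges c) = 2" by blast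
  then obtain a b where "col ` cycle_edges c = {a, b}" by (meson card_2_iff)
  moreover have len: "3 \<le> length c" "distinct c" "cycle_edges c \<subseteq> E" using c(1) by (auto simp: cycle_in_def)
  moreover have "c \<noteq> []" using len(1) by auto
  ultimately have "cycle_edges c = {}"
    using bicycle_free_empty[OF assms, of "cycle_edges c" a b] vertex_degree_cycle_edges[OF len(1,2)]
      Union_cycle_edges by (metis order_refl)
  then show False using c(2) by simp
qed

text \<open>Longest path argument: every neighbour of the first vertex of a longest path lies on the
  path, and a second edge at that vertex closes a cycle.\<close>

lemma min_degree_2_cycle:
  assumes F: "simple_edges F" "F \<noteq> {}" and deg: "\<And>v. v \<in> \<Union>F \<Longrightarrow> 2 \<le> vertex_degree F v"
  shows "\<exists>c. cycle_in F c"
proof -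
  define P where "P xs \<longleftrightarrow> successively (adjacent F) xs \<and> distinct xs \<and> set xs \<subseteq> \<Union>F \<and> 2 \<le> length xs" for xs
  have fin: "finite (\<Union>F)" using simple_edges_finite_Union[OF F(1)] .
  have bound: "length xs < Suc (card (\<Union>F))" if "P xs" for xs
    using that card_mono[OF fin, of "set xs"] unfolding P_def by (simp add: distinct_card)
  obtain e where "e \<in> F" using F(2) by blast
  then obtain x y where xy: "{x, y} \<in> F" "x \<noteq> y" using simple_edges_nonempty[OF F(1)] by metis
  then have "P [x, y]" unfolding P_def adjacent_def by auto
  then obtain xs where xs: "P xs" "\<And>ys. P ys \<Longrightarrow> length ys \<le> length xs"
    using ex_has_greatest_nat[of P "[x, y]" length "Suc (card (\<Union>F))"] bound by (metis less_imp_le)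
  then obtain v s r where v: "xs = v # s # r" unfolding P_def
    by (metis One_nat_def Suc_1 Suc_le_length_iff)
  have p: "successively (adjacent F) (v # s # r)" "distinct (v # s # r)" "set (v # s # r) \<subseteq> \<Union>F"
    using xs(1) unfolding P_def v by blast+
  have "2 \<le> vertex_degree F v" using deg p(3) by auto
  then obtain f where f: "f \<in> F" "v \<in> f" "f \<noteq> {v, s}" using vertex_degree_ge2_other[of F v "{v, s}"] by blast
  obtain t where t: "f = {v, t}" "t \<noteq> v" using simple_edges_other[OF F(1) f(1,2)] by blast
  have "t \<in> set (v # s # r)"
  proof (rule ccontr)
    assume n: "t \<notin> set (v # s # r)"
    have "P (t # v # s # r)"
      using p n f(1) t unfolding P_def by (auto simp: adjacent_def insert_commute)
    then show False using xs(2)[of "t # v # s # r"] v by simp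
  qed
  then have "t \<in> set r" using t f(3) by auto
  then obtain a b where ab: "r = a @ t # b" by (meson split_list)
  let ?c = "v # s # a @ [t]"
  have "successively (adjacent F) ((v # s # a) @ t # b)" using p(1) ab by simp
  then have "successively (adjacent F) ((v # s # a) @ [t])" by (rule successively_prefix)
  moreover have "successively (adjacent F) (t # [v])" using f(1) t by (simp add: adjacent_def insert_commute)
  ultimately have "successively (adjacent F) ((v # s # a) @ t # [v])" by (rule successively_join)
  then have "cycle_in F ?c" using p(2) ab by (intro cycle_inI) auto
  then show ?thesis by blast
qed

lemma colorable_forest:
  assumes E: "simple_edges E" and no: "\<nexists>c. cycle_in E c" and deg: "\<And>v. vertex_degree E v \<le> k"
  shows "colorable k E"
  using assms
proof (induction "card E" arbitrary: E rule: less_induct)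
  case less
  note E = less.prems(1) and fin = simple_edges_finite[OF less.prems(1)]
  show ?case
  proof (cases "E = {}")
    case True
    then have "bicycle_free E (\<lambda>_. 0)" "(\<lambda>_. 0) ` E \<subseteq> {..<k}"
      by (auto simp: bicycle_free_def proper_edge_coloring_def)
    then show ?thesis unfolding colorable_def by blast
  next
    case False
    obtain v where v: "v \<in> \<Union>E" "\<not> 2 \<le> vertex_degree E v"
      using min_degree_2_cycle[OF E False] less.prems(2) by blast
    then have "vertex_degree E v = 1" using vertex_degree_pos[OF fin, of v] by auto
    then obtain e where e: "e \<in> E" "v \<in> e" and only: "\<And>e'. e' \<in> E \<Longrightarrow> v \<in> e' \<Longrightarrow> e' = e"
      by (rule vertex_degree_1E) blast
    obtain x where x: "e = {v, x}" using simple_edges_other[OF E e] by blast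
    define E0 where "E0 = E - {e}"
    have E0: "E = insert e E0" "E0 \<subseteq> E" "e \<notin> E0" using e(1) unfolding E0_def by blast+
    have fin0: "finite E0" using fin E0(2) finite_subset by blast
    have vE0: "v \<notin> \<Union>E0" using only unfolding E0_def by blast
    have "card E0 < card E" using E0 fin by (intro psubset_card_mono) auto
    moreover have "\<nexists>c. cycle_in E0 c" using less.prems(2) E0(2) unfolding cycle_in_def by blast
    moreover have "\<And>v. vertex_degree E0 v \<le> k"
      using vertex_degree_mono[OF fin E0(2)] less.prems(3) order_trans by blast
    ultimately obtain c where c: "bicycle_free E0 c" "c ` E0 \<subseteq> {..<k}"
      using less.hyps[OF _ simple_edges_subset[OF E E0(2)]] unfolding colorable_def by blast
    have "card (c ` {f \<in> E0. x \<in> f}) = vertex_degree E0 x"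
      using proper_card_star[OF bicycle_free_proper[OF c(1)]] .
    \<comment> \<open>The leaf edge \<open>e\<close> counts at \<open>x\<close> in \<open>E\<close>
      but not in \<open>E0\<close>, which leaves a colour for it.\<close>
    also have "\<dots> < k"
      using less.prems(3)[of x] vertex_degree_insert[OF fin0 E0(3), of x] x E0(1) by simp
    finally have "\<not> {..<k} \<subseteq> c ` {f \<in> E0. x \<in> f}"
      using card_mono[of "c ` {f \<in> E0. x \<in> f}" "{..<k}"] fin0 by auto
    then obtain p where p: "p < k" "p \<notin> c ` {f \<in> E0. x \<in> f}" by blast
    have "c f \<noteq> p" if f: "f \<in> E0" "f \<inter> e \<noteq> {}" for f
    proof -
      have "x \<in> f" using f vE0 x by blast
      then show ?thesis using p(2) f(1) by blast
    qed
    then have "bicycle_free (insert e E0) (c(e := p))"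
      by (rule bicycle_free_pendant[OF c(1) e(2) vE0])
    moreover have "(c(e := p)) ` (insert e E0) \<subseteq> {..<k}" using c(2) p(1) by auto
    ultimately show ?thesis unfolding colorable_def E0(1) by blast
  qed
qed

text \<open>The cycle already uses both edges at each of its vertices, so no edge leaves it, and
  connectedness makes it the whole graph.\<close>

lemma connected_max_degree_2_cycle:
  assumes G: "finite_simple_graph V E" and conn: "connected_graph V E"
    and deg: "\<And>v. vertex_degree E v \<le> 2" and c: "cycle_in E c"
  shows "cycle_graph V E"
proof -
  interpret finite_simple_graph V E by (rule G)
  have finE: "finite E"
    by (rule finite_subset[of E "Pow V"]) (use edge_subset finite_vertices in auto)
  have len: "3 \<le> length c" "distinct c" and sub: "cycle_edges c \<subseteq> E" using c by (auto simp: cycle_in_def)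
  have ne: "c \<noteq> []" using len(1) by auto
  have star: "e \<in> cycle_edges c" if e: "e \<in> E" "x \<in> e" "x \<in> set c" for e x
  proof -
    have "{e \<in> cycle_edges c. x \<in> e} = {e \<in> E. x \<in> e}"
    proof (rule card_seteq)
      show "card {e \<in> E. x \<in> e} \<le> card {e \<in> cycle_edges c. x \<in> e}"
        using deg[of x] vertex_degree_cycle_edges[OF len e(3)] by (simp add: vertex_degree_def)
    qed (use finE sub in auto)
    then show ?thesis using e by blast
  qed
  have cV: "set c \<subseteq> V" using sub edge_subset Union_cycle_edges[OF ne] by blast
  obtain x0 where x0: "x0 \<in> set c" using ne by (meson hd_in_set)
  have step: "y \<in> set c" if xy: "{x, y} \<in> E" "x \<in> set c" for x y
    using star[OF xy(1) _ xy(2)] Union_cycle_edges[OF ne] by blast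
  have "v \<in> set c" if "v \<in> V" for v
  proof -
    have "(x0, v) \<in> {(x, y). {x, y} \<in> E}\<^sup>*" using conn x0 cV that unfolding connected_graph_def by blast
    then show ?thesis by (induction rule: rtrancl_induct) (use x0 step in auto)
  qed
  then have V: "set c = V" using cV by blast
  have "e \<in> cycle_edges c" if e: "e \<in> E" for e
  proof -
    have "e \<noteq> {}" using edge_card[OF e] by auto
    then obtain x where "x \<in> e" by blast
    then show ?thesis using star[OF e] edge_subset[OF e] V by blast
  qed
  then have "cycle_edges c = E" using sub by blast
  then show ?thesis using V c unfolding cycle_graph_def by blast
qed

lemma acyclic_chromatic_index_eqI:
  assumes "colorable k E"
    and "\<And>j col. acyclic_edge_coloring E col \<Longrightarrow> col ` E \<subseteq> {..<j} \<Longrightarrow> k \<le> j"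
  shows "acyclic_chromatic_index E = k"
  unfolding acyclic_chromatic_index_def
proof (rule Least_equality)
  show "\<exists>col. acyclic_edge_coloring E col \<and> col ` E \<subseteq> {..<k}"
    using assms(1) bicycle_free_acyclic unfolding colorable_def by blast
qed (use assms(2) in blast)

theorem theorem1:
  fixes V :: "'a set" and E :: "'a set set"
  assumes "finite_simple_graph V E"
    and "connected_graph V E"
    and "chordless E"
  shows "(\<not> cycle_graph V E \<longrightarrow> acyclic_chromatic_index E = max_degree V E) \<and>
    (cycle_graph V E \<longrightarrow>
       acyclic_chromatic_index E = max_degree V E + 1 \<and> max_degree V E + 1 = 3)"
proof -
  interpret finite_simple_graph V E by (rule assms(1))
  have finE: "finite E"
    by (rule finite_subset[of E "Pow V"]) (use edge_subset finite_vertices in auto)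
  have simple: "simple_edges E" using finE edge_card by (simp add: simple_edges_def)
  have sepE: "edge_separable E" using chordless_edge_separable[OF simple assms(3)] .
  have deg: "vertex_degree E v \<le> max_degree V E" for v
  proof (cases "v \<in> V")
    case True
    then show ?thesis unfolding max_degree_def using finite_vertices by (intro Max_ge) auto
  next
    case False
    then have "vertex_degree E v = 0" using edge_subset by (intro vertex_degree_0) blast
    then show ?thesis by simp
  qed
  have "max_degree V E \<in> vertex_degree E ` V"
    unfolding max_degree_def using finite_vertices nonempty_vertices by (intro Max_in) auto
  then obtain v0 where v0: "max_degree V E = vertex_degree E v0" by blast
  have lower: "max_degree V E \<le> j" if "acyclic_edge_coloring E col" "col ` E \<subseteq> {..<j}" for j col
  proof -
    have "proper_edge_coloring E col" using that(1) by (simp add: acyclic_edge_coloring_def)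
    then have "max_degree V E = card (col ` {e \<in> E. v0 \<in> e})" using proper_card_star v0 by metis
    also have "\<dots> \<le> card {..<j}" using that(2) by (intro card_mono) auto
    finally show ?thesis by simp
  qed
  show ?thesis
  proof (intro conjI impI)
    assume n: "\<not> cycle_graph V E"
    have "colorable (max_degree V E) E"
    proof (cases "3 \<le> max_degree V E")
      case True
      then show ?thesis using colorable_separable[OF _ simple sepE deg] by blast
    next
      case False
      then have "vertex_degree E v \<le> 2" for v using deg[of v] by simp
      then have "\<nexists>c. cycle_in E c" using connected_max_degree_2_cycle[OF assms(1,2)] n by blast
      then show ?thesis using colorable_forest[OF simple _ deg] by blast
    qed
    then show "acyclic_chromatic_index E = max_degree V E"
      using lower by (rule acyclic_chromatic_index_eqI)
  next
    assume "cycle_graph V E"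
    then obtain c where c: "cycle_in E c" "set c = V" "cycle_edges c = E" unfolding cycle_graph_def by blast
    have len: "3 \<le> length c" "distinct c" using c(1) by (auto simp: cycle_in_def)
    have deg2: "vertex_degree E v = 2" if "v \<in> V" for v
      using vertex_degree_cycle_edges[OF len, of v] c(2,3) that by simp
    obtain v where v: "v \<in> V" using nonempty_vertices by blast
    have "vertex_degree E ` V = {2}" using deg2 v by force
    then have max: "max_degree V E = 2" by (simp add: max_degree_def)
    then show "max_degree V E + 1 = 3" by simp
    \<comment> \<open>The general colouring theorem is applied with three colours although the
      maximum degree is 2.\<close>
    have "vertex_degree E v \<le> 3" for v using deg[of v] max by simp
    then have "colorable 3 E"
      using colorable_separable[OF _ simple sepE, of 3] by simp
    \<comment> \<open>With only two colours, both occurring at \<open>v\<close>, the graph itself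
      would be a two-coloured cycle.\<close>
    moreover have "3 \<le> j" if col: "acyclic_edge_coloring E col" "col ` E \<subseteq> {..<j}" for j col
    proof (rule ccontr)
      assume "\<not> 3 \<le> j"
      then have "j = 2" using lower[OF col] max by simp
      then have "card (col ` E) \<le> 2" using card_mono[OF _ col(2)] by simp
      moreover have "card (col ` {e \<in> E. v \<in> e}) = 2"
        using proper_card_star[of E col v] col(1) deg2[OF v] by (simp add: acyclic_edge_coloring_def)
      moreover have "card (col ` {e \<in> E. v \<in> e}) \<le> card (col ` E)"
        using finE by (intro card_mono) auto
      ultimately have "card (col ` cycle_edges c) = 2" using c(3) by simp
      then show False using col(1) c(1) unfolding acyclic_edge_coloring_def by blast
    qed
    ultimately have "acyclic_chromatic_index E = 3" by (rule acyclic_chromatic_index_eqI)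
    then show "acyclic_chromatic_index E = max_degree V E + 1" using max by simp
  qed
qed

end
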